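(* For each $k\in\{2,3,5\}$, we have $g(n,K_3,C_{2k})=\Theta(n^{1+1/k})$ as $n\to\infty$.
   Context: Constructor--Blocker game: given graphs $H$ and $F$, two players, Constructor and Blocker, alternately claim one previously unclaimed edge of the complete graph $K_n$, with Constructor moving first. The graph formed by Constructor's edges must remain $F$-free (contain no subgraph isomorphic to $F$, not necessarily induced) throughout the game, so Constructor may not claim an edge that would create a copy of $F$; Blocker plays without restriction. The game ends when all edges are claimed or Constructor has no legal move. Constructor aims to maximize the number of copies of $H$ (subgraphs isomorphic to $H$) in her final graph and Blocker aims to minimize it; $g(n,H,F)$ denotes this number under optimal play by both players. $C_\ell$ is the cycle of length $\ell$ and $K_3$ the triangle. *)

theory Defs
  imports Complex_Main "HOL-Library.Landau_Symbols"
begin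

text \<open>A simple graph is a pair of a vertex set and a set of two-element subsets of it.\<close>

type_synonym 'a graph = "'a set \<times> 'a set set"

definition simple_graph :: "'a graph \<Rightarrow> bool" where
  "simple_graph G \<longleftrightarrow> (\<forall>e \<in> snd G. e \<subseteq> fst G \<and> card e = 2)"

definition subgraph :: "'a graph \<Rightarrow> 'a graph \<Rightarrow> bool" where
  "subgraph S G \<longleftrightarrow> simple_graph S \<and> fst S \<subseteq> fst G \<and> snd S \<subseteq> snd G"

definition isomorphic :: "'a graph \<Rightarrow> 'b graph \<Rightarrow> bool" where
  "isomorphic G G' \<longleftrightarrow>
     (\<exists>f. bij_betw f (fst G) (fst G') \<and> snd G' = (\<lambda>e. f ` e) ` snd G)"

definition copies :: "'b graph \<Rightarrow> 'a graph \<Rightarrow> 'a graph set" where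
  "copies H G = {S. subgraph S G \<and> isomorphic H S}"

definition free_of :: "'b graph \<Rightarrow> 'a graph \<Rightarrow> bool" where
  "free_of F G \<longleftrightarrow> copies F G = {}"

definition complete_graph :: "nat \<Rightarrow> nat graph" where
  "complete_graph n = ({..<n}, {e. e \<subseteq> {..<n} \<and> card e = 2})"

text \<open>The cycle of length \<open>l\<close>; meaningful for \<open>l \<ge> 3\<close> only.\<close>

definition cycle_graph :: "nat \<Rightarrow> nat graph" where
  "cycle_graph l = ({..<l}, {{i, (i + 1) mod l} | i. i < l})"

lemma simple_complete_graph: "simple_graph (complete_graph n)"
  by (auto simp: simple_graph_def complete_graph_def)

lemma simple_cycle_graph: "l \<ge> 3 \<Longrightarrow> simple_graph (cycle_graph l)"
  by (auto simp: simple_graph_def cycle_graph_def card_insert_if mod_Suc)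

text \<open>In a position, \<open>C\<close> and \<open>B\<close> are the sets of edges of \<open>complete_graph n\<close> claimed so far by
  Constructor and by Blocker.\<close>

datatype player = Constructor | Blocker

definition unclaimed :: "nat \<Rightarrow> nat set set \<Rightarrow> nat set set \<Rightarrow> nat set set" where
  "unclaimed n C B = snd (complete_graph n) - C - B"

definition constructor_moves ::
  "nat \<Rightarrow> 'f graph \<Rightarrow> nat set set \<Rightarrow> nat set set \<Rightarrow> nat set set" where
  "constructor_moves n F C B = {e \<in> unclaimed n C B. free_of F ({..<n}, insert e C)}"

definition game_over :: "nat \<Rightarrow> 'f graph \<Rightarrow> nat set set \<Rightarrow> nat set set \<Rightarrow> bool" where
  "game_over n F C B \<longleftrightarrow> unclaimed n C B = {} \<or> constructor_moves n F C B = {}"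

lemma finite_unclaimed: "finite (unclaimed n C B)"
  unfolding unclaimed_def complete_graph_def by simp

text \<open>The number of copies of \<open>H\<close> in Constructor's final graph when both players play optimally
  from the position \<open>C\<close>, \<open>B\<close> with the given player to move (backward induction). No player may
  pass.\<close>

function game_value ::
  "nat \<Rightarrow> 'h graph \<Rightarrow> 'f graph \<Rightarrow> player \<Rightarrow> nat set set \<Rightarrow> nat set set \<Rightarrow> nat" where
  "game_value n H F Constructor C B =
     (if game_over n F C B then card (copies H ({..<n}, C))
      else Max ((\<lambda>e. game_value n H F Blocker (insert e C) B) ` constructor_moves n F C B))"
| "game_value n H F Blocker C B =
     (if game_over n F C B then card (copies H ({..<n}, C))
      else Min ((\<lambda>e. game_value n H F Constructor C (insert e B)) ` unclaimed n C B))"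
  by pat_completeness auto
termination
proof (relation "measure (\<lambda>(n, H, F, p, C, B). card (unclaimed n C B))", goal_cases)
  case 1
  show ?case by simp
next
  case (2 n H F C B e)
  then have "unclaimed n (insert e C) B \<subset> unclaimed n C B"
    by (auto simp: constructor_moves_def unclaimed_def)
  then show ?case by (simp add: psubset_card_mono finite_unclaimed)
next
  case (3 n H F C B e)
  then have "unclaimed n C (insert e B) \<subset> unclaimed n C B"
    by (auto simp: unclaimed_def)
  then show ?case by (simp add: psubset_card_mono finite_unclaimed)
qed

declare game_value.simps [simp del]

definition g :: "nat \<Rightarrow> 'h graph \<Rightarrow> 'f graph \<Rightarrow> nat" where
  "g n H F = game_value n H F Constructor {} {}"

end

theory Submission
  imports Defs "HOL-Algebra.Algebraic_Closure_Type"
begin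

text \<open>The upper bound holds for every \<open>k \<ge> 2\<close> and for every graph on \<open>n\<close> vertices without a cycle of length
  \<open>2 * k\<close>, however the game is played. Such a graph has \<open>O(n powr (1 + 1 / k))\<close> edges by the theorem of
  Bondy and Simonovits: otherwise it contains a bipartite subgraph of large minimum degree, in which a
  breadth-first search cannot grow by the factor \<open>n powr (1 / k)\<close> in each of \<open>k\<close> steps; so two consecutive
  layers span a subgraph of minimum degree larger than \<open>2 * k\<close>, where a path of suitable length closes up
  through the search tree (\<open>even_cycle_between_layers\<close>). Moreover the neighbourhood of a vertex contains
  no path with \<open>2 * k - 1\<close> vertices, so it spans linearly many edges, and the number of triangles is at
  most a constant times the number of edges.

  For the lower bound Constructor plays items: she claims an edge \<open>x\<close> and then one of two edges \<open>y\<close>, \<open>z\<close>,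
  of which Blocker can take only one. Among disjoint items she completes at least a third
  (\<open>item_phase\<close>).

  For \<open>k \<in> {3, 5}\<close> take a bipartite graph of girth larger than \<open>2 * k\<close> with \<open>q ^ k\<close> vertices on each side and
  \<open>q ^ (k + 1)\<close> edges. Replace the vertices of one side by stars with two leaves, which Constructor claims
  first at negligible cost. Joining a vertex \<open>y\<close> of the other side to the centre of a neighbouring star and
  then to one of its leaves is an item that yields a triangle. The resulting graph contains no cycle of length \<open>2 * k\<close>: the
  projection of such a cycle would be a closed walk of length at most \<open>2 * k\<close>, so it would stay in
  one star, and there all cycles are short (\<open>blow_up_strategy\<close>). The bipartite graphs are given by
  equations over finite fields of characteristic three; for \<open>k = 5\<close> the absence of short cycles comes down to a
  polynomial identity modulo three (\<open>minors_quadratic_form\<close>).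

  For \<open>k = 2\<close> two triangles cannot share an edge. Constructor claims incidences between points and lines of
  a plane over a field with \<open>q\<close> elements. These create of the order of \<open>q ^ 4\<close> pairs of points seen from a
  common line, far too many for Blocker to take. The pairs are distributed over \<open>q\<close> families, each of which
  can be added to the incidences without creating a four-cycle (\<open>no_quadrilateral\<close>). She picks a family
  with of the order of \<open>q ^ 3\<close> free pairs and claims half of them, closing a triangle each time
  (\<open>four_cycle_strategy\<close>).\<close>

section \<open>Cycles and triangles as copies\<close>

definition has_cycle :: "nat \<Rightarrow> 'a set set \<Rightarrow> bool" where
  "has_cycle l E \<longleftrightarrow> (\<exists>v. inj_on v {..<l} \<and> (\<forall>i<l. {v i, v (Suc i mod l)} \<in> E))"

definition triangles :: "'a set set \<Rightarrow> 'a set set" where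
  "triangles E = {T. card T = 3 \<and> (\<forall>x\<in>T. \<forall>y\<in>T. x \<noteq> y \<longrightarrow> {x, y} \<in> E)}"

lemma free_of_cycle_iff:
  fixes E :: "'a set set"
  assumes l: "3 \<le> l" and EV: "\<And>e. e \<in> E \<Longrightarrow> e \<subseteq> V"
  shows "free_of (cycle_graph l) (V, E) \<longleftrightarrow> \<not> has_cycle l E"
proof
  assume free: "free_of (cycle_graph l) (V, E)"
  show "\<not> has_cycle l E"
  proof
    assume "has_cycle l E"
    then obtain v where inj: "inj_on v {..<l}" and adj: "\<And>i. i < l \<Longrightarrow> {v i, v (Suc i mod l)} \<in> E"
      unfolding has_cycle_def by blast
    define S where "S = (v ` {..<l}, {{v i, v (Suc i mod l)} | i. i < l})"
    have "v i \<noteq> v (Suc i mod l)" if "i < l" for i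
      using inj_onD[OF inj, of i "Suc i mod l"] l that by (auto simp: mod_Suc)
    then have "simple_graph S"
      using l by (auto simp: simple_graph_def S_def card_insert_if)
    moreover have "fst S \<subseteq> V"
      using EV[OF adj] by (auto simp: S_def)
    moreover have "snd S \<subseteq> E" using adj by (auto simp: S_def)
    moreover have "isomorphic (cycle_graph l) S"
      unfolding isomorphic_def
    proof (intro exI conjI)
      show "bij_betw v (fst (cycle_graph l)) (fst S)"
        using inj by (simp add: bij_betw_def cycle_graph_def S_def)
      show "snd S = (\<lambda>e. v ` e) ` snd (cycle_graph l)"
      proof -
        have "snd (cycle_graph l) = (\<lambda>i. {i, Suc i mod l}) ` {..<l}"
          by (auto simp: cycle_graph_def)
        moreover have "snd S = (\<lambda>i. {v i, v (Suc i mod l)}) ` {..<l}"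
          by (auto simp: S_def)
        ultimately show ?thesis by (simp add: image_image)
      qed
    qed
    ultimately have "S \<in> copies (cycle_graph l) (V, E)"
      by (simp add: copies_def subgraph_def)
    with free show False by (auto simp: free_of_def)
  qed
next
  assume nc: "\<not> has_cycle l E"
  show "free_of (cycle_graph l) (V, E)"
    unfolding free_of_def
  proof (rule ccontr)
    assume "copies (cycle_graph l) (V, E) \<noteq> {}"
    then obtain S f where S: "snd S \<subseteq> E" and bij: "bij_betw f (fst (cycle_graph l)) (fst S)"
      and sS: "snd S = (\<lambda>e. f ` e) ` snd (cycle_graph l)"
      unfolding copies_def subgraph_def isomorphic_def by auto
    have "{f i, f (Suc i mod l)} \<in> E" if "i < l" for i
    proof -
      have "{i, Suc i mod l} \<in> snd (cycle_graph l)"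
        using that by (auto simp: cycle_graph_def)
      then have "f ` {i, Suc i mod l} \<in> snd S" unfolding sS by (rule imageI)
      then show ?thesis using S by auto
    qed
    moreover have "inj_on f {..<l}"
      using bij by (simp add: bij_betw_def cycle_graph_def)
    ultimately show False using nc unfolding has_cycle_def by blast
  qed
qed

lemma pair_subsets_eq:
  assumes "simple_graph S" "bij_betw f {..<3::nat} (fst S)"
    "snd S = (\<lambda>e. f ` e) ` {e. e \<subseteq> {..<3} \<and> card e = 2}"
  shows "snd S = {e. e \<subseteq> fst S \<and> card e = 2}"
proof
  show "snd S \<subseteq> {e. e \<subseteq> fst S \<and> card e = 2}"
    using assms(1) by (auto simp: simple_graph_def)
  show "{e. e \<subseteq> fst S \<and> card e = 2} \<subseteq> snd S"
  proof clarify
    fix e assume e: "e \<subseteq> fst S" "card e = 2"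
    have im: "f ` {..<3} = fst S" and inj: "inj_on f {..<3}"
      using assms(2) by (auto simp: bij_betw_def)
    obtain e' where e': "e' \<subseteq> {..<3}" "e = f ` e'"
      using e(1) im by (metis subset_imageE)
    then have "card e' = 2"
      using e(2) card_image[OF inj_on_subset[OF inj e'(1)]] by simp
    then show "e \<in> snd S" using e' assms(3) by blast
  qed
qed

lemma card_copies_triangle:
  fixes E :: "'a set set"
  assumes EV: "\<And>e. e \<in> E \<Longrightarrow> e \<subseteq> V"
  shows "card (copies (complete_graph 3) (V, E)) = card (triangles E)"
proof -
  have mem: "S \<in> copies (complete_graph 3) (V, E) \<longleftrightarrow>
      fst S \<in> triangles E \<and> snd S = {e. e \<subseteq> fst S \<and> card e = 2}" for S
  proof
    assume S: "S \<in> copies (complete_graph 3) (V, E)"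
    then obtain f where sub: "simple_graph S" "snd S \<subseteq> E" and f: "bij_betw f {..<3::nat} (fst S)"
      "snd S = (\<lambda>e. f ` e) ` {e. e \<subseteq> {..<3} \<and> card e = 2}"
      by (auto simp: copies_def subgraph_def isomorphic_def complete_graph_def)
    have eq: "snd S = {e. e \<subseteq> fst S \<and> card e = 2}"
      using pair_subsets_eq[OF sub(1) f] .
    moreover have "card (fst S) = 3" using bij_betw_same_card[OF f(1)] by simp
    moreover have "{x, y} \<in> E" if "x \<in> fst S" "y \<in> fst S" "x \<noteq> y" for x y
      using that eq sub(2) by auto
    ultimately show "fst S \<in> triangles E \<and> snd S = {e. e \<subseteq> fst S \<and> card e = 2}"
      by (auto simp: triangles_def)
  next
    assume S: "fst S \<in> triangles E \<and> snd S = {e. e \<subseteq> fst S \<and> card e = 2}"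
    then have c3: "card (fst S) = 3" by (simp add: triangles_def)
    then have fin: "finite (fst S)" using card.infinite by fastforce
    obtain f where f: "bij_betw f {..<3::nat} (fst S)"
      using ex_bij_betw_nat_finite[OF fin] c3 by (auto simp: atLeast0LessThan)
    have inj: "inj_on f {..<3}" and im: "f ` {..<3} = fst S" using f by (auto simp: bij_betw_def)
    have "snd S = (\<lambda>e. f ` e) ` {e. e \<subseteq> {..<3} \<and> card e = 2}"
    proof -
      have "{e. e \<subseteq> f ` {..<3} \<and> card e = 2} = (\<lambda>e. f ` e) ` {e. e \<subseteq> {..<3} \<and> card e = 2}"
      proof (intro equalityI subsetI)
        fix e assume "e \<in> {e. e \<subseteq> f ` {..<3} \<and> card e = 2}"
        then obtain e' where e': "e' \<subseteq> {..<3}" "e = f ` e'" "card e = 2"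
          by (auto elim: subset_imageE)
        then show "e \<in> (\<lambda>e. f ` e) ` {e. e \<subseteq> {..<3} \<and> card e = 2}"
          using card_image[OF inj_on_subset[OF inj e'(1)]] by auto
      next
        fix e assume "e \<in> (\<lambda>e. f ` e) ` {e. e \<subseteq> {..<3} \<and> card e = 2}"
        then show "e \<in> {e. e \<subseteq> f ` {..<3} \<and> card e = 2}"
          using card_image[OF inj_on_subset[OF inj]] by fastforce
      qed
      then show ?thesis using S im by simp
    qed
    then have "isomorphic (complete_graph 3) S"
      using f by (auto simp: isomorphic_def complete_graph_def)
    moreover have "simple_graph S" using S by (simp add: simple_graph_def)
    moreover have sub: "snd S \<subseteq> E"
    proof
      fix e assume "e \<in> snd S"
      then obtain x y where "e = {x, y}" "x \<noteq> y" "x \<in> fst S" "y \<in> fst S"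
        using S by (auto simp: card_2_iff)
      then show "e \<in> E" using S by (auto simp: triangles_def)
    qed
    moreover have "fst S \<subseteq> V"
    proof
      fix x assume x: "x \<in> fst S"
      have "\<not> fst S \<subseteq> {x}"
        using c3 card_mono[of "{x}" "fst S"] by auto
      then obtain y where "y \<in> fst S" "y \<noteq> x" by blast
      then have "{x, y} \<in> E" using x S by (auto simp: triangles_def)
      then show "x \<in> V" using EV by blast
    qed
    ultimately show "S \<in> copies (complete_graph 3) (V, E)"
      by (simp add: copies_def subgraph_def)
  qed
  have "bij_betw fst (copies (complete_graph 3) (V, E)) (triangles E)"
    by (rule bij_betw_byWitness[where f' = "\<lambda>T. (T, {e. e \<subseteq> T \<and> card e = 2})"])
      (auto simp: mem prod_eq_iff)
  then show ?thesis by (rule bij_betw_same_card)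
qed

lemma triangles_mono: "E \<subseteq> E' \<Longrightarrow> triangles E \<subseteq> triangles E'"
  unfolding triangles_def by blast

lemma finite_triangles:
  assumes "\<And>e. e \<in> E \<Longrightarrow> e \<subseteq> V" "finite V"
  shows "finite (triangles E)"
proof (rule finite_subset[OF _ finite_Pow_iff[THEN iffD2, OF assms(2)]])
  show "triangles E \<subseteq> Pow V"
  proof clarify
    fix T x assume T: "T \<in> triangles E" "x \<in> T"
    then have "\<not> T \<subseteq> {x}"
      using card_mono[of "{x}" T] by (auto simp: triangles_def)
    then obtain y where "y \<in> T" "y \<noteq> x" by blast
    then have "{x, y} \<in> E" using T by (auto simp: triangles_def)
    then show "x \<in> V" using assms(1) by blast
  qed
qed

section \<open>Strategies and the value of the game\<close>

abbreviation edges_of :: "nat \<Rightarrow> nat set set" where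
  "edges_of n \<equiv> snd (complete_graph n)"

lemma edges_ofD: "e \<in> edges_of n \<Longrightarrow> e \<subseteq> {..<n}"
  by (simp add: complete_graph_def)

lemma constructor_moves_finite: "finite (constructor_moves n F C B)"
  unfolding constructor_moves_def using finite_unclaimed by simp

lemma game_value_over:
  "game_over n F C B \<Longrightarrow> game_value n H F p C B = card (copies H ({..<n}, C))"
  by (cases p; hypsubst; subst game_value.simps) simp_all

lemma game_value_Constructor:
  "\<not> game_over n F C B \<Longrightarrow> game_value n H F Constructor C B =
     Max ((\<lambda>e. game_value n H F Blocker (insert e C) B) ` constructor_moves n F C B)"
  by (subst game_value.simps) simp

lemma game_value_Blocker:
  "\<not> game_over n F C B \<Longrightarrow> game_value n H F Blocker C B =
     Min ((\<lambda>e. game_value n H F Constructor C (insert e B)) ` unclaimed n C B)"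
  by (subst game_value.simps) simp

lemma game_value_constructor_move:
  assumes "e \<in> constructor_moves n F C B"
    and "m \<le> game_value n H F Blocker (insert e C) B"
  shows "m \<le> game_value n H F Constructor C B"
proof -
  have "\<not> game_over n F C B"
    using assms(1) by (auto simp: game_over_def constructor_moves_def)
  moreover have "game_value n H F Blocker (insert e C) B
      \<le> Max ((\<lambda>e. game_value n H F Blocker (insert e C) B) ` constructor_moves n F C B)"
    using assms(1) by (intro Max_ge finite_imageI constructor_moves_finite imageI)
  ultimately show ?thesis using assms(2) by (simp add: game_value_Constructor)
qed

text \<open>Edges are never given back, so triangles already claimed survive all later moves. A strategy may
  therefore stop as soon as enough triangles have been claimed.\<close>

lemma game_value_ge_current:
  assumes "C \<subseteq> edges_of n"
  shows "card (triangles C) \<le> game_value n (complete_graph 3) F p C B"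
  using assms
proof (induction n "complete_graph 3" F p C B rule: game_value.induct)
  case (1 n F C B)
  have cc: "card (copies (complete_graph 3) ({..<n}, C)) = card (triangles C)"
    using 1 edges_ofD by (intro card_copies_triangle) blast
  show ?case
  proof (cases "game_over n F C B")
    case True
    then show ?thesis by (simp add: game_value_over cc)
  next
    case False
    then obtain e where e: "e \<in> constructor_moves n F C B"
      by (auto simp: game_over_def)
    then have sub: "insert e C \<subseteq> edges_of n"
      using 1 by (auto simp: constructor_moves_def unclaimed_def)
    have "card (triangles C) \<le> card (triangles (insert e C))"
      using sub edges_ofD
      by (intro card_mono triangles_mono finite_triangles[of _ "{..<n}"]) blast+
    also have "\<dots> \<le> game_value n (complete_graph 3) F Blocker (insert e C) B"
      using 1(1)[OF False e] sub by simp
    finally show ?thesis by (rule game_value_constructor_move[OF e])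
  qed
next
  case (2 n F C B)
  have cc: "card (copies (complete_graph 3) ({..<n}, C)) = card (triangles C)"
    using 2 edges_ofD by (intro card_copies_triangle) blast
  show ?case
  proof (cases "game_over n F C B")
    case True
    then show ?thesis by (simp add: game_value_over cc)
  next
    case False
    then have "unclaimed n C B \<noteq> {}" by (auto simp: game_over_def)
    then show ?thesis
      using False 2(1)[OF False _ 2(2)] finite_unclaimed
      by (subst game_value_Blocker[OF False]) (intro Min.boundedI, auto)
  qed
qed

text \<open>A game that has ended behaves as if Blocker had passed; so a strategy only has to deal with
  all positions in which Blocker has claimed at most one further edge.\<close>

lemma game_value_blocker_move:
  assumes "\<And>B'. B \<subseteq> B' \<Longrightarrow> finite B' \<Longrightarrow> card B' \<le> Suc (card B) \<Longrightarrow> m \<le> game_value n H F Constructor C B'"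
    and "finite B"
  shows "m \<le> game_value n H F Blocker C B"
proof (cases "game_over n F C B")
  case True
  have "m \<le> game_value n H F Constructor C B" using assms by simp
  then show ?thesis using True by (simp add: game_value_over)
next
  case False
  then have "unclaimed n C B \<noteq> {}" by (auto simp: game_over_def)
  moreover have "m \<le> game_value n H F Constructor C (insert f B)" for f
    using assms by (intro assms(1)) (auto simp: card_insert_if)
  ultimately show ?thesis
    using finite_unclaimed by (subst game_value_Blocker[OF False]) (intro Min.boundedI, auto)
qed

lemma free_of_mono:
  assumes "free_of F (V, C')" "C \<subseteq> C'"
  shows "free_of F (V, C)"
proof -
  have "copies F (V, C) \<subseteq> copies F (V, C')"
    using assms(2) by (auto simp: copies_def subgraph_def)
  then show ?thesis using assms(1) by (simp add: free_of_def)
qed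

lemma game_value_constructor_round:
  assumes "e \<in> edges_of n" "e \<notin> C" "e \<notin> B" "free_of F ({..<n}, insert e C)" "finite B"
    and "\<And>B'. B \<subseteq> B' \<Longrightarrow> finite B' \<Longrightarrow> card B' \<le> Suc (card B)
           \<Longrightarrow> m \<le> game_value n H F Constructor (insert e C) B'"
  shows "m \<le> game_value n H F Constructor C B"
proof (rule game_value_constructor_move)
  show "e \<in> constructor_moves n F C B"
    using assms(1-4) by (simp add: constructor_moves_def unclaimed_def)
  show "m \<le> game_value n H F Blocker (insert e C) B"
    using assms(5,6) by (intro game_value_blocker_move)
qed

text \<open>A phase in which Constructor simply claims edges from a pool: each round costs her at most
  two of them.\<close>

lemma single_edge_phase:
  fixes x :: "'i \<Rightarrow> nat set"
  assumes "finite I" "inj_on x I" "x ` I \<subseteq> edges_of n" "x ` I \<inter> (C \<union> B) = {}" "finite B"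
    and "\<forall>S\<subseteq>I. free_of F ({..<n}, C \<union> x ` S)"
    and "\<forall>S\<subseteq>I. card I \<le> 2 * card S \<longrightarrow> (\<forall>B'. m \<le> game_value n H F Constructor (C \<union> x ` S) B')"
  shows "m \<le> game_value n H F Constructor C B"
  using assms
proof (induction "card I" arbitrary: I C B rule: less_induct)
  case less
  show ?case
  proof (cases "I = {}")
    case True
    then show ?thesis using less.prems(7)[rule_format, of "{}" B] by simp
  next
    case False
    then obtain i where i: "i \<in> I" by blast
    show ?thesis
    proof (rule game_value_constructor_round[of "x i"])
      show "free_of F ({..<n}, insert (x i) C)" using less.prems(6)[rule_format, of "{i}"] i by simp
    next
      fix B' assume B': "B \<subseteq> B'" "finite B'" "card B' \<le> Suc (card B)"
      define I' where "I' = {j \<in> I - {i}. x j \<notin> B'}"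
      have sub: "I' \<subseteq> I" "i \<notin> I'" by (auto simp: I'_def)
      have fin: "finite I'" using less.prems(1) sub finite_subset by blast
      have "card (x ` {j \<in> I. x j \<in> B'}) \<le> card (B' - B)"
        using less.prems(4) B' by (intro card_mono) auto
      also have "\<dots> \<le> 1" using B' less.prems(5) by (simp add: card_Diff_subset)
      finally have "card {j \<in> I. x j \<in> B'} \<le> 1"
        using less.prems(2) by (subst (asm) card_image) (auto intro: inj_on_subset)
      moreover have "I \<subseteq> insert i (I' \<union> {j \<in> I. x j \<in> B'})" by (auto simp: I'_def)
      then have "card I \<le> card (insert i (I' \<union> {j \<in> I. x j \<in> B'}))"
        using less.prems(1) fin by (intro card_mono) auto
      moreover have "card (insert i (I' \<union> {j \<in> I. x j \<in> B'})) \<le> Suc (card I' + card {j \<in> I. x j \<in> B'})"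
        using card_Un_le[of I' "{j \<in> I. x j \<in> B'}"] fin less.prems(1) by (simp add: card_insert_if)
      ultimately have cI: "card I \<le> card I' + 2" by linarith
      have less': "card I' < card I"
        using sub i less.prems(1) by (intro psubset_card_mono) auto
      show "m \<le> game_value n H F Constructor (insert (x i) C) B'"
      proof (rule less.hyps[OF less' fin])
        show "inj_on x I'" using less.prems(2) sub(1) inj_on_subset by blast
        show "x ` I' \<subseteq> edges_of n" using less.prems(3) sub(1) by blast
        show "x ` I' \<inter> (insert (x i) C \<union> B') = {}"
          using less.prems(2,4) sub i by (auto simp: I'_def dest: inj_onD)
        show "finite B'" by fact
        show "\<forall>S\<subseteq>I'. free_of F ({..<n}, insert (x i) C \<union> x ` S)"
        proof (intro allI impI)
          fix S assume "S \<subseteq> I'"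
          then show "free_of F ({..<n}, insert (x i) C \<union> x ` S)"
            using less.prems(6)[rule_format, of "insert i S"] i sub(1) by auto
        qed
        show "\<forall>S\<subseteq>I'. card I' \<le> 2 * card S \<longrightarrow>
            (\<forall>B''. m \<le> game_value n H F Constructor (insert (x i) C \<union> x ` S) B'')"
        proof (intro allI impI)
          fix S B'' assume S: "S \<subseteq> I'" "card I' \<le> 2 * card S"
          have "card (insert i S) = Suc (card S)"
            using S(1) sub(2) fin finite_subset by (subst card_insert_disjoint) auto
          then show "m \<le> game_value n H F Constructor (insert (x i) C \<union> x ` S) B''"
            using less.prems(7)[rule_format, of "insert i S" B''] S sub i cI by auto
        qed
      qed
    next
      show "x i \<in> edges_of n" "x i \<notin> C" "x i \<notin> B" using i less.prems(3,4) by blast+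
      show "finite B" by fact
    qed
  qed
qed

lemma card_hit_le:
  fixes T :: "'i \<Rightarrow> 'b set"
  assumes "finite D" and "\<forall>i\<in>I. \<forall>j\<in>I. i \<noteq> j \<longrightarrow> T i \<inter> T j = {}"
  shows "card {i \<in> I. T i \<inter> D \<noteq> {}} \<le> card D"
proof -
  let ?hit = "{i \<in> I. T i \<inter> D \<noteq> {}}"
  have "\<forall>i\<in>?hit. \<exists>f. f \<in> T i \<inter> D" by blast
  from bchoice[OF this] obtain p where p: "\<And>i. i \<in> ?hit \<Longrightarrow> p i \<in> T i \<inter> D" by blast
  have "inj_on p ?hit"
  proof (rule inj_onI, rule ccontr)
    fix i j assume ij: "i \<in> ?hit" "j \<in> ?hit" "p i = p j" "i \<noteq> j"
    then have "T i \<inter> T j = {}" using assms(2) by simp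
    then show False using p[OF ij(1)] p[OF ij(2)] ij(3) by auto
  qed
  moreover have "p ` ?hit \<subseteq> D" using p by blast
  ultimately show ?thesis using assms(1) by (intro card_inj_on_le)
qed

text \<open>In an item \<open>(x i; y i, z i)\<close> Constructor claims \<open>x i\<close>, after which Blocker can prevent
  only one of \<open>y i\<close> and \<open>z i\<close>. Completing an item costs her at most two further items,
  those which Blocker touches with his two replies.\<close>

lemma item_phase:
  fixes x y z :: "'i \<Rightarrow> nat set"
  assumes "finite I"
    and "\<And>i. i \<in> I \<Longrightarrow> {x i, y i, z i} \<subseteq> edges_of n"
    and "\<And>i. i \<in> I \<Longrightarrow> {x i, y i, z i} \<inter> (C \<union> B) = {}"
    and "\<And>i. i \<in> I \<Longrightarrow> x i \<noteq> y i \<and> x i \<noteq> z i \<and> y i \<noteq> z i"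
    and "\<And>i j. i \<in> I \<Longrightarrow> j \<in> I \<Longrightarrow> i \<noteq> j \<Longrightarrow> {x i, y i, z i} \<inter> {x j, y j, z j} = {}"
    and "finite B"
    and "\<forall>S\<subseteq>I. \<forall>w. (\<forall>i\<in>S. w i \<in> {y i, z i}) \<longrightarrow> free_of F ({..<n}, C \<union> x ` S \<union> w ` S)"
    and "\<forall>S\<subseteq>I. \<forall>w B'. (\<forall>i\<in>S. w i \<in> {y i, z i}) \<longrightarrow> card I \<le> 3 * card S
           \<longrightarrow> finite B' \<longrightarrow> card B' \<le> card B + 2 * card S
           \<longrightarrow> m \<le> game_value n H F Constructor (C \<union> x ` S \<union> w ` S) B'"
  shows "m \<le> game_value n H F Constructor C B"
  using assms
proof (induction "card I" arbitrary: I C B rule: less_induct)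
  case less
  note prems = less.prems
  show ?case
  proof (cases "I = {}")
    case True
    then show ?thesis using prems(8)[rule_format, of "{}" y B] prems(6) by simp
  next
    case False
    then obtain i where i: "i \<in> I" by blast
    show ?thesis
    proof (rule game_value_constructor_round[of "x i"])
      show "x i \<in> edges_of n" "x i \<notin> C" "x i \<notin> B" using prems(2,3)[OF i] by blast+
      show "finite B" by fact
      have "free_of F ({..<n}, C \<union> x ` {i} \<union> y ` {i})" using i by (intro prems(7)[rule_format]) auto
      then show "free_of F ({..<n}, insert (x i) C)" by (rule free_of_mono) auto
    next
      fix B1 assume B1: "B \<subseteq> B1" "finite B1" "card B1 \<le> Suc (card B)"
      have "card (B1 - B) \<le> 1" using B1 prems(6) by (simp add: card_Diff_subset)
      then have one: "a = b" if "a \<in> B1 - B" "b \<in> B1 - B" for a b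
        using that B1(2) by (metis card_le_Suc0_iff_eq finite_Diff One_nat_def)
      have "\<not> (y i \<in> B1 \<and> z i \<in> B1)"
        using one[of "y i" "z i"] prems(3,4)[OF i] by blast
      then obtain e where e: "e \<in> {y i, z i}" "e \<notin> B1" by blast
      show "m \<le> game_value n H F Constructor (insert (x i) C) B1"
      proof (rule game_value_constructor_round[of e])
        show "e \<in> edges_of n" "e \<notin> insert (x i) C" "e \<notin> B1"
          using e prems(2,3,4)[OF i] by blast+
        show "finite B1" by fact
        have "free_of F ({..<n}, C \<union> x ` {i} \<union> (\<lambda>_. e) ` {i})"
          using i e by (intro prems(7)[rule_format]) auto
        then show "free_of F ({..<n}, insert e (insert (x i) C))" by (rule free_of_mono) auto
      next
        fix B2 assume B2: "B1 \<subseteq> B2" "finite B2" "card B2 \<le> Suc (card B1)"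
        define hit where "hit = {j \<in> I. {x j, y j, z j} \<inter> B2 \<noteq> {}}"
        define I' where "I' = I - {i} - hit"
        define C' where "C' = C \<union> {x i, e}"
        have sub: "I' \<subseteq> I" "i \<notin> I'" by (auto simp: I'_def)
        have fin: "finite I'" "finite hit" using prems(1) by (auto simp: I'_def hit_def)
        have cB2: "card (B2 - B) \<le> 2"
          using B1 B2 prems(6) by (simp add: card_Diff_subset)
        have "hit = {j \<in> I. {x j, y j, z j} \<inter> (B2 - B) \<noteq> {}}"
          using prems(3) unfolding hit_def by blast
        then have "card hit \<le> card (B2 - B)"
          using B2(2) prems(5) by (simp only:) (intro card_hit_le, auto)
        moreover have "card I \<le> Suc (card I' + card hit)"
        proof -
          have "card I \<le> card (insert i (I' \<union> hit))"
            using fin by (intro card_mono) (auto simp: I'_def)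
          also have "\<dots> \<le> Suc (card (I' \<union> hit))" by (rule card_insert_le_m1) auto
          also have "\<dots> \<le> Suc (card I' + card hit)" using card_Un_le[of I' hit] by simp
          finally show ?thesis .
        qed
        ultimately have cI: "card I \<le> card I' + 3" using cB2 by linarith
        have less': "card I' < card I"
          using sub i prems(1) by (intro psubset_card_mono) auto
        have ex: "\<exists>w'. (\<forall>j\<in>insert i S. w' j \<in> {y j, z j}) \<and>
            C' \<union> x ` S \<union> w ` S = C \<union> x ` insert i S \<union> w' ` insert i S"
          if "S \<subseteq> I'" "\<forall>j\<in>S. w j \<in> {y j, z j}" for S w
        proof (intro exI conjI ballI)
          fix j assume "j \<in> insert i S"
          then show "(w(i := e)) j \<in> {y j, z j}" using that(2) e(1) by auto
        next
          have "(w(i := e)) ` S = w ` S" using that(1) sub(2) by (intro image_cong) auto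
          then show "C' \<union> x ` S \<union> w ` S = C \<union> x ` insert i S \<union> (w(i := e)) ` insert i S"
            by (simp add: C'_def) blast
        qed
        have "m \<le> game_value n H F Constructor C' B2"
        proof (rule less.hyps[OF less' fin(1)])
          show "finite B2" by fact
          fix j assume j: "j \<in> I'"
          then have jI: "j \<in> I" "j \<noteq> i" "j \<notin> hit" by (auto simp: I'_def)
          show "{x j, y j, z j} \<subseteq> edges_of n" by (rule prems(2)[OF jI(1)])
          show "x j \<noteq> y j \<and> x j \<noteq> z j \<and> y j \<noteq> z j" by (rule prems(4)[OF jI(1)])
          have "{x j, y j, z j} \<inter> {x i, y i, z i} = {}" by (rule prems(5)[OF jI(1) i jI(2)])
          moreover have "{x j, y j, z j} \<inter> (C \<union> B) = {}" by (rule prems(3)[OF jI(1)])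
          moreover have "{x j, y j, z j} \<inter> B2 = {}" using jI by (simp add: hit_def)
          ultimately show "{x j, y j, z j} \<inter> (C' \<union> B2) = {}"
            using e(1) unfolding C'_def by blast
        next
          show "{x j, y j, z j} \<inter> {x l, y l, z l} = {}" if "j \<in> I'" "l \<in> I'" "j \<noteq> l" for j l
            using that sub(1) by (intro prems(5)) auto
        next
          show "\<forall>S\<subseteq>I'. \<forall>w. (\<forall>j\<in>S. w j \<in> {y j, z j}) \<longrightarrow>
              free_of F ({..<n}, C' \<union> x ` S \<union> w ` S)"
          proof (intro allI impI)
            fix S w assume S: "S \<subseteq> I'" "\<forall>j\<in>S. w j \<in> {y j, z j}"
            from ex[OF S] obtain w' where w': "\<forall>j\<in>insert i S. w' j \<in> {y j, z j}"
              "C' \<union> x ` S \<union> w ` S = C \<union> x ` insert i S \<union> w' ` insert i S" by blast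
            have "insert i S \<subseteq> I" using S(1) sub i by blast
            then show "free_of F ({..<n}, C' \<union> x ` S \<union> w ` S)"
              unfolding w'(2) using w'(1) prems(7) by blast
          qed
        next
          show "\<forall>S\<subseteq>I'. \<forall>w B'. (\<forall>j\<in>S. w j \<in> {y j, z j}) \<longrightarrow> card I' \<le> 3 * card S
              \<longrightarrow> finite B' \<longrightarrow> card B' \<le> card B2 + 2 * card S
              \<longrightarrow> m \<le> game_value n H F Constructor (C' \<union> x ` S \<union> w ` S) B'"
          proof (intro allI impI)
            fix S w and B' :: "nat set set"
            assume S: "S \<subseteq> I'" "\<forall>j\<in>S. w j \<in> {y j, z j}"
              and c: "card I' \<le> 3 * card S" "finite B'" "card B' \<le> card B2 + 2 * card S"
            from ex[OF S] obtain w' where w': "\<forall>j\<in>insert i S. w' j \<in> {y j, z j}"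
              "C' \<union> x ` S \<union> w ` S = C \<union> x ` insert i S \<union> w' ` insert i S" by blast
            have cS: "card (insert i S) = Suc (card S)"
              using S(1) sub(2) fin finite_subset by (subst card_insert_disjoint) auto
            show "m \<le> game_value n H F Constructor (C' \<union> x ` S \<union> w ` S) B'"
              unfolding w'(2)
            proof (rule prems(8)[rule_format])
              show "insert i S \<subseteq> I" using S(1) sub i by blast
              show "w' j \<in> {y j, z j}" if "j \<in> insert i S" for j using w'(1) that by blast
              show "card I \<le> 3 * card (insert i S)" using cS cI c(1) by simp
              show "finite B'" by fact
              show "card B' \<le> card B + 2 * card (insert i S)"
                using cS c(3) B1(3) B2(3) by simp
            qed
          qed
        qed
        moreover have "insert e (insert (x i) C) = C'" by (auto simp: C'_def)
        ultimately show "m \<le> game_value n H F Constructor (insert e (insert (x i) C)) B2" by simp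
      qed
    qed
  qed
qed

section \<open>Even cycles in graphs with many edges\<close>

text \<open>In this part a graph is a symmetric irreflexive relation, so that passing to an induced subgraph
  only changes the set of vertices.\<close>

definition degree_sum :: "('a \<Rightarrow> 'a \<Rightarrow> bool) \<Rightarrow> 'a set \<Rightarrow> nat" where
  "degree_sum adj V = (\<Sum>v\<in>V. card {u \<in> V. adj v u})"

definition cycle_in :: "('a \<Rightarrow> 'a \<Rightarrow> bool) \<Rightarrow> 'a set \<Rightarrow> nat \<Rightarrow> bool" where
  "cycle_in adj V l \<longleftrightarrow> (\<exists>p. p \<noteq> [] \<and> distinct p \<and> set p \<subseteq> V \<and> length p = l \<and>
     successively adj p \<and> adj (last p) (hd p))"

lemma cycle_in_mono: "cycle_in adj V l \<Longrightarrow> V \<subseteq> V' \<Longrightarrow> cycle_in adj V' l"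
  unfolding cycle_in_def by blast

lemma cycle_in_mono_adj:
  assumes "cycle_in adj V l" "\<And>u v. adj u v \<Longrightarrow> adj' u v"
  shows "cycle_in adj' V l"
proof -
  have "successively adj' p" if "successively adj p" for p
    using that by (rule successively_mono) (rule assms(2))
  then show ?thesis using assms unfolding cycle_in_def by blast
qed

lemma degree_sum_insert:
  assumes "finite V" "x \<notin> V" and sym: "\<And>u v. adj u v \<Longrightarrow> adj v u" and irr: "\<And>v. \<not> adj v v"
  shows "degree_sum adj (insert x V) = degree_sum adj V + 2 * card {u \<in> V. adj x u}"
proof -
  have "card {u \<in> insert x V. adj v u} = card {u \<in> V. adj v u} + (if adj v x then 1 else 0)"
    if "v \<in> V" for v
  proof (cases "adj v x")
    case True
    then have "{u \<in> insert x V. adj v u} = insert x {u \<in> V. adj v u}" by auto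
    then show ?thesis using True assms(1,2) by simp
  next
    case False
    then have "{u \<in> insert x V. adj v u} = {u \<in> V. adj v u}" by auto
    then show ?thesis using False by simp
  qed
  then have "(\<Sum>v\<in>V. card {u \<in> insert x V. adj v u})
      = degree_sum adj V + (\<Sum>v\<in>V. if adj v x then 1 else 0)"
    by (simp add: degree_sum_def sum.distrib)
  also have "(\<Sum>v\<in>V. if adj v x then 1 else 0) = card {u \<in> V. adj x u}"
  proof -
    have "{u \<in> V. adj u x} = {u \<in> V. adj x u}" using sym by blast
    then show ?thesis using assms(1) by (simp add: sum.If_cases Int_def)
  qed
  moreover have "{u \<in> insert x V. adj x u} = {u \<in> V. adj x u}" using irr by auto
  ultimately show ?thesis
    using assms(1,2) by (simp add: degree_sum_def)
qed

text \<open>Deleting vertices of degree at most \<open>D\<close> one after the other costs too little to use up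
  all edges.\<close>

lemma min_degree_core:
  assumes "finite V" and sym: "\<And>u v. adj u v \<Longrightarrow> adj v u" and irr: "\<And>v. \<not> adj v v"
    and "2 * D * card V < degree_sum adj V"
  shows "\<exists>W\<subseteq>V. W \<noteq> {} \<and> (\<forall>v\<in>W. D < card {u \<in> W. adj v u})"
  using assms(1,4)
proof (induction "card V" arbitrary: V)
  case 0
  then show ?case by (simp add: degree_sum_def)
next
  case (Suc m)
  show ?case
  proof (cases "\<forall>v\<in>V. D < card {u \<in> V. adj v u}")
    case True
    then show ?thesis using Suc(2) by (intro exI[of _ V]) auto
  next
    case False
    then obtain x where x: "x \<in> V" "card {u \<in> V. adj x u} \<le> D" by force
    define V' where "V' = V - {x}"
    have V: "V = insert x V'" "x \<notin> V'" "finite V'" using x Suc(3) by (auto simp: V'_def)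
    have "{u \<in> V'. adj x u} = {u \<in> V. adj x u}" using irr by (auto simp: V'_def)
    then have "degree_sum adj V \<le> degree_sum adj V' + 2 * D"
      using degree_sum_insert[where adj = adj, OF V(3,2) sym irr] V(1) x(2) by simp
    moreover have "card V = Suc (card V')" using V by simp
    ultimately have "2 * D * card V' < degree_sum adj V'" using Suc(4) by (simp add: algebra_simps)
    moreover have "m = card V'" using Suc(2) \<open>card V = Suc (card V')\<close> by simp
    ultimately obtain W where "W \<subseteq> V'" "W \<noteq> {}" "\<forall>v\<in>W. D < card {u \<in> W. adj v u}"
      using Suc(1)[of V'] V(3) by blast
    then show ?thesis using V(1) by blast
  qed
qed

text \<open>Colour the vertices one after the other, each time with the colour that is rarer among the
  neighbours coloured so far.\<close>

lemma half_of_edges_bipartite: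
  assumes "finite V" and sym: "\<And>u v. adj u v \<Longrightarrow> adj v u" and irr: "\<And>v. \<not> adj v v"
  shows "\<exists>col :: 'a \<Rightarrow> bool. degree_sum adj V \<le> 2 * degree_sum (\<lambda>u v. adj u v \<and> col u \<noteq> col v) V"
  using assms(1)
proof (induction V)
  case empty
  then show ?case by (simp add: degree_sum_def)
next
  case (insert x V)
  then obtain col :: "'a \<Rightarrow> bool" where
    col: "degree_sum adj V \<le> 2 * degree_sum (\<lambda>u v. adj u v \<and> col u \<noteq> col v) V" by blast
  define T where "T b = {u \<in> V. adj x u \<and> col u \<noteq> b}" for b
  have "{u \<in> V. adj x u} = T True \<union> T False" by (auto simp: T_def)
  then have "card {u \<in> V. adj x u} \<le> card (T True) + card (T False)"
    using card_Un_le by metis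
  then have "\<exists>b. card {u \<in> V. adj x u} \<le> 2 * card (T b)"
    by (cases "card (T True) \<le> card (T False)") (auto intro: exI[of _ True] exI[of _ False])
  then obtain b where b: "card {u \<in> V. adj x u} \<le> 2 * card (T b)" by blast
  define col' where "col' = col(x := b)"
  have eq: "degree_sum (\<lambda>u v. adj u v \<and> col' u \<noteq> col' v) V
      = degree_sum (\<lambda>u v. adj u v \<and> col u \<noteq> col v) V"
    unfolding degree_sum_def col'_def using insert(2)
    by (intro sum.cong refl arg_cong[where f = card]) auto
  have "{u \<in> V. adj x u \<and> col' x \<noteq> col' u} = T b"
    using insert(2) by (auto simp: T_def col'_def)
  then have "degree_sum (\<lambda>u v. adj u v \<and> col' u \<noteq> col' v) (insert x V)
      = degree_sum (\<lambda>u v. adj u v \<and> col u \<noteq> col v) V + 2 * card (T b)"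
    using degree_sum_insert[OF insert(1,2), of "\<lambda>u v. adj u v \<and> col' u \<noteq> col' v"] sym irr eq by auto
  moreover have "degree_sum adj (insert x V) = degree_sum adj V + 2 * card {u \<in> V. adj x u}"
    by (rule degree_sum_insert[where adj = adj, OF insert(1,2) sym irr])
  ultimately show ?case using b col by (intro exI[of _ col']) simp
qed

text \<open>Greedily: the last vertex of a path always has a neighbour outside the path and outside \<open>Z\<close>.\<close>

lemma path_of_min_degree:
  assumes "finite W" "\<And>v. v \<in> W \<Longrightarrow> D < card {u \<in> W. adj v u}" and irr: "\<And>v. \<not> adj v v"
    and "a \<in> W" "finite Z" "a \<notin> Z" "card Z + l \<le> D"
  shows "\<exists>p. length p = Suc l \<and> distinct p \<and> set p \<subseteq> W - Z \<and> hd p = a \<and> successively adj p"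
  using assms(7)
proof (induction l)
  case 0
  then show ?case using assms(4,6) by (intro exI[of _ "[a]"]) auto
next
  case (Suc l)
  then obtain p where p: "length p = Suc l" "distinct p" "set p \<subseteq> W - Z" "hd p = a" "successively adj p"
    by auto
  then have ne: "p \<noteq> []" by auto
  define z where "z = last p"
  have zp: "z \<in> set p" using ne by (simp add: z_def)
  have "card (Z \<union> (set p - {z})) \<le> card Z + l"
  proof -
    have "card (set p - {z}) = l" using p zp by (simp add: distinct_card)
    then show ?thesis using card_Un_le[of Z "set p - {z}"] by simp
  qed
  also have "\<dots> < card {u \<in> W. adj z u}"
    using assms(2)[of z] zp p(3) Suc(2) by auto
  finally have "\<not> {u \<in> W. adj z u} \<subseteq> Z \<union> (set p - {z})"
    using assms(5) by (meson card_mono finite_Diff finite_UnI finite_set leD)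
  then obtain u where u: "u \<in> W" "adj z u" "u \<notin> Z" "u \<notin> set p - {z}" by blast
  then have "u \<notin> set p" using irr by auto
  then show ?case
    using p u ne by (intro exI[of _ "p @ [u]"]) (auto simp: successively_append_iff z_def)
qed

lemma successively_map_upt:
  assumes "\<And>j. m \<le> j \<Longrightarrow> Suc j < n \<Longrightarrow> P (f j) (f (Suc j))"
  shows "successively P (map f [m..<n])"
  using assms by (auto simp: successively_conv_nth)

text \<open>The layers of a breadth-first search, with the edges \<open>v, par v\<close> of a search tree.\<close>

locale layered_graph =
  fixes adj :: "'a \<Rightarrow> 'a \<Rightarrow> bool" and L :: "nat \<Rightarrow> 'a set" and par :: "'a \<Rightarrow> 'a" and r :: 'a
  assumes sym: "adj u v \<Longrightarrow> adj v u" and irr: "\<not> adj v v"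
    and root: "L 0 = {r}"
    and disj: "i \<noteq> j \<Longrightarrow> L i \<inter> L j = {}"
    and par: "v \<in> L (Suc i) \<Longrightarrow> par v \<in> L i" "v \<in> L (Suc i) \<Longrightarrow> adj v (par v)"
begin

lemma ancestor_layer: "v \<in> L i \<Longrightarrow> j \<le> i \<Longrightarrow> (par ^^ j) v \<in> L (i - j)"
proof (induction j)
  case (Suc j)
  then have "(par ^^ j) v \<in> L (Suc (i - Suc j))" by (simp add: Suc_diff_Suc)
  then show ?case using par(1) by simp
qed simp

lemma ancestor_adj: "v \<in> L i \<Longrightarrow> Suc j \<le> i \<Longrightarrow> adj ((par ^^ j) v) ((par ^^ Suc j) v)"
  using ancestor_layer[of v i j] par(2)[of "(par ^^ j) v" "i - Suc j"] by (simp add: Suc_diff_Suc)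

lemma ancestor_root: "v \<in> L i \<Longrightarrow> (par ^^ i) v = r"
  using ancestor_layer[of v i i] root by simp

lemma layer_unique: "v \<in> L i \<Longrightarrow> v \<in> L j \<Longrightarrow> i = j"
  using disj by blast

text \<open>Two vertices of a layer whose first common ancestor lies \<open>h\<close> levels up are joined through
  the tree by a path with \<open>2 * h - 1\<close> inner vertices, all of them in lower layers.\<close>

lemma close_up_through_tree:
  assumes x: "x \<in> L i" and d: "d \<in> L i" and h: "0 < h" "h \<le> i"
    and meet: "(par ^^ h) x = (par ^^ h) d" and before: "(par ^^ (h - 1)) x \<noteq> (par ^^ (h - 1)) d"
    and p: "p \<noteq> []" "distinct p" "set p \<subseteq> L i \<union> L (Suc i)" "successively adj p" "hd p = d" "last p = x"
  shows "cycle_in adj (\<Union>j. L j) (length p + 2 * h - 1)"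
proof -
  define up where "up = map (\<lambda>j. (par ^^ j) x) [1..<Suc h]"
  define down where "down = rev (map (\<lambda>j. (par ^^ j) d) [1..<h])"
  have apart: "(par ^^ j) x \<noteq> (par ^^ j) d" if "j \<le> h - 1" for j
  proof
    assume eq: "(par ^^ j) x = (par ^^ j) d"
    have "h - 1 = (h - 1 - j) + j" using that by simp
    then have "(par ^^ (h - 1)) v = (par ^^ (h - 1 - j)) ((par ^^ j) v)" for v
      by (metis comp_apply funpow_add)
    with eq before show False by simp
  qed
  have upL: "(par ^^ j) u \<in> L (i - j)" if "u \<in> {x, d}" "j \<le> h" for j u
    using ancestor_layer[of u i j] x d h that by auto
  have same: "j = j'" if "(par ^^ j) u = (par ^^ j') v" "u \<in> {x, d}" "v \<in> {x, d}" "j \<le> h" "j' \<le> h"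
    for j j' u v
  proof -
    have "i - j = i - j'"
      using upL[OF that(2,4)] upL[OF that(3,5)] unfolding that(1) by (rule layer_unique)
    then show ?thesis using that(4,5) h(2) by simp
  qed
  have low: "(par ^^ j) u \<notin> set p" if "u \<in> {x, d}" "1 \<le> j" "j \<le> h" for u j
  proof
    assume "(par ^^ j) u \<in> set p"
    then have "(par ^^ j) u \<in> L i \<union> L (Suc i)" using p(3) by blast
    moreover have "(par ^^ j) u \<in> L (i - j)" using that by (intro upL)
    ultimately have "i = i - j \<or> Suc i = i - j" using layer_unique by blast
    then show False using that h by linarith
  qed
  let ?c = "p @ up @ down"
  have "distinct up" unfolding up_def distinct_map
    using same by (auto intro!: inj_onI)
  moreover have "distinct down" unfolding down_def distinct_map distinct_rev
    using same by (auto intro!: inj_onI)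
  moreover have "set up \<inter> set down = {}"
  proof -
    have "(par ^^ j) x \<noteq> (par ^^ j') d" if "1 \<le> j" "j \<le> h" "1 \<le> j'" "j' < h" for j j'
    proof
      assume eq: "(par ^^ j) x = (par ^^ j') d"
      then have "j = j'" using same[of j x j' d] that by simp
      then show False using eq apart[of j'] that by simp
    qed
    then show ?thesis by (force simp: up_def down_def)
  qed
  moreover have "set p \<inter> set (up @ down) = {}"
    using low by (force simp: up_def down_def)
  ultimately have "distinct ?c" using p(2) by auto
  moreover have "successively adj ?c"
  proof -
    have s1: "successively adj up"
      unfolding up_def using ancestor_adj[OF x] h by (intro successively_map_upt) auto
    have "successively adj (map (\<lambda>j. (par ^^ j) d) [1..<h])"
      using ancestor_adj[OF d] h by (intro successively_map_upt) auto
    then have s2: "successively adj down"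
      unfolding down_def successively_rev by (rule successively_mono) (rule sym)
    have "up \<noteq> []" "hd up = par x" "last up = (par ^^ h) x"
      using h by (simp_all add: up_def hd_map last_map del: upt_Suc)
    moreover have "adj x (par x)" using ancestor_adj[OF x, of 0] h by simp
    moreover have "down = [] \<or> hd down = (par ^^ (h - 1)) d"
    proof (cases "h = 1")
      case False
      then have "[1..<h] \<noteq> []" "last [1..<h] = h - 1" using h by auto
      then show ?thesis by (simp add: down_def hd_rev last_map)
    qed (simp add: down_def)
    moreover have "adj ((par ^^ h) x) ((par ^^ (h - 1)) d)"
      using ancestor_adj[OF d, of "h - 1"] h unfolding meet by (simp add: sym)
    ultimately show ?thesis
      using p(1,4,6) s1 s2 by (auto simp: successively_append_iff)
  qed
  moreover have "adj (last ?c) (hd ?c)"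
  proof (cases "h = 1")
    case True
    then have "last ?c = par x" by (simp add: up_def down_def)
    then show ?thesis using ancestor_adj[OF d, of 0] h meet True p(1,5) by (simp add: sym)
  next
    case False
    then have "hd (map (\<lambda>j. (par ^^ j) d) [1..<h]) = par d" "[1..<h] \<noteq> []"
      using h by (simp_all add: hd_map)
    then have "last ?c = par d" by (simp add: down_def last_rev)
    then show ?thesis using ancestor_adj[OF d, of 0] h p(1,5) by (simp add: sym)
  qed
  moreover have "set ?c \<subseteq> (\<Union>j. L j)"
  proof -
    have ud: "set up \<subseteq> (\<lambda>j. (par ^^ j) x) ` {..h}" "set down \<subseteq> (\<lambda>j. (par ^^ j) d) ` {..h}"
      by (auto simp: up_def down_def simp del: upt_Suc)
    have anc: "(\<lambda>j. (par ^^ j) u) ` {..h} \<subseteq> (\<Union>j. L j)" if "u \<in> {x, d}" for u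
      using upL[OF that] by blast
    have "set up \<subseteq> (\<Union>j. L j)" by (rule order_trans[OF ud(1) anc]) simp
    moreover have "set down \<subseteq> (\<Union>j. L j)" by (rule order_trans[OF ud(2) anc]) simp
    moreover have "set p \<subseteq> (\<Union>j. L j)" using p(3) by blast
    ultimately show ?thesis by simp
  qed
  moreover have "length ?c = length p + 2 * h - 1" using h by (simp add: up_def down_def)
  ultimately show ?thesis using p(1) unfolding cycle_in_def by blast
qed

text \<open>The heart of the argument. For each \<open>y\<close> in the outer layer look at how far one must go up
  the tree until the ancestors of all its neighbours agree, and choose \<open>y\<close> with the largest such
  height \<open>h\<close>. Then all inner vertices reached from \<open>y\<close> inside \<open>W\<close> have the same ancestor at
  height \<open>h\<close>, while \<open>y\<close> has neighbours \<open>b\<close> and \<open>c\<close> whose ancestors at height \<open>h - 1\<close> differ. A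
  path of the right length from a third neighbour ends in a vertex that, at height \<open>h - 1\<close>,
  differs from \<open>b\<close> or from \<open>c\<close>.\<close>

lemma even_cycle_between_layers:
  assumes fin: "finite W" and W: "W \<noteq> {}" "W \<subseteq> L i \<union> L (Suc i)"
    and cross: "\<And>u v. u \<in> W \<Longrightarrow> v \<in> W \<Longrightarrow> adj u v \<Longrightarrow> u \<in> L i \<longleftrightarrow> v \<in> L (Suc i)"
    and deg: "\<And>v. v \<in> W \<Longrightarrow> 2 * k < card {u \<in> W. adj v u}"
    and i: "1 \<le> i" "i < k"
  shows "cycle_in adj (\<Union>j. L j) (2 * k)"
proof -
  define N where "N v = {u \<in> W. adj v u}" for v
  have finN: "finite (N v)" for v using fin by (simp add: N_def)
  have notboth: "v \<in> L i \<Longrightarrow> v \<notin> L (Suc i)" for v using layer_unique[of v i "Suc i"] by auto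
  define Y where "Y = W \<inter> L (Suc i)"
  have NY: "N y \<subseteq> W \<inter> L i" if "y \<in> Y" for y
    using that cross W sym unfolding Y_def N_def by blast
  have "Y \<noteq> {}"
  proof -
    obtain w where w: "w \<in> W" using W by blast
    have "0 < card (N w)" using deg[OF w] by (simp add: N_def)
    then have "N w \<noteq> {}" by auto
    then obtain u where "u \<in> W" "adj w u" by (auto simp: N_def)
    then show ?thesis using cross[OF w] W w by (auto simp: Y_def)
  qed
  define agree where "agree h y \<longleftrightarrow> (\<forall>u\<in>N y. \<forall>v\<in>N y. (par ^^ h) u = (par ^^ h) v)" for h y
  define ht where "ht y = (LEAST h. agree h y)" for y
  have agree_i: "agree i y" if "y \<in> Y" for y
    using NY[OF that] ancestor_root unfolding agree_def by blast
  have ht_le: "ht y \<le> i" if "y \<in> Y" for y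
    unfolding ht_def using agree_i[OF that] by (rule Least_le)
  have agree_ht: "agree (ht y) y" if "y \<in> Y" for y
    unfolding ht_def using agree_i[OF that] by (rule LeastI)
  have agree_mono: "agree h' y" if "agree h y" "h \<le> h'" for h h' y
  proof -
    have "(par ^^ h') v = (par ^^ (h' - h)) ((par ^^ h) v)" for v
      using that(2) by (metis comp_apply funpow_add le_add_diff_inverse2)
    then show ?thesis using that(1) unfolding agree_def by metis
  qed
  have "finite Y" using fin by (simp add: Y_def)
  have "Max (ht ` Y) \<in> ht ` Y" using \<open>finite Y\<close> \<open>Y \<noteq> {}\<close> by (intro Max_in) auto
  then obtain y where y: "y \<in> Y" and "Max (ht ` Y) = ht y" by blast
  then have ymax: "\<And>y'. y' \<in> Y \<Longrightarrow> ht y' \<le> ht y"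
    using \<open>finite Y\<close> by (metis Max_ge finite_imageI imageI)
  define h where "h = ht y"
  have yW: "y \<in> W" using y by (simp add: Y_def)
  have agree_h: "agree h y'" if "y' \<in> Y" for y'
    using agree_mono[OF agree_ht[OF that] ymax[OF that]] by (simp add: h_def)
  have cardN: "2 * k < card (N y)" using deg[OF yW] by (simp add: N_def)
  have "h \<noteq> 0"
  proof
    assume "h = 0"
    then have "\<forall>u\<in>N y. \<forall>v\<in>N y. u = v" using agree_h[OF y] by (simp add: agree_def)
    then have "card (N y) \<le> 1" using card_le_Suc0_iff_eq[OF finN] by auto
    then show False using cardN i by simp
  qed
  then have "\<not> agree (h - 1) y"
    unfolding h_def ht_def by (intro not_less_Least) simp
  then obtain b c where bc: "b \<in> N y" "c \<in> N y" "(par ^^ (h - 1)) b \<noteq> (par ^^ (h - 1)) c"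
    unfolding agree_def by blast
  have "\<not> N y \<subseteq> {b, c}"
  proof
    assume "N y \<subseteq> {b, c}"
    then have "card (N y) \<le> 2" using card_mono[of "{b, c}" "N y"] card_insert_le_m1[of 2 "{c}" b] by (simp add: card_insert_if split: if_splits)
    then show False using cardN i by simp
  qed
  then obtain a where a: "a \<in> N y" "a \<noteq> b" "a \<noteq> c" by blast
  have hk: "h < k" using ht_le[OF y] i by (simp add: h_def)
  have ay: "a \<noteq> y" using a(1) irr by (auto simp: N_def)
  have "card {y, b, c} + (2 * (k - h) - 2) \<le> 2 * k"
  proof -
    have "card {y, b, c} \<le> 3" by (simp add: card_insert_if)
    then show ?thesis using \<open>h \<noteq> 0\<close> hk by simp
  qed
  then obtain p where p: "length p = Suc (2 * (k - h) - 2)" "distinct p" "set p \<subseteq> W - {y, b, c}"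
      "hd p = a" "successively adj p"
    using path_of_min_degree[OF fin deg irr, of a "{y, b, c}" "2 * (k - h) - 2"] a ay
    by (auto simp: N_def)
  have ne: "p \<noteq> []" using p(1) by auto
  have along: "p ! (2 * j) \<in> L i \<and> (par ^^ h) (p ! (2 * j)) = (par ^^ h) a" if "2 * j < length p" for j
    using that
  proof (induction j)
    case 0
    then show ?case using NY[OF y] a p(4) ne by (auto simp: hd_conv_nth)
  next
    case (Suc j)
    let ?u = "p ! (2 * j)" and ?v = "p ! Suc (2 * j)" and ?w = "p ! Suc (Suc (2 * j))"
    have adj: "adj ?u ?v" "adj ?v ?w"
      using p(5) Suc(2) by (auto simp: successively_conv_nth)
    have inW: "?u \<in> W" "?v \<in> W" "?w \<in> W" using p(3) Suc(2) by (auto simp: subset_iff)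
    have IH: "?u \<in> L i" "(par ^^ h) ?u = (par ^^ h) a" using Suc by auto
    have v: "?v \<in> Y" using cross[OF inW(1,2) adj(1)] IH inW by (auto simp: Y_def)
    have "?u \<in> N ?v" "?w \<in> N ?v" using adj inW sym by (auto simp: N_def)
    then have "(par ^^ h) ?w = (par ^^ h) ?u" "?w \<in> L i"
      using agree_h[OF v] NY[OF v] unfolding agree_def by blast+
    then show ?case using IH by simp
  qed
  define x where "x = last p"
  have "x = p ! (2 * (k - h - 1))" using p(1) ne hk by (simp add: x_def last_conv_nth algebra_simps)
  then have x: "x \<in> L i" "(par ^^ h) x = (par ^^ h) a"
    using along[of "k - h - 1"] p(1) hk by auto
  obtain d where d: "d \<in> {b, c}" "(par ^^ (h - 1)) x \<noteq> (par ^^ (h - 1)) d"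
    using bc(3) by (metis insertCI)
  have dN: "d \<in> N y" using d bc by auto
  have da: "(par ^^ h) d = (par ^^ h) a" using agree_h[OF y] dN a(1) unfolding agree_def by blast
  have dy: "adj d y" "adj y a" "d \<noteq> y" "d \<in> L i"
    using dN a(1) irr sym NY[OF y] by (auto simp: N_def)
  have "cycle_in adj (\<Union>j. L j) (length (d # y # p) + 2 * h - 1)"
  proof (rule close_up_through_tree[OF x(1) dy(4)])
    show "0 < h" "h \<le> i" using \<open>h \<noteq> 0\<close> ht_le[OF y] by (auto simp: h_def)
    show "(par ^^ h) x = (par ^^ h) d" using x da by simp
    show "(par ^^ (h - 1)) x \<noteq> (par ^^ (h - 1)) d" by (rule d(2))
    show "distinct (d # y # p)" using p(2,3) d(1) dy by auto
    show "set (d # y # p) \<subseteq> L i \<union> L (Suc i)" using p(3) W dN yW by (auto simp: N_def)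
    show "successively adj (d # y # p)"
      using dy p(4,5) ne by (cases p) auto
  qed (use ne in \<open>auto simp: x_def\<close>)
  moreover have "length (d # y # p) + 2 * h - 1 = 2 * k" using p(1) hk by simp
  ultimately show ?thesis by simp
qed

end

text \<open>Balls and spheres around \<open>r\<close> for the distance in the graph induced on \<open>W\<close>.\<close>

fun ball_layers :: "('a \<Rightarrow> 'a \<Rightarrow> bool) \<Rightarrow> 'a set \<Rightarrow> 'a \<Rightarrow> nat \<Rightarrow> 'a set" where
  "ball_layers adj W r 0 = {r}"
| "ball_layers adj W r (Suc i) =
     ball_layers adj W r i \<union> {v \<in> W. \<exists>u\<in>ball_layers adj W r i. adj u v}"

fun sphere :: "('a \<Rightarrow> 'a \<Rightarrow> bool) \<Rightarrow> 'a set \<Rightarrow> 'a \<Rightarrow> nat \<Rightarrow> 'a set" where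
  "sphere adj W r 0 = {r}"
| "sphere adj W r (Suc i) = ball_layers adj W r (Suc i) - ball_layers adj W r i"

lemma ball_layers_mono: "i \<le> j \<Longrightarrow> ball_layers adj W r i \<subseteq> ball_layers adj W r j"
  by (rule lift_Suc_mono_le[of "ball_layers adj W r"]) auto

lemma sphere_subset_ball: "sphere adj W r i \<subseteq> ball_layers adj W r i"
  by (cases i) auto

lemma sphere_disjoint:
  assumes "i < j"
  shows "sphere adj W r i \<inter> sphere adj W r j = {}"
proof -
  obtain j' where j: "j = Suc j'" "i \<le> j'" using assms by (cases j) auto
  have "sphere adj W r i \<subseteq> ball_layers adj W r j'"
    using sphere_subset_ball ball_layers_mono[OF j(2)] by (rule order_trans)
  then show ?thesis unfolding j(1) sphere.simps by blast
qed

lemma sphere_subset: "r \<in> W \<Longrightarrow> sphere adj W r i \<subseteq> W"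
proof (cases i)
  case (Suc j)
  then show ?thesis by auto
qed auto

lemma sphere_parent:
  assumes "v \<in> sphere adj W r (Suc i)"
  shows "\<exists>u \<in> sphere adj W r i. adj u v"
proof -
  obtain u where u: "u \<in> ball_layers adj W r i" "adj u v" "v \<in> W" "v \<notin> ball_layers adj W r i"
    using assms by auto
  have "u \<in> sphere adj W r i"
  proof (cases i)
    case 0
    then show ?thesis using u by simp
  next
    case (Suc j)
    then have "u \<notin> ball_layers adj W r j" using u by auto
    then show ?thesis using u Suc by simp
  qed
  then show ?thesis using u by blast
qed

lemma sphere_neighbours:
  assumes "v \<in> sphere adj W r (Suc i)" "adj v u" "u \<in> W" and sym: "\<And>u v. adj u v \<Longrightarrow> adj v u"
  shows "u \<in> sphere adj W r i \<or> u \<in> sphere adj W r (Suc i) \<or> u \<in> sphere adj W r (Suc (Suc i))"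
proof -
  have v: "v \<in> ball_layers adj W r (Suc i)" "v \<notin> ball_layers adj W r i" "v \<in> W" using assms(1) by auto
  then have "u \<in> ball_layers adj W r (Suc (Suc i))" using assms(2,3) by auto
  moreover have "u \<in> sphere adj W r i" if "u \<in> ball_layers adj W r i"
  proof (cases i)
    case 0
    then show ?thesis using that by simp
  next
    case (Suc j)
    then have "u \<notin> ball_layers adj W r j" using v sym[OF assms(2)] by auto
    then show ?thesis using that Suc by simp
  qed
  ultimately show ?thesis by (cases "u \<in> ball_layers adj W r i"; cases "u \<in> ball_layers adj W r (Suc i)") auto
qed

lemma card_pairs_swap:
  assumes "finite A" "finite B"
  shows "(\<Sum>a\<in>A. card {b \<in> B. R a b}) = (\<Sum>b\<in>B. card {a \<in> A. R a b})"
proof -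
  have "(\<Sum>a\<in>A. card {b \<in> B. R a b}) = (\<Sum>a\<in>A. \<Sum>b\<in>B. if R a b then 1 else 0)"
    using assms(2) by (simp add: sum.If_cases Int_def)
  also have "\<dots> = (\<Sum>b\<in>B. \<Sum>a\<in>A. if R a b then 1 else 0)" by (rule sum.swap)
  also have "\<dots> = (\<Sum>b\<in>B. card {a \<in> A. R a b})"
    using assms(1) by (simp add: sum.If_cases Int_def)
  finally show ?thesis .
qed

text \<open>Without a cycle of length \<open>2 * k\<close> the first \<open>k\<close> pairs of consecutive spheres span at most
  \<open>2 * k * (|L i| + |L (i + 1)|)\<close> edges each, by the lemma on layers. The degrees in sphere \<open>i\<close> thus add
  up to at most \<open>2 * k * (|L (i - 1)| + 2 * |L i| + |L (i + 1)|)\<close>. If all degrees exceed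
  \<open>2 * k * (t + 3)\<close>, the summand 3 absorbs the first two terms, and the spheres grow by the factor \<open>t\<close>.\<close>

lemma large_min_degree_even_cycle_free:
  fixes adj :: "'a \<Rightarrow> 'a \<Rightarrow> bool" and col :: "'a \<Rightarrow> bool"
  assumes fin: "finite W" and ne: "W \<noteq> {}"
    and sym: "\<And>u v. adj u v \<Longrightarrow> adj v u" and col: "\<And>u v. adj u v \<Longrightarrow> col u \<noteq> col v"
    and deg: "\<And>v. v \<in> W \<Longrightarrow> 2 * k * (t + 3) < card {u \<in> W. adj v u}"
    and free: "\<not> cycle_in adj W (2 * k)" and k: "1 \<le> k" and t: "1 \<le> t"
  shows "t ^ k \<le> card W"
proof -
  have irr: "\<not> adj v v" for v using col by blast
  obtain r where r: "r \<in> W" using ne by blast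
  define L where "L = sphere adj W r"
  have LW: "L i \<subseteq> W" for i unfolding L_def by (rule sphere_subset[OF r])
  have finL: "finite (L i)" for i using LW fin finite_subset by blast
  have disj: "L i \<inter> L j = {}" if "i \<noteq> j" for i j
    using that sphere_disjoint[of i j adj W r] sphere_disjoint[of j i adj W r]
    unfolding L_def by (cases "i < j") auto
  define par where "par v = (SOME u. \<exists>i. v \<in> L (Suc i) \<and> u \<in> L i \<and> adj v u)" for v
  have par: "par v \<in> L i \<and> adj v (par v)" if "v \<in> L (Suc i)" for v i
  proof -
    have "\<exists>u i. v \<in> L (Suc i) \<and> u \<in> L i \<and> adj v u"
      using sphere_parent[of v adj W r i] that sym unfolding L_def by blast
    then have "\<exists>i. v \<in> L (Suc i) \<and> par v \<in> L i \<and> adj v (par v)"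
      unfolding par_def by (rule someI_ex)
    then obtain j where "v \<in> L (Suc j)" "par v \<in> L j" "adj v (par v)" by blast
    moreover have "Suc j = Suc i" using that calculation(1) disj by blast
    ultimately show ?thesis by simp
  qed
  have root: "L 0 = {r}" by (simp add: L_def)
  interpret layered_graph adj L par r
  proof
    show "adj u v \<Longrightarrow> adj v u" for u v by (rule sym)
    show "\<not> adj v v" for v by (rule irr)
    show "L 0 = {r}" by (rule root)
    show "i \<noteq> j \<Longrightarrow> L i \<inter> L j = {}" for i j by (rule disj)
    show "v \<in> L (Suc i) \<Longrightarrow> par v \<in> L i" "v \<in> L (Suc i) \<Longrightarrow> adj v (par v)" for v i
      using par by auto
  qed
  have colL: "col v = (col r = even i)" if "v \<in> L i" for v i
    using that
  proof (induction i arbitrary: v)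
    case 0
    then show ?case by (simp add: L_def)
  next
    case (Suc i)
    then show ?case using Suc.IH[of "par v"] par[of v i] col[of v "par v"] by auto
  qed
  define e where "e i = (\<Sum>v\<in>L i. card {u \<in> L (Suc i). adj v u})" for i
  have e_swap: "e i = (\<Sum>v\<in>L (Suc i). card {u \<in> L i. adj v u})" for i
  proof -
    have comm: "adj u v \<longleftrightarrow> adj v u" for u v using sym by blast
    have "e i = (\<Sum>v\<in>L (Suc i). card {u \<in> L i. adj u v})"
      unfolding e_def by (rule card_pairs_swap[OF finL finL])
    also have "\<dots> = (\<Sum>v\<in>L (Suc i). card {u \<in> L i. adj v u})"
      by (intro sum.cong refl arg_cong[where f = card] Collect_cong conj_cong comm)
    finally show ?thesis .
  qed
  have sparse: "e i \<le> 2 * k * (card (L i) + card (L (Suc i)))" if "i < k" for i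
  proof (cases "i = 0")
    case True
    have "e i \<le> (\<Sum>v\<in>L i. card (L (Suc i)))"
      unfolding e_def using finL by (intro sum_mono card_mono) auto
    also have "\<dots> = card (L (Suc i))" using True by (simp add: L_def)
    also have "\<dots> \<le> 2 * k * (card (L i) + card (L (Suc i)))"
      using k mult_le_mono[of 1 "2 * k" "card (L (Suc i))" "card (L i) + card (L (Suc i))"] by simp
    finally show ?thesis .
  next
    case False
    show ?thesis
    proof (rule ccontr)
      assume many: "\<not> ?thesis"
      define V where "V = L i \<union> L (Suc i)"
      define cr where "cr u v \<longleftrightarrow> adj u v \<and> (u \<in> L i \<longleftrightarrow> v \<in> L (Suc i)) \<and> (v \<in> L i \<longleftrightarrow> u \<in> L (Suc i))" for u v
      have d: "L i \<inter> L (Suc i) = {}" using disj by simp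
      have "degree_sum cr V = (\<Sum>v\<in>L i. card {u \<in> V. cr v u}) + (\<Sum>v\<in>L (Suc i). card {u \<in> V. cr v u})"
        unfolding degree_sum_def V_def using finL d by (intro sum.union_disjoint) auto
      also have "(\<Sum>v\<in>L i. card {u \<in> V. cr v u}) = e i"
        unfolding e_def using d
        by (intro sum.cong refl arg_cong[where f = card]) (auto simp: V_def cr_def)
      also have "(\<Sum>v\<in>L (Suc i). card {u \<in> V. cr v u}) = e i"
        unfolding e_swap using d
        by (intro sum.cong refl arg_cong[where f = card]) (auto simp: V_def cr_def)
      finally have "2 * (2 * k) * card V < degree_sum cr V"
        using many finL d by (simp add: V_def card_Un_disjoint)
      then have "\<exists>U\<subseteq>V. U \<noteq> {} \<and> (\<forall>v\<in>U. 2 * k < card {u \<in> U. cr v u})"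
      proof (rule min_degree_core[rotated -1])
        show "finite V" using finL by (simp add: V_def)
        show "cr v u" if "cr u v" for u v using that sym unfolding cr_def by blast
        show "\<not> cr v v" for v using irr by (simp add: cr_def)
      qed
      then obtain U where U: "U \<subseteq> V" "U \<noteq> {}" "\<And>v. v \<in> U \<Longrightarrow> 2 * k < card {u \<in> U. cr v u}" by blast
      have finU: "finite U" using U(1) by (rule finite_subset) (simp add: V_def finL)
      have "cycle_in adj (\<Union>j. L j) (2 * k)"
      proof (rule even_cycle_between_layers[OF finU U(2)])
        show "U \<subseteq> L i \<union> L (Suc i)" using U(1) by (simp add: V_def)
        show "u \<in> L i \<longleftrightarrow> v \<in> L (Suc i)" if "u \<in> U" "v \<in> U" "adj u v" for u v
        proof -
          have uv: "u \<in> L i \<or> u \<in> L (Suc i)" "v \<in> L i \<or> v \<in> L (Suc i)" using that U(1) by (auto simp: V_def)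
          moreover have "\<not> (u \<in> L j \<and> v \<in> L j)" for j using colL[of u j] colL[of v j] col[OF that(3)] by auto
          ultimately show ?thesis using d by blast
        qed
        show "2 * k < card {u \<in> U. adj v u}" if "v \<in> U" for v
        proof -
          have "card {u \<in> U. cr v u} \<le> card {u \<in> U. adj v u}"
            using finU by (intro card_mono) (auto simp: cr_def)
          then show ?thesis using U(3)[OF that] by linarith
        qed
        show "1 \<le> i" "i < k" using False \<open>i < k\<close> by auto
      qed
      then have "cycle_in adj W (2 * k)" by (rule cycle_in_mono) (use LW in blast)
      then show False using free by contradiction
    qed
  qed
  have step: "2 * k * (t + 3) * card (L (Suc i)) \<le> e i + e (Suc i)" for i
  proof -
    have "2 * k * (t + 3) * card (L (Suc i)) = (\<Sum>v\<in>L (Suc i). 2 * k * (t + 3))" by simp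
    also have "\<dots> \<le> (\<Sum>v\<in>L (Suc i). card {u \<in> W. adj v u})"
    proof (rule sum_mono)
      fix v assume "v \<in> L (Suc i)"
      then have "v \<in> W" using LW by blast
      then show "2 * k * (t + 3) \<le> card {u \<in> W. adj v u}" using deg[of v] by simp
    qed
    also have "\<dots> \<le> (\<Sum>v\<in>L (Suc i). card {u \<in> L i. adj v u} + card {u \<in> L (Suc (Suc i)). adj v u})"
    proof (intro sum_mono)
      fix v assume v: "v \<in> L (Suc i)"
      have "{u \<in> W. adj v u} \<subseteq> {u \<in> L i. adj v u} \<union> {u \<in> L (Suc (Suc i)). adj v u}"
      proof
        fix u assume "u \<in> {u \<in> W. adj v u}"
        then have u: "u \<in> W" "adj v u" by auto
        then have "u \<in> L i \<or> u \<in> L (Suc i) \<or> u \<in> L (Suc (Suc i))"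
          using sphere_neighbours[of v adj W r i u] v sym unfolding L_def by blast
        moreover have "u \<notin> L (Suc i)" using colL[OF v] colL[of u "Suc i"] col[OF u(2)] by auto
        ultimately show "u \<in> {u \<in> L i. adj v u} \<union> {u \<in> L (Suc (Suc i)). adj v u}" using u by blast
      qed
      then have "card {u \<in> W. adj v u} \<le> card ({u \<in> L i. adj v u} \<union> {u \<in> L (Suc (Suc i)). adj v u})"
        using finL by (intro card_mono) auto
      also have "\<dots> \<le> card {u \<in> L i. adj v u} + card {u \<in> L (Suc (Suc i)). adj v u}"
        by (rule card_Un_le)
      finally show "card {u \<in> W. adj v u} \<le> \<dots>" .
    qed
    also have "\<dots> = e i + e (Suc i)" by (simp add: sum.distrib e_swap[of i] e_def[of "Suc i"])
    finally show ?thesis .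
  qed
  have grow: "t * card (L i) \<le> card (L (Suc i)) \<and> card (L i) \<le> card (L (Suc i))" if "i < k" for i
    using that
  proof (induction i)
    case 0
    have "{u \<in> W. adj r u} \<subseteq> L (Suc 0)" using irr by (auto simp: L_def)
    then have "card {u \<in> W. adj r u} \<le> card (L (Suc 0))" using finL by (intro card_mono)
    moreover have "t \<le> 2 * k * (t + 3)" using k mult_le_mono[of 1 "2 * k" t "t + 3"] by simp
    ultimately show ?case using deg[OF r] t by (simp add: L_def)
  next
    case (Suc i)
    let ?a = "card (L i)" and ?b = "card (L (Suc i))" and ?c = "card (L (Suc (Suc i)))"
    have "2 * k * (t + 3) * ?b \<le> 2 * k * (?a + ?b) + 2 * k * (?b + ?c)"
      using step[of i] sparse[of i] sparse[of "Suc i"] Suc(2) by linarith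
    then have "2 * k * ((t + 3) * ?b) \<le> 2 * k * (?a + ?b + (?b + ?c))"
      by (simp add: algebra_simps)
    then have "(t + 3) * ?b \<le> ?a + ?b + (?b + ?c)" using k by simp
    moreover have "?a \<le> ?b" using Suc by simp
    ultimately have "t * ?b \<le> ?c" by (simp add: algebra_simps)
    moreover have "?b \<le> t * ?b" using t by simp
    ultimately show ?case by linarith
  qed
  have "t ^ i \<le> card (L i)" if "i \<le> k" for i
    using that
  proof (induction i)
    case 0
    then show ?case by (simp add: L_def)
  next
    case (Suc i)
    then have "t * t ^ i \<le> t * card (L i)" by simp
    also have "\<dots> \<le> card (L (Suc i))" using grow[of i] Suc(2) by simp
    finally show ?case by simp
  qed
  from this[of k] have "t ^ k \<le> card (L k)" by simp
  also have "\<dots> \<le> card W" using LW fin by (rule card_mono[rotated])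
  finally show ?thesis .
qed

lemma even_cycle_free_degree_sum:
  fixes adj :: "'a \<Rightarrow> 'a \<Rightarrow> bool"
  assumes fin: "finite V" and sym: "\<And>u v. adj u v \<Longrightarrow> adj v u" and irr: "\<And>v. \<not> adj v v"
    and free: "\<not> cycle_in adj V (2 * k)" and k: "1 \<le> k" and t: "1 \<le> t" "card V < t ^ k"
  shows "degree_sum adj V \<le> 8 * k * (t + 3) * card V"
proof -
  obtain col :: "'a \<Rightarrow> bool" where
    col: "degree_sum adj V \<le> 2 * degree_sum (\<lambda>u v. adj u v \<and> col u \<noteq> col v) V"
    using half_of_edges_bipartite[where adj = adj, OF fin sym irr] by blast
  define cr where "cr u v \<longleftrightarrow> adj u v \<and> col u \<noteq> col v" for u v
  have sym': "cr v u" if "cr u v" for u v using that sym by (simp add: cr_def)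
  have "degree_sum cr V \<le> 2 * (2 * k * (t + 3)) * card V"
  proof (rule ccontr)
    assume many: "\<not> ?thesis"
    have "\<exists>W\<subseteq>V. W \<noteq> {} \<and> (\<forall>v\<in>W. 2 * k * (t + 3) < card {u \<in> W. cr v u})"
    proof (rule min_degree_core[OF fin])
      show "cr v u" if "cr u v" for u v using that by (rule sym')
      show "2 * (2 * k * (t + 3)) * card V < degree_sum cr V" using many by simp
    qed (simp add: cr_def)
    then obtain W where W: "W \<subseteq> V" "W \<noteq> {}" "\<And>v. v \<in> W \<Longrightarrow> 2 * k * (t + 3) < card {u \<in> W. cr v u}"
      by blast
    have "t ^ k \<le> card W"
    proof (rule large_min_degree_even_cycle_free[where adj = cr and col = col])
      show "finite W" using W(1) fin by (rule finite_subset)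
      show "\<not> cycle_in cr W (2 * k)"
      proof
        assume "cycle_in cr W (2 * k)"
        then have "cycle_in adj W (2 * k)" by (rule cycle_in_mono_adj) (simp add: cr_def)
        then show False using free cycle_in_mono[OF _ W(1)] by blast
      qed
      show "cr v u" if "cr u v" for u v using that by (rule sym')
    qed (use W k t in \<open>auto simp: cr_def\<close>)
    also have "\<dots> \<le> card V" using W(1) fin by (rule card_mono[rotated])
    finally show False using t(2) by simp
  qed
  then show ?thesis using col by (simp add: cr_def[abs_def])
qed

section \<open>Triangles in graphs without a given even cycle\<close>

text \<open>A path with \<open>2 * k - 1\<close> vertices among the neighbours of \<open>v\<close> would close up to a cycle of length
  \<open>2 * k\<close> through \<open>v\<close>.\<close>

lemma neighbourhood_degree_sum:
  fixes adj :: "'a \<Rightarrow> 'a \<Rightarrow> bool"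
  assumes fin: "finite V" and v: "v \<in> V" and sym: "\<And>u v. adj u v \<Longrightarrow> adj v u" and irr: "\<And>v. \<not> adj v v"
    and free: "\<not> cycle_in adj V (2 * k)" and k: "2 \<le> k"
  shows "degree_sum adj {u \<in> V. adj v u} \<le> 4 * k * card {u \<in> V. adj v u}"
proof (rule ccontr)
  let ?N = "{u \<in> V. adj v u}"
  assume many: "\<not> ?thesis"
  have "\<exists>W\<subseteq>?N. W \<noteq> {} \<and> (\<forall>v\<in>W. 2 * k < card {u \<in> W. adj v u})"
  proof (rule min_degree_core)
    show "finite ?N" using fin by simp
    show "adj v u" if "adj u v" for u v using that by (rule sym)
    show "\<not> adj v v" for v by (rule irr)
    show "2 * (2 * k) * card ?N < degree_sum adj ?N" using many by simp
  qed
  then obtain W where W: "W \<subseteq> ?N" "W \<noteq> {}" "\<And>v. v \<in> W \<Longrightarrow> 2 * k < card {u \<in> W. adj v u}" by blast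
  then obtain a where a: "a \<in> W" by blast
  have finW: "finite W" by (rule finite_subset[OF W(1)]) (use fin in simp)
  have "\<exists>p. length p = Suc (2 * k - 2) \<and> distinct p \<and> set p \<subseteq> W - {} \<and> hd p = a \<and> successively adj p"
    by (rule path_of_min_degree[OF finW W(3) irr a]) auto
  then obtain p where "length p = Suc (2 * k - 2)" and p': "distinct p" "set p \<subseteq> W" "successively adj p"
    by auto
  then have "length p = 2 * k - 1" using k by simp
  note p = this p'
  have ne: "p \<noteq> []" using p(1) k by auto
  have nb: "adj v x" if "x \<in> set p" for x using that p(3) W(1) by blast
  have "v \<notin> set p" using nb irr by blast
  then have "distinct (v # p)" "length (v # p) = 2 * k" using p k by auto
  moreover have "successively adj (v # p)" using ne nb p(4) by (cases p) auto
  moreover have "adj (last (v # p)) (hd (v # p))" using ne nb[of "last p"] by (simp add: sym)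
  moreover have "set (v # p) \<subseteq> V" using v p(3) W(1) by auto
  ultimately show False using free unfolding cycle_in_def by blast
qed

lemma cycle_in_imp_has_cycle:
  assumes "cycle_in (\<lambda>u v. {u, v} \<in> E) V l"
  shows "has_cycle l E"
proof -
  obtain p where p: "p \<noteq> []" "distinct p" "length p = l" "successively (\<lambda>u v. {u, v} \<in> E) p"
    "{last p, hd p} \<in> E"
    using assms unfolding cycle_in_def by blast
  have "{p ! i, p ! (Suc i mod l)} \<in> E" if "i < l" for i
  proof (cases "Suc i = l")
    case True
    then show ?thesis using p by (simp add: last_conv_nth hd_conv_nth flip: True)
  next
    case False
    then show ?thesis using that p(3,4) by (simp add: successively_conv_nth)
  qed
  moreover have "inj_on ((!) p) {..<l}" using p(2,3) by (simp add: inj_on_nth)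
  ultimately show ?thesis unfolding has_cycle_def by blast
qed

text \<open>A triangle is an edge inside the neighbourhood of one of its vertices, and such a neighbourhood
  spans only linearly many edges; so there are at most a constant times as many triangles as edges.\<close>

lemma card_triangles_even_cycle_free:
  fixes E :: "'a set set"
  assumes fin: "finite V" and E: "\<And>e. e \<in> E \<Longrightarrow> e \<subseteq> V \<and> card e = 2"
    and free: "\<not> has_cycle (2 * k) E" and k: "2 \<le> k" and t: "1 \<le> t" "card V < t ^ k"
  shows "card (triangles E) \<le> 32 * k\<^sup>2 * (t + 3) * card V"
proof -
  let ?adj = "\<lambda>u v. {u, v} \<in> E"
  have sym: "?adj u v \<Longrightarrow> ?adj v u" for u v by (simp add: insert_commute)
  have irr: "\<not> ?adj v v" for v using E[of "{v, v}"] by auto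
  have free': "\<not> cycle_in ?adj V (2 * k)" using free cycle_in_imp_has_cycle by blast
  define N where "N v = {u \<in> V. ?adj v u}" for v
  define Tr where "Tr = (SIGMA v:V. SIGMA u:N v. {w \<in> N v. ?adj u w})"
  have finN: "finite (N v)" for v using fin by (simp add: N_def)
  have finTr: "finite Tr" unfolding Tr_def using fin finN by (intro finite_SigmaI) auto
  have "triangles E \<subseteq> (\<lambda>(v, u, w). {v, u, w}) ` Tr"
  proof
    fix T assume T: "T \<in> triangles E"
    then obtain v u w where vuw: "T = {v, u, w}" "v \<noteq> u" "v \<noteq> w" "u \<noteq> w"
      by (auto simp: triangles_def card_3_iff)
    then have "?adj v u" "?adj v w" "?adj u w" using T by (auto simp: triangles_def)
    moreover from this have "v \<in> V" "u \<in> V" "w \<in> V" using E by blast+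
    ultimately have "(v, u, w) \<in> Tr" by (auto simp: Tr_def N_def)
    then show "T \<in> (\<lambda>(v, u, w). {v, u, w}) ` Tr" using vuw(1) by (intro image_eqI[of _ _ "(v, u, w)"]) auto
  qed
  then have "card (triangles E) \<le> card Tr" using finTr by (rule surj_card_le[rotated])
  also have "\<dots> = (\<Sum>v\<in>V. degree_sum ?adj (N v))"
    unfolding Tr_def degree_sum_def using fin finN by (simp add: card_SigmaI finite_SigmaI)
  also have "\<dots> \<le> (\<Sum>v\<in>V. 4 * k * card (N v))"
    unfolding N_def using fin sym irr free' k by (intro sum_mono neighbourhood_degree_sum) auto
  also have "\<dots> = 4 * k * degree_sum ?adj V" by (simp add: N_def degree_sum_def sum_distrib_left)
  also have "\<dots> \<le> 4 * k * (8 * k * (t + 3) * card V)"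
    using fin sym irr free' k t by (intro mult_left_mono even_cycle_free_degree_sum) auto
  finally show ?thesis by (simp add: power2_eq_square algebra_simps)
qed

text \<open>Legal moves keep Constructor's graph \<open>F\<close>-free, whatever Blocker does; so extremal bounds for
  \<open>F\<close>-free graphs bound the value of the game.\<close>

lemma game_value_le:
  assumes "C \<subseteq> edges_of n" "free_of F ({..<n}, C)"
    and "\<And>C'. C' \<subseteq> edges_of n \<Longrightarrow> free_of F ({..<n}, C') \<Longrightarrow> card (copies H ({..<n}, C')) \<le> m"
  shows "game_value n H F p C B \<le> m"
  using assms
proof (induction n H F p C B rule: game_value.induct)
  case (1 n H F C B)
  show ?case
  proof (cases "game_over n F C B")
    case True
    then show ?thesis using 1 by (simp add: game_value_over)
  next
    case False
    have "game_value n H F Blocker (insert e C) B \<le> m" if "e \<in> constructor_moves n F C B" for e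
      using that 1(2,4) by (intro 1(1)[OF False that]) (auto simp: constructor_moves_def unclaimed_def)
    moreover have "constructor_moves n F C B \<noteq> {}" using False by (auto simp: game_over_def)
    ultimately show ?thesis
      using constructor_moves_finite[of n F C B] by (subst game_value_Constructor[OF False]) auto
  qed
next
  case (2 n H F C B)
  show ?case
  proof (cases "game_over n F C B")
    case True
    then show ?thesis using 2 by (simp add: game_value_over)
  next
    case False
    then obtain e where e: "e \<in> unclaimed n C B" by (auto simp: game_over_def)
    have "game_value n H F Blocker C B \<le> game_value n H F Constructor C (insert e B)"
      using e finite_unclaimed[of n C B] by (subst game_value_Blocker[OF False]) auto
    also have "\<dots> \<le> m" using 2 by (intro 2(1)[OF False e])
    finally show ?thesis .
  qed
qed

text \<open>The choice \<open>t = \<lfloor>n powr (1 / k)\<rfloor> + 1\<close> is the least one with \<open>n < t ^ k\<close>.\<close>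

theorem upper_bound:
  assumes k: "2 \<le> k"
  shows "real (g n (complete_graph 3) (cycle_graph (2 * k)))
           \<le> 160 * real k ^ 2 * real n powr (1 + 1 / real k)"
proof -
  define a where "a = real n powr (1 / real k)"
  define t where "t = Suc (nat \<lfloor>a\<rfloor>)"
  have EV: "e \<subseteq> {..<n} \<and> card e = 2" if "C \<subseteq> edges_of n" "e \<in> C" for C e
    using that by (auto simp: complete_graph_def)
  have "card {..<n} < t ^ k"
  proof (cases "n = 0")
    case False
    have "a < real t" unfolding t_def a_def by (simp add: of_nat_Suc add.commute) linarith
    then have "a ^ k < real t ^ k" using k by (intro power_strict_mono) (auto simp: a_def)
    moreover have "a ^ k = real n"
      unfolding a_def using False k by (simp add: powr_powr flip: powr_realpow)
    ultimately have "real n < real (t ^ k)" by simp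
    then show ?thesis by (simp only: card_lessThan of_nat_less_iff)
  qed (simp add: t_def)
  then have tri: "card (triangles C) \<le> 32 * k\<^sup>2 * (t + 3) * n"
    if "C \<subseteq> edges_of n" "\<not> has_cycle (2 * k) C" for C
    using card_triangles_even_cycle_free[of "{..<n}" C k t] EV that k by (simp add: t_def)
  have "g n (complete_graph 3) (cycle_graph (2 * k)) \<le> 32 * k\<^sup>2 * (t + 3) * n"
    unfolding g_def
  proof (rule game_value_le)
    have "\<not> has_cycle (2 * k) {}" using k by (auto simp: has_cycle_def intro!: exI[of _ 0])
    then show "free_of (cycle_graph (2 * k)) ({..<n}, {})"
      using k by (subst free_of_cycle_iff) auto
    fix C assume C: "C \<subseteq> edges_of n" "free_of (cycle_graph (2 * k)) ({..<n}, C)"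
    then have "\<not> has_cycle (2 * k) C"
      using k EV by (subst (asm) free_of_cycle_iff) auto
    moreover have "card (copies (complete_graph 3) ({..<n}, C)) = card (triangles C)"
      using C EV by (intro card_copies_triangle) blast
    ultimately show "card (copies (complete_graph 3) ({..<n}, C)) \<le> 32 * k\<^sup>2 * (t + 3) * n"
      using tri C(1) by simp
  qed simp
  then have "real (g n (complete_graph 3) (cycle_graph (2 * k))) \<le> real (32 * k\<^sup>2 * (t + 3) * n)"
    by (rule of_nat_mono)
  also have "\<dots> = 32 * real k ^ 2 * ((real t + 3) * real n)" by simp
  also have "\<dots> \<le> 32 * real k ^ 2 * (5 * (a * real n))"
  proof (intro mult_left_mono)
    show "(real t + 3) * real n \<le> 5 * (a * real n)"
    proof (cases "n = 0")
      case False
      then have "1 \<le> a" unfolding a_def by (intro ge_one_powr_ge_zero) auto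
      moreover have "real t \<le> a + 1" unfolding t_def using \<open>1 \<le> a\<close> by simp
      ultimately have "real t + 3 \<le> 5 * a" by simp
      then show ?thesis using mult_right_mono[of "real t + 3" "5 * a" "real n"] by simp
    qed simp
  qed auto
  also have "\<dots> = 160 * real k ^ 2 * real n powr (1 + 1 / real k)"
    by (cases "n = 0") (simp_all add: a_def powr_add)
  finally show ?thesis .
qed

section \<open>Finite fields of characteristic three\<close>

text \<open>The field with \<open>3 ^ j\<close> elements consists of the fixed points of a power of the Frobenius map inside
  an algebraically closed field of characteristic three. In this way fields of unboundedly many sizes
  share a single type.\<close>

definition frob_fixed :: "nat \<Rightarrow> 'a :: field set" where
  "frob_fixed j = {x. x ^ (3 ^ j) = x}"

lemma cube_add:
  fixes x y :: "'a :: field"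
  assumes "(3 :: 'a) = 0"
  shows "(x + y) ^ 3 = x ^ 3 + y ^ 3"
  using assms by (simp add: algebra_simps power3_eq_cube)

lemma cube_diff:
  fixes x y :: "'a :: field"
  assumes "(3 :: 'a) = 0"
  shows "(x - y) ^ 3 = x ^ 3 - y ^ 3"
  using cube_add[OF assms, of "x - y" y] by simp

lemma frob_add:
  fixes x y :: "'a :: field"
  assumes "(3 :: 'a) = 0"
  shows "(x + y) ^ (3 ^ j) = x ^ (3 ^ j) + y ^ (3 ^ j)"
proof (induction j)
  case (Suc j)
  have "(x + y) ^ (3 ^ Suc j) = ((x + y) ^ (3 ^ j)) ^ 3" by (simp add: power_mult mult.commute flip: power_mult)
  also have "\<dots> = (x ^ (3 ^ j)) ^ 3 + (y ^ (3 ^ j)) ^ 3" unfolding Suc by (rule cube_add[OF assms])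
  finally show ?case by (simp add: mult.commute flip: power_mult)
qed simp

lemma frob_fixed_closed:
  fixes x y :: "'a :: field"
  assumes three: "(3 :: 'a) = 0" and x: "x \<in> frob_fixed j" and y: "y \<in> frob_fixed j"
  shows "x + y \<in> frob_fixed j" "x - y \<in> frob_fixed j" "x * y \<in> frob_fixed j" "x ^ m \<in> frob_fixed j"
proof -
  have xy: "x ^ (3 ^ j) = x" "y ^ (3 ^ j) = y" using x y by (auto simp: frob_fixed_def)
  show "x + y \<in> frob_fixed j" using frob_add[OF three, of x y j] xy by (simp add: frob_fixed_def)
  show "x - y \<in> frob_fixed j"
    using frob_add[OF three, of "x - y" y j] xy by (simp add: frob_fixed_def algebra_simps)
  show "x * y \<in> frob_fixed j" using xy by (simp add: frob_fixed_def power_mult_distrib)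
  show "x ^ m \<in> frob_fixed j"
    using xy by (simp add: frob_fixed_def) (metis power_mult mult.commute)
qed

lemma frob_fixed_0_1: "0 \<in> frob_fixed j" "1 \<in> frob_fixed j"
  by (simp_all add: frob_fixed_def)

text \<open>Splitting off linear factors never repeats a root, as the derivative does not vanish there.\<close>

lemma card_roots_separable:
  fixes p :: "'a :: alg_closed_field poly"
  assumes "p \<noteq> 0" "\<And>x. poly p x = 0 \<Longrightarrow> poly (pderiv p) x \<noteq> 0"
  shows "card {x. poly p x = 0} = degree p"
  using assms
proof (induction "degree p" arbitrary: p)
  case 0
  then obtain c where "p = [:c:]" "c \<noteq> 0" by (metis degree_eq_zeroE pCons_eq_0_iff)
  then show ?case by simp
next
  case (Suc m)
  then obtain a where a: "poly p a = 0"
    using alg_closed_imp_poly_has_root[of p] by (metis zero_less_Suc)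
  then obtain r where r: "p = [:-a, 1:] * r" by (metis dvdE poly_eq_0_iff_dvd)
  have r0: "r \<noteq> 0" using Suc(3) r by auto
  have der: "poly (pderiv p) x = poly r x + (x - a) * poly (pderiv r) x" for x
    unfolding r pderiv_mult by (simp add: pderiv_pCons algebra_simps)
  have ra: "poly r a \<noteq> 0" using Suc(4)[OF a] der[of a] by simp
  have "degree p = Suc (degree r)" unfolding r using r0 by (subst degree_mult_eq) auto
  then have "m = degree r" using Suc(2) by simp
  moreover have "poly (pderiv r) x \<noteq> 0" if "poly r x = 0" for x
    using Suc(4)[of x] that der[of x] r by auto
  ultimately have "card {x. poly r x = 0} = m" using Suc(1)[OF _ r0] by simp
  moreover have "{x. poly p x = 0} = insert a {x. poly r x = 0}" unfolding r by auto
  ultimately show ?case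
    using ra poly_roots_finite[OF r0] Suc(2) by simp
qed

lemma card_frob_fixed:
  assumes three: "(3 :: 'a :: alg_closed_field) = 0" and j: "0 < j"
  shows "finite (frob_fixed j :: 'a set)" "card (frob_fixed j :: 'a set) = 3 ^ j"
proof -
  define q :: nat where "q = 3 ^ j"
  define p :: "'a poly" where "p = monom 1 q - monom 1 1"
  have q: "1 < q" unfolding q_def using j by (intro one_less_power) auto
  have roots: "frob_fixed j = {x. poly p x = 0}"
    by (simp add: frob_fixed_def p_def poly_monom q_def)
  have deg: "degree p = q"
    unfolding p_def diff_conv_add_uminus using q by (subst degree_add_eq_left) (auto simp: degree_monom_eq)
  then have p0: "p \<noteq> 0" using q by auto
  have "(of_nat q :: 'a) = 0" unfolding q_def using j three by (simp add: zero_power)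
  then have "poly (pderiv p) x = - 1" for x
    by (simp add: p_def pderiv_diff pderiv_monom poly_monom)
  then have "card {x. poly p x = 0} = degree p" by (intro card_roots_separable p0) auto
  then show "card (frob_fixed j :: 'a set) = 3 ^ j" using roots deg by (simp add: q_def)
  show "finite (frob_fixed j :: 'a set)" unfolding roots by (rule poly_roots_finite[OF p0])
qed

type_synonym ac3 = "Enum.finite_3 alg_closure"

lemma three_ac3: "(3 :: ac3) = 0"
proof -
  have "(3 :: Enum.finite_3) = 1 + 1 + 1" by (simp only: numeral.simps)
  also have "\<dots> = 0"
    by (simp only: plus_finite_3_def one_finite_3_def zero_finite_3_def Enum.finite_3.case prod.case)
  finally have "(3 :: Enum.finite_3) = 0" .
  then have "to_ac (3 :: Enum.finite_3) = 0" by simp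
  then show ?thesis by simp
qed

section \<open>Bipartite graphs of large girth\<close>

text \<open>A closed walk \<open>x\<^sub>0 y\<^sub>0 x\<^sub>1 y\<^sub>1 \<dots>\<close> in the bipartite graph of a relation \<open>R\<close> is given by the list
  of the pairs \<open>(x\<^sub>i, y\<^sub>i)\<close>.\<close>

definition closed_walk :: "('x \<Rightarrow> 'y \<Rightarrow> bool) \<Rightarrow> ('x \<times> 'y) list \<Rightarrow> bool" where
  "closed_walk R ps \<longleftrightarrow> list_all2 (\<lambda>(x, y) (x', y'). R x y \<and> R x' y) ps (rotate1 ps)"

definition nonbacktracking :: "('x \<times> 'y) list \<Rightarrow> bool" where
  "nonbacktracking ps \<longleftrightarrow> list_all2 (\<lambda>(x, y) (x', y'). x \<noteq> x' \<and> y \<noteq> y') ps (rotate1 ps)"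

text \<open>Girth larger than \<open>2 * k\<close>. Closed walks that only avoid turning back at once, rather than cycles,
  are both what the algebra below excludes and what projections of cycles produce.\<close>

definition girth_exceeds :: "nat \<Rightarrow> ('x \<Rightarrow> 'y \<Rightarrow> bool) \<Rightarrow> bool" where
  "girth_exceeds k R \<longleftrightarrow>
     (\<forall>ps. ps \<noteq> [] \<longrightarrow> length ps \<le> k \<longrightarrow> closed_walk R ps \<longrightarrow> \<not> nonbacktracking ps)"

text \<open>Algebraic substitutes for the incidence graphs of a generalized quadrangle and of a generalized
  hexagon: over a field with \<open>q\<close> elements, both sides have \<open>q ^ 3\<close> respectively \<open>q ^ 5\<close> vertices, all
  degrees are \<open>q\<close>, and the girth exceeds 6, respectively 10 in characteristic three.\<close>

fun quadrangle :: "'a::field \<times> 'a \<times> 'a \<Rightarrow> 'a \<times> 'a \<times> 'a \<Rightarrow> bool" where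
  "quadrangle (a, x2, x3) (b, y2, y3) \<longleftrightarrow> x2 + y2 = a * b \<and> x3 + y3 = a * b ^ 2"

fun hexagon :: "'a::field \<times> 'a \<times> 'a \<times> 'a \<times> 'a \<Rightarrow> 'a \<times> 'a \<times> 'a \<times> 'a \<times> 'a \<Rightarrow> bool" where
  "hexagon (a, x2, x3, x4, x5) (b, y2, y3, y4, y5) \<longleftrightarrow>
     x2 + y2 = a * b \<and> x3 + y3 = a * b ^ 2 \<and> x4 + y4 = a * b ^ 3 \<and> x5 + y5 = a ^ 2 * b ^ 3"

lemma quadrangle_first_coord:
  "quadrangle U V \<Longrightarrow> quadrangle U' V \<Longrightarrow> U \<noteq> U' \<Longrightarrow> fst U \<noteq> fst U'"
  "quadrangle U V \<Longrightarrow> quadrangle U V' \<Longrightarrow> V \<noteq> V' \<Longrightarrow> fst V \<noteq> fst V'"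
  by (cases U; cases U'; cases V; auto simp: eq_diff_eq[symmetric])
     (cases U; cases V; cases V'; auto simp: add.commute[of "fst U"] eq_diff_eq[symmetric])

lemma quadrangle_diff:
  assumes "quadrangle U V" "quadrangle U' V"
  shows "(fst U - fst U') * fst V = fst (snd U) - fst (snd U')"
    "(fst U - fst U') * fst V ^ 2 = snd (snd U) - snd (snd U')"
  using assms by (cases U; cases U'; cases V; simp add: left_diff_distrib flip: eq_diff_eq)+

lemma hexagon_first_coord:
  "hexagon U V \<Longrightarrow> hexagon U' V \<Longrightarrow> U \<noteq> U' \<Longrightarrow> fst U \<noteq> fst U'"
  "hexagon U V \<Longrightarrow> hexagon U V' \<Longrightarrow> V \<noteq> V' \<Longrightarrow> fst V \<noteq> fst V'"
  by (cases U; cases U'; cases V; auto simp: eq_diff_eq[symmetric])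
     (cases U; cases V; cases V'; auto simp: add.commute[of "fst U"] eq_diff_eq[symmetric])

lemma hexagon_diff:
  assumes "hexagon U V" "hexagon U' V"
  shows "(fst U - fst U') * fst V = fst (snd U) - fst (snd U')"
    "(fst U - fst U') * fst V ^ 2 = fst (snd (snd U)) - fst (snd (snd U'))"
    "(fst U - fst U') * fst V ^ 3 = fst (snd (snd (snd U))) - fst (snd (snd (snd U')))"
    "(fst U ^ 2 - fst U' ^ 2) * fst V ^ 3 = snd (snd (snd (snd U))) - snd (snd (snd (snd U')))"
  using assms by (cases U; cases U'; cases V; simp add: left_diff_distrib flip: eq_diff_eq)+

text \<open>Around a closed walk each defining equation telescopes to \<open>\<Sum> f(a\<^sub>i, b\<^sub>i) - f(a\<^sub>i\<^sub>+\<^sub>1, b\<^sub>i) = 0\<close>.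
  The equations with \<open>f = a * b ^ m\<close> say that the weights \<open>e\<^sub>i = a\<^sub>i - a\<^sub>i\<^sub>+\<^sub>1\<close> at the nodes \<open>b\<^sub>i\<close> annihilate
  all polynomials of small degree. Testing against polynomials that vanish at all nodes but one
  gives the contradictions below.\<close>

lemma three_nodes:
  fixes b0 b1 b2 :: "'a :: field"
  assumes "e0 + e1 + e2 = 0" "e0 * b0 + e1 * b1 + e2 * b2 = 0" "e0 * b0 ^ 2 + e1 * b1 ^ 2 + e2 * b2 ^ 2 = 0"
    and "b0 \<noteq> b1" "b0 \<noteq> b2"
  shows "e0 = 0"
proof -
  have "e0 * ((b0 - b1) * (b0 - b2)) = (e0 * b0 ^ 2 + e1 * b1 ^ 2 + e2 * b2 ^ 2)
      - (b1 + b2) * (e0 * b0 + e1 * b1 + e2 * b2) + b1 * b2 * (e0 + e1 + e2)"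
    by (simp add: algebra_simps power2_eq_square)
  then show ?thesis using assms by simp
qed

lemma four_nodes:
  fixes b0 b1 b2 b3 :: "'a :: field"
  assumes "e0 + e1 + e2 + e3 = 0" "e0 * b0 + e1 * b1 + e2 * b2 + e3 * b3 = 0"
    "e0 * b0 ^ 2 + e1 * b1 ^ 2 + e2 * b2 ^ 2 + e3 * b3 ^ 2 = 0"
    "e0 * b0 ^ 3 + e1 * b1 ^ 3 + e2 * b2 ^ 3 + e3 * b3 ^ 3 = 0"
    and "b0 \<noteq> b1" "b0 \<noteq> b2" "b0 \<noteq> b3"
  shows "e0 = 0"
proof -
  have "e0 * ((b0 - b1) * (b0 - b2) * (b0 - b3))
      = (e0 * b0 ^ 3 + e1 * b1 ^ 3 + e2 * b2 ^ 3 + e3 * b3 ^ 3)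
      - (b1 + b2 + b3) * (e0 * b0 ^ 2 + e1 * b1 ^ 2 + e2 * b2 ^ 2 + e3 * b3 ^ 2)
      + (b1 * b2 + b1 * b3 + b2 * b3) * (e0 * b0 + e1 * b1 + e2 * b2 + e3 * b3)
      - b1 * b2 * b3 * (e0 + e1 + e2 + e3)"
    by (simp add: algebra_simps power2_eq_square power3_eq_cube)
  then show ?thesis using assms by simp
qed

text \<open>If the nodes \<open>b0\<close> and \<open>b2\<close> coincided, their weights would add up, and at most four nodes would be
  left, among them one that carries a single nonzero weight.\<close>

lemma five_nodes_distinct:
  fixes b0 b1 b2 b3 b4 :: "'a :: field"
  assumes m: "e0 + e1 + e2 + e3 + e4 = 0" "e0 * b0 + e1 * b1 + e2 * b2 + e3 * b3 + e4 * b4 = 0"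
    "e0 * b0 ^ 2 + e1 * b1 ^ 2 + e2 * b2 ^ 2 + e3 * b3 ^ 2 + e4 * b4 ^ 2 = 0"
    "e0 * b0 ^ 3 + e1 * b1 ^ 3 + e2 * b2 ^ 3 + e3 * b3 ^ 3 + e4 * b4 ^ 3 = 0"
    and b: "b0 \<noteq> b1" "b1 \<noteq> b2" "b2 \<noteq> b3" "b3 \<noteq> b4" "b4 \<noteq> b0"
    and e: "e1 \<noteq> 0" "e3 \<noteq> 0" "e4 \<noteq> 0"
  shows "b0 \<noteq> b2"
proof
  assume eq: "b0 = b2"
  consider "b1 \<noteq> b3" "b1 \<noteq> b4" | "b1 = b3" | "b1 = b4" by blast
  then show False
  proof cases
    case 1
    have "e1 = 0"
      by (rule four_nodes[of e1 "e0 + e2" e3 e4 b1 b0 b3 b4])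
        (use m b 1 eq in \<open>simp_all add: algebra_simps\<close>)
    then show False using e by simp
  next
    case 2
    have "e4 = 0"
      by (rule three_nodes[of e4 "e0 + e2" "e1 + e3" b4 b0 b1])
        (use m b 2 eq in \<open>simp_all add: algebra_simps\<close>)
    then show False using e by simp
  next
    case 3
    have "e3 = 0"
      by (rule three_nodes[of e3 "e0 + e2" "e1 + e4" b3 b0 b1])
        (use m b 3 eq in \<open>simp_all add: algebra_simps\<close>)
    then show False using e by simp
  qed
qed

lemma closed_walk_lengths:
  assumes "closed_walk R ps" "nonbacktracking ps" "ps \<noteq> []" "length ps \<le> 5"
  obtains (2) X0 Y0 X1 Y1 where "length ps = 2" "R X0 Y0" "R X1 Y0" "R X1 Y1" "R X0 Y1" "X0 \<noteq> X1" "Y0 \<noteq> Y1"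
  | (3) X0 Y0 X1 Y1 X2 Y2 where "length ps = 3" "R X0 Y0" "R X1 Y0" "R X1 Y1" "R X2 Y1" "R X2 Y2" "R X0 Y2"
     "X0 \<noteq> X1" "X1 \<noteq> X2" "X2 \<noteq> X0" "Y0 \<noteq> Y1" "Y1 \<noteq> Y2" "Y2 \<noteq> Y0"
  | (4) X0 Y0 X1 Y1 X2 Y2 X3 Y3 where "length ps = 4" "R X0 Y0" "R X1 Y0" "R X1 Y1" "R X2 Y1" "R X2 Y2" "R X3 Y2"
     "R X3 Y3" "R X0 Y3" "X0 \<noteq> X1" "X1 \<noteq> X2" "X2 \<noteq> X3" "X3 \<noteq> X0" "Y0 \<noteq> Y1" "Y1 \<noteq> Y2" "Y2 \<noteq> Y3" "Y3 \<noteq> Y0"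
  | (5) X0 Y0 X1 Y1 X2 Y2 X3 Y3 X4 Y4 where "length ps = 5" "R X0 Y0" "R X1 Y0" "R X1 Y1" "R X2 Y1" "R X2 Y2" "R X3 Y2"
     "R X3 Y3" "R X4 Y3" "R X4 Y4" "R X0 Y4" "X0 \<noteq> X1" "X1 \<noteq> X2" "X2 \<noteq> X3" "X3 \<noteq> X4" "X4 \<noteq> X0"
     "Y0 \<noteq> Y1" "Y1 \<noteq> Y2" "Y2 \<noteq> Y3" "Y3 \<noteq> Y4" "Y4 \<noteq> Y0"
proof -
  note w = assms(1,2)[unfolded closed_walk_def nonbacktracking_def]
  have "length ps \<in> {1, 2, 3, 4, 5}" using assms(3,4) by (cases "length ps") auto
  then consider "length ps = 1" | "length ps = 2" | "length ps = 3" | "length ps = 4" | "length ps = 5" by auto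
  then show thesis
  proof cases
    case l: 1
    then show thesis using w(2) by (auto simp: length_Suc_conv)
  next
    case l: 2
    then obtain p0 p1 where ps: "ps = [p0, p1]" by (auto simp: length_Suc_conv numeral_eq_Suc)
    show thesis using w l unfolding ps by (intro 2[of "fst p0" "snd p0" "fst p1" "snd p1"]) (auto simp: case_prod_beta ps)
  next
    case l: 3
    then obtain p0 p1 p2 where ps: "ps = [p0, p1, p2]" by (auto simp: length_Suc_conv numeral_eq_Suc)
    show thesis using w l unfolding ps
      by (intro 3[of "fst p0" "snd p0" "fst p1" "snd p1" "fst p2" "snd p2"]) (auto simp: case_prod_beta ps)
  next
    case l: 4
    then obtain p0 p1 p2 p3 where ps: "ps = [p0, p1, p2, p3]" by (auto simp: length_Suc_conv numeral_eq_Suc)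
    show thesis using w l unfolding ps
      by (intro 4[of "fst p0" "snd p0" "fst p1" "snd p1" "fst p2" "snd p2" "fst p3" "snd p3"])
        (auto simp: case_prod_beta ps)
  next
    case l: 5
    then obtain p0 p1 p2 p3 p4 where ps: "ps = [p0, p1, p2, p3, p4]" by (auto simp: length_Suc_conv numeral_eq_Suc)
    show thesis using w l unfolding ps
      by (intro 5[of "fst p0" "snd p0" "fst p1" "snd p1" "fst p2" "snd p2" "fst p3" "snd p3" "fst p4" "snd p4"])
        (auto simp: case_prod_beta ps)
  qed
qed

theorem girth_quadrangle: "girth_exceeds 3 (quadrangle :: 'a :: field \<times> 'a \<times> 'a \<Rightarrow> 'a \<times> 'a \<times> 'a \<Rightarrow> bool)"
  unfolding girth_exceeds_def
proof (intro allI impI notI)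
  fix ps :: "(('a :: field \<times> 'a \<times> 'a) \<times> ('a \<times> 'a \<times> 'a)) list"
  assume ps: "ps \<noteq> []" "length ps \<le> 3" "closed_walk quadrangle ps" "nonbacktracking ps"
  then have "length ps \<le> 5" by simp
  from ps(3,4,1) this show False
  proof (cases rule: closed_walk_lengths)
    case (2 X0 Y0 X1 Y1)
    note q = quadrangle_diff(1)[OF 2(2,3)] quadrangle_diff(1)[OF 2(4,5)]
    have "(fst X0 - fst X1) * (fst Y0 - fst Y1) = (fst X0 - fst X1) * fst Y0 + (fst X1 - fst X0) * fst Y1"
      by (simp add: algebra_simps)
    also have "\<dots> = 0" unfolding q by simp
    finally show False
      using quadrangle_first_coord(1)[OF 2(2,3,6)] quadrangle_first_coord(2)[OF 2(3,4,7)] by simp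
  next
    case (3 X0 Y0 X1 Y1 X2 Y2)
    note q = quadrangle_diff[OF 3(2,3)] quadrangle_diff[OF 3(4,5)] quadrangle_diff[OF 3(6,7)]
    have "fst X0 - fst X1 = 0"
      by (rule three_nodes[of _ "fst X1 - fst X2" "fst X2 - fst X0" "fst Y0" "fst Y1" "fst Y2"])
        (use q quadrangle_first_coord(2)[OF 3(3,4,11)] quadrangle_first_coord(2)[OF 3(7,2,13)] in auto)
    then show False using quadrangle_first_coord(1)[OF 3(2,3,8)] by simp
  qed (use ps(2) in auto)
qed

text \<open>Three linear equations determine four unknowns up to a common factor; they are proportional to the
  signed minors of the system.\<close>

lemma minors_proportional:
  fixes s0 :: "'a :: field"
  defines "D \<equiv> \<lambda>s0 t0 s1 t1 s2 t2 :: 'a. s0 * (t1 - t2) + s1 * (t2 - t0) + s2 * (t0 - t1)"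
  assumes "A0 + A1 + A2 + A3 = 0" "A0 * s0 + A1 * s1 + A2 * s2 + A3 * s3 = 0"
    "A0 * t0 + A1 * t1 + A2 * t2 + A3 * t3 = 0"
  shows "A0 * D s0 t0 s1 t1 s2 t2 = - A3 * D s1 t1 s2 t2 s3 t3"
    "A1 * D s0 t0 s1 t1 s2 t2 = A3 * D s0 t0 s2 t2 s3 t3"
    "A2 * D s0 t0 s1 t1 s2 t2 = - A3 * D s0 t0 s1 t1 s3 t3"
proof -
  have "A0 * D s0 t0 s1 t1 s2 t2 + A3 * D s1 t1 s2 t2 s3 t3
      = (s1 * t2 - t1 * s2) * (A0 + A1 + A2 + A3) + (t1 - t2) * (A0 * s0 + A1 * s1 + A2 * s2 + A3 * s3)
        + (s2 - s1) * (A0 * t0 + A1 * t1 + A2 * t2 + A3 * t3)"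
    by (simp add: D_def algebra_simps)
  then show "A0 * D s0 t0 s1 t1 s2 t2 = - A3 * D s1 t1 s2 t2 s3 t3"
    unfolding assms(2-4) by (simp add: eq_neg_iff_add_eq_0)
  have "A1 * D s0 t0 s1 t1 s2 t2 - A3 * D s0 t0 s2 t2 s3 t3
      = - ((s0 * t2 - t0 * s2) * (A0 + A1 + A2 + A3) + (t0 - t2) * (A0 * s0 + A1 * s1 + A2 * s2 + A3 * s3)
        + (s2 - s0) * (A0 * t0 + A1 * t1 + A2 * t2 + A3 * t3))"
    by (simp add: D_def algebra_simps)
  then show "A1 * D s0 t0 s1 t1 s2 t2 = A3 * D s0 t0 s2 t2 s3 t3"
    unfolding assms(2-4) by simp
  have "A2 * D s0 t0 s1 t1 s2 t2 + A3 * D s0 t0 s1 t1 s3 t3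
      = (s0 * t1 - t0 * s1) * (A0 + A1 + A2 + A3) + (t0 - t1) * (A0 * s0 + A1 * s1 + A2 * s2 + A3 * s3)
        + (s1 - s0) * (A0 * t0 + A1 * t1 + A2 * t2 + A3 * t3)"
    by (simp add: D_def algebra_simps)
  then show "A2 * D s0 t0 s1 t1 s2 t2 = - A3 * D s0 t0 s1 t1 s3 t3"
    unfolding assms(2-4) by (simp add: eq_neg_iff_add_eq_0)
qed

text \<open>In characteristic three this form in the minors of the rows \<open>1\<close>, \<open>s\<close> and \<open>d ^ 2\<close> is a product of
  differences of the nodes \<open>0, x, y, z, w\<close>. Over the integers the two sides differ by a multiple of three.\<close>

lemma minors_quadratic_form:
  fixes x y z w :: "'a :: field"
  defines "D \<equiv> \<lambda>s0 t0 s1 t1 s2 t2 :: 'a. s0 * (t1 - t2) + s1 * (t2 - t0) + s2 * (t0 - t1)"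
  assumes three: "(3 :: 'a) = 0"
  shows "(D (x + y) ((y - x) ^ 2) (y + z) ((z - y) ^ 2) (z + w) ((w - z) ^ 2)) ^ 2 * x
       + (D x (x ^ 2) (y + z) ((z - y) ^ 2) (z + w) ((w - z) ^ 2)) ^ 2 * (y - x)
       + (D x (x ^ 2) (x + y) ((y - x) ^ 2) (z + w) ((w - z) ^ 2)) ^ 2 * (z - y)
       + (D x (x ^ 2) (x + y) ((y - x) ^ 2) (y + z) ((z - y) ^ 2)) ^ 2 * (w - z)
       = w * w * (z - x) * (w - x) * (w - y) * y * z"
proof -
  have "(6 :: 'a) = 3 * 2" "(9 :: 'a) = 3 * 3" "(12 :: 'a) = 3 * 4" "(15 :: 'a) = 3 * 5"
    "(4 :: 'a) = 3 + 1" by simp_all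
  then have "(6 :: 'a) = 0" "(9 :: 'a) = 0" "(12 :: 'a) = 0" "(15 :: 'a) = 0" "(4 :: 'a) = 1"
    using three by simp_all
  then show ?thesis using three unfolding D_def by (simp add: algebra_simps power2_eq_square)
qed

text \<open>The nodes are distinct. Translate them, and likewise the \<open>a\<^sub>i\<close>, so that those with index 4 become
  zero, and let \<open>d\<^sub>i = b\<^sub>i - b\<^sub>i\<^sub>-\<^sub>1\<close> and \<open>s\<^sub>i = b\<^sub>i + b\<^sub>i\<^sub>-\<^sub>1\<close>. Summation by parts turns the
  first three equations into linear ones, with coefficients \<open>1\<close>, \<open>s\<^sub>i\<close> and \<open>d\<^sub>i ^ 2\<close>, for the
  four unknowns \<open>A\<^sub>i = a\<^sub>i * d\<^sub>i\<close>, and the last one into \<open>\<Sum> A\<^sub>i ^ 2 * d\<^sub>i = 0\<close>. By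
  the two preceding lemmas a product of nonzero differences vanishes.\<close>

lemma no_five_cycle_in_char_three:
  fixes a0 a1 a2 a3 a4 b0 b1 b2 b3 b4 :: "'a :: field"
  assumes three: "(3 :: 'a) = 0"
    and E1: "(a0 - a1) * b0 + (a1 - a2) * b1 + (a2 - a3) * b2 + (a3 - a4) * b3 + (a4 - a0) * b4 = 0"
    and E2: "(a0 - a1) * b0 ^ 2 + (a1 - a2) * b1 ^ 2 + (a2 - a3) * b2 ^ 2 + (a3 - a4) * b3 ^ 2 + (a4 - a0) * b4 ^ 2 = 0"
    and E3: "(a0 - a1) * b0 ^ 3 + (a1 - a2) * b1 ^ 3 + (a2 - a3) * b2 ^ 3 + (a3 - a4) * b3 ^ 3 + (a4 - a0) * b4 ^ 3 = 0"
    and E4: "(a0 ^ 2 - a1 ^ 2) * b0 ^ 3 + (a1 ^ 2 - a2 ^ 2) * b1 ^ 3 + (a2 ^ 2 - a3 ^ 2) * b2 ^ 3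
      + (a3 ^ 2 - a4 ^ 2) * b3 ^ 3 + (a4 ^ 2 - a0 ^ 2) * b4 ^ 3 = 0"
    and a: "a0 \<noteq> a1" "a1 \<noteq> a2" "a2 \<noteq> a3" "a3 \<noteq> a4" "a4 \<noteq> a0"
    and b: "b0 \<noteq> b1" "b1 \<noteq> b2" "b2 \<noteq> b3" "b3 \<noteq> b4" "b4 \<noteq> b0"
  shows False
proof -
  let ?e0 = "a0 - a1" and ?e1 = "a1 - a2" and ?e2 = "a2 - a3" and ?e3 = "a3 - a4" and ?e4 = "a4 - a0"
  note E = E1 E2 E3
  have e: "?e0 \<noteq> 0" "?e1 \<noteq> 0" "?e2 \<noteq> 0" "?e3 \<noteq> 0" "?e4 \<noteq> 0" using a by auto
  have b02: "b0 \<noteq> b2"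
    by (rule five_nodes_distinct[of ?e0 ?e1 ?e2 ?e3 ?e4 b0 b1 b2 b3 b4])
      ((use E b e in \<open>simp_all add: add_ac\<close>)[])+
  have b13: "b1 \<noteq> b3"
    by (rule five_nodes_distinct[of ?e1 ?e2 ?e3 ?e4 ?e0 b1 b2 b3 b4 b0])
      ((use E b e in \<open>simp_all add: add_ac\<close>)[])+
  have b24: "b2 \<noteq> b4"
    by (rule five_nodes_distinct[of ?e2 ?e3 ?e4 ?e0 ?e1 b2 b3 b4 b0 b1])
      ((use E b e in \<open>simp_all add: add_ac\<close>)[])+
  have b30: "b3 \<noteq> b0"
    by (rule five_nodes_distinct[of ?e3 ?e4 ?e0 ?e1 ?e2 b3 b4 b0 b1 b2])
      ((use E b e in \<open>simp_all add: add_ac\<close>)[])+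
  have b41: "b4 \<noteq> b1"
    by (rule five_nodes_distinct[of ?e4 ?e0 ?e1 ?e2 ?e3 b4 b0 b1 b2 b3])
      ((use E b e in \<open>simp_all add: add_ac\<close>)[])+
  define x y z w where "x = b0 - b4" and "y = b1 - b4" and "z = b2 - b4" and "w = b3 - b4"
  note xyzw = x_def y_def z_def w_def
  define A0 A1 A2 A3 where "A0 = (a0 - a4) * x" and "A1 = (a1 - a4) * (y - x)"
    and "A2 = (a2 - a4) * (z - y)" and "A3 = (a3 - a4) * (w - z)"
  note A = A0_def A1_def A2_def A3_def
  have "A0 + A1 + A2 + A3
      = (a0 - a1) * b0 + (a1 - a2) * b1 + (a2 - a3) * b2 + (a3 - a4) * b3 + (a4 - a0) * b4"
    by (simp add: A xyzw algebra_simps)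
  then have s0: "A0 + A1 + A2 + A3 = 0" using E1 by simp
  have "A0 * x + A1 * (x + y) + A2 * (y + z) + A3 * (z + w)
      = ((a0 - a1) * b0 ^ 2 + (a1 - a2) * b1 ^ 2 + (a2 - a3) * b2 ^ 2 + (a3 - a4) * b3 ^ 2 + (a4 - a0) * b4 ^ 2)
      - 2 * b4 * ((a0 - a1) * b0 + (a1 - a2) * b1 + (a2 - a3) * b2 + (a3 - a4) * b3 + (a4 - a0) * b4)"
    by (simp add: A xyzw algebra_simps power2_eq_square)
  then have s1: "A0 * x + A1 * (x + y) + A2 * (y + z) + A3 * (z + w) = 0" using E1 E2 by simp
  \<comment> \<open>Here characteristic three enters: cubes of differences are differences of cubes.\<close>
  have cubes: "x ^ 3 = b0 ^ 3 - b4 ^ 3" "(y - x) ^ 3 = b1 ^ 3 - b0 ^ 3" "(z - y) ^ 3 = b2 ^ 3 - b1 ^ 3"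
    "(w - z) ^ 3 = b3 ^ 3 - b2 ^ 3"
    using cube_diff[OF three] by (simp_all add: xyzw)
  have sq: "u * v * v ^ 2 = u * v ^ 3" "(u * v) ^ 2 * v = u ^ 2 * v ^ 3" for u v :: 'a
    by (simp_all add: power2_eq_square power3_eq_cube)
  have "A0 * x ^ 2 + A1 * (y - x) ^ 2 + A2 * (z - y) ^ 2 + A3 * (w - z) ^ 2
      = (a0 - a1) * b0 ^ 3 + (a1 - a2) * b1 ^ 3 + (a2 - a3) * b2 ^ 3 + (a3 - a4) * b3 ^ 3 + (a4 - a0) * b4 ^ 3"
    unfolding A sq cubes by (simp add: algebra_simps)
  then have s2: "A0 * x ^ 2 + A1 * (y - x) ^ 2 + A2 * (z - y) ^ 2 + A3 * (w - z) ^ 2 = 0" using E3 by simp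
  have "A0 ^ 2 * x + A1 ^ 2 * (y - x) + A2 ^ 2 * (z - y) + A3 ^ 2 * (w - z)
      = ((a0 ^ 2 - a1 ^ 2) * b0 ^ 3 + (a1 ^ 2 - a2 ^ 2) * b1 ^ 3 + (a2 ^ 2 - a3 ^ 2) * b2 ^ 3
      + (a3 ^ 2 - a4 ^ 2) * b3 ^ 3 + (a4 ^ 2 - a0 ^ 2) * b4 ^ 3)
      - 2 * a4 * ((a0 - a1) * b0 ^ 3 + (a1 - a2) * b1 ^ 3 + (a2 - a3) * b2 ^ 3 + (a3 - a4) * b3 ^ 3 + (a4 - a0) * b4 ^ 3)"
    unfolding A sq cubes by (simp add: algebra_simps power2_eq_square)
  then have quad: "A0 ^ 2 * x + A1 ^ 2 * (y - x) + A2 ^ 2 * (z - y) + A3 ^ 2 * (w - z) = 0"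
    using E3 E4 by simp
  define D where "D = (\<lambda>s0 t0 s1 t1 s2 t2 :: 'a. s0 * (t1 - t2) + s1 * (t2 - t0) + s2 * (t0 - t1))"
  define K where "K = D x (x ^ 2) (x + y) ((y - x) ^ 2) (y + z) ((z - y) ^ 2)"
  define M0 where "M0 = D (x + y) ((y - x) ^ 2) (y + z) ((z - y) ^ 2) (z + w) ((w - z) ^ 2)"
  define M1 where "M1 = D x (x ^ 2) (y + z) ((z - y) ^ 2) (z + w) ((w - z) ^ 2)"
  define M2 where "M2 = D x (x ^ 2) (x + y) ((y - x) ^ 2) (z + w) ((w - z) ^ 2)"
  have minors: "A0 * K = - A3 * M0" "A1 * K = A3 * M1" "A2 * K = - A3 * M2"
    using minors_proportional[OF s0 s1 s2] by (simp_all add: D_def K_def M0_def M1_def M2_def)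
  have "A3 ^ 2 * (M0 ^ 2 * x + M1 ^ 2 * (y - x) + M2 ^ 2 * (z - y) + K ^ 2 * (w - z))
      = (A0 * K) ^ 2 * x + (A1 * K) ^ 2 * (y - x) + (A2 * K) ^ 2 * (z - y) + (A3 * K) ^ 2 * (w - z)"
    unfolding minors by (simp add: power_mult_distrib distrib_left mult.assoc)
  also have "\<dots> = K ^ 2 * (A0 ^ 2 * x + A1 ^ 2 * (y - x) + A2 ^ 2 * (z - y) + A3 ^ 2 * (w - z))"
    by (simp add: power_mult_distrib distrib_left mult_ac)
  also have "\<dots> = 0" unfolding quad by simp
  also have "M0 ^ 2 * x + M1 ^ 2 * (y - x) + M2 ^ 2 * (z - y) + K ^ 2 * (w - z)
      = w * w * (z - x) * (w - x) * (w - y) * y * z"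
    using minors_quadratic_form[OF three, of x y z w] by (simp add: D_def K_def M0_def M1_def M2_def)
  finally have "A3 ^ 2 * (w * w * (z - x) * (w - x) * (w - y) * y * z) = 0" .
  then show False
    using a b b02 b13 b24 b30 b41 by (auto simp: A3_def xyzw)
qed

text \<open>Here the first three equations leave only \<open>b0 = b2\<close> and \<open>b1 = b3\<close>. As cubing is injective in
  characteristic three, the last equation then says that \<open>a0, a2\<close> and \<open>a1, a3\<close>, which have equal sums,
  also have equal sums of squares.\<close>

lemma no_four_cycle_in_char_three:
  fixes a0 a1 a2 a3 b0 b1 b2 b3 :: "'a :: field"
  assumes three: "(3 :: 'a) = 0"
    and E1: "(a0 - a1) * b0 + (a1 - a2) * b1 + (a2 - a3) * b2 + (a3 - a0) * b3 = 0"
    and E2: "(a0 - a1) * b0 ^ 2 + (a1 - a2) * b1 ^ 2 + (a2 - a3) * b2 ^ 2 + (a3 - a0) * b3 ^ 2 = 0"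
    and E3: "(a0 - a1) * b0 ^ 3 + (a1 - a2) * b1 ^ 3 + (a2 - a3) * b2 ^ 3 + (a3 - a0) * b3 ^ 3 = 0"
    and E4: "(a0 ^ 2 - a1 ^ 2) * b0 ^ 3 + (a1 ^ 2 - a2 ^ 2) * b1 ^ 3 + (a2 ^ 2 - a3 ^ 2) * b2 ^ 3
      + (a3 ^ 2 - a0 ^ 2) * b3 ^ 3 = 0"
    and a: "a0 \<noteq> a1" "a1 \<noteq> a2" "a2 \<noteq> a3" "a3 \<noteq> a0"
    and b: "b0 \<noteq> b1" "b1 \<noteq> b2" "b2 \<noteq> b3" "b3 \<noteq> b0"
  shows False
proof -
  have "b0 = b2"
  proof (rule ccontr)
    assume "b0 \<noteq> b2"
    then have "a0 - a1 = 0"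
      using b by (intro four_nodes[OF _ E1 E2 E3]) auto
    then show False using a by simp
  qed
  have "b1 = b3"
  proof (rule ccontr)
    assume "b1 \<noteq> b3"
    then have "a1 - a2 = 0"
      using b E1 E2 E3 by (intro four_nodes[of "a1 - a2" "a2 - a3" "a3 - a0" "a0 - a1" b1 b2 b3 b0]) (auto simp: add_ac)
    then show False using a by simp
  qed
  have "(a0 - a1 + a2 - a3) * (b0 - b1) = 0"
    using E1 unfolding \<open>b0 = b2\<close> \<open>b1 = b3\<close> by (simp add: algebra_simps)
  then have "a0 - a1 + a2 - a3 = 0" using b by simp
  then have lin: "a0 - a1 = a3 - a2" by (simp add: algebra_simps)
  have "(a0 ^ 2 - a1 ^ 2 + a2 ^ 2 - a3 ^ 2) * (b0 - b1) ^ 3 = 0"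
    using E4 unfolding cube_diff[OF three] \<open>b0 = b2\<close> \<open>b1 = b3\<close> by (simp add: algebra_simps)
  then have "a0 ^ 2 - a1 ^ 2 + a2 ^ 2 - a3 ^ 2 = 0" using b by simp
  then have "a0 ^ 2 - a1 ^ 2 = a3 ^ 2 - a2 ^ 2" by (simp add: algebra_simps)
  then have "(a0 - a1) * (a0 + a1) = (a3 - a2) * (a3 + a2)"
    by (simp add: algebra_simps power2_eq_square)
  then have "a0 + a1 = a3 + a2" using lin a by simp
  moreover have "a0 + a2 = a3 + a1" using lin by (simp add: algebra_simps)
  moreover have "(a1 - a2) * 2 = (a0 + a1) - (a3 + a2) - ((a0 + a2) - (a3 + a1))"
    by (simp add: algebra_simps)
  ultimately have "(a1 - a2) * 2 = 0" by simp
  moreover have "(2 :: 'a) \<noteq> 0"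
  proof
    assume "(2 :: 'a) = 0"
    then have "(3 :: 'a) - 2 = 0" using three by simp
    then show False by simp
  qed
  ultimately show False using a by simp
qed

theorem girth_hexagon:
  assumes three: "(3 :: 'a) = 0"
  shows "girth_exceeds 5
    (hexagon :: 'a :: field \<times> 'a \<times> 'a \<times> 'a \<times> 'a \<Rightarrow> 'a \<times> 'a \<times> 'a \<times> 'a \<times> 'a \<Rightarrow> bool)"
  unfolding girth_exceeds_def
proof (intro allI impI notI)
  fix ps :: "(('a \<times> 'a \<times> 'a \<times> 'a \<times> 'a) \<times> ('a \<times> 'a \<times> 'a \<times> 'a \<times> 'a)) list"
  assume ps: "ps \<noteq> []" "length ps \<le> 5" "closed_walk hexagon ps" "nonbacktracking ps"
  from ps(3,4,1,2) show False
  proof (cases rule: closed_walk_lengths)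
    case (2 X0 Y0 X1 Y1)
    note q = hexagon_diff(1)[OF 2(2,3)] hexagon_diff(1)[OF 2(4,5)]
    have "(fst X0 - fst X1) * (fst Y0 - fst Y1) = (fst X0 - fst X1) * fst Y0 + (fst X1 - fst X0) * fst Y1"
      by (simp add: algebra_simps)
    also have "\<dots> = 0" unfolding q by simp
    finally show False
      using hexagon_first_coord(1)[OF 2(2,3,6)] hexagon_first_coord(2)[OF 2(3,4,7)] by simp
  next
    case (3 X0 Y0 X1 Y1 X2 Y2)
    note q = hexagon_diff[OF 3(2,3)] hexagon_diff[OF 3(4,5)] hexagon_diff[OF 3(6,7)]
    have "fst X0 - fst X1 = 0"
      by (rule three_nodes[of _ "fst X1 - fst X2" "fst X2 - fst X0" "fst Y0" "fst Y1" "fst Y2"])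
        (use q hexagon_first_coord(2)[OF 3(3,4,11)] hexagon_first_coord(2)[OF 3(7,2,13)] in auto)
    then show False using hexagon_first_coord(1)[OF 3(2,3,8)] by simp
  next
    case (4 X0 Y0 X1 Y1 X2 Y2 X3 Y3)
    note q = hexagon_diff[OF 4(2,3)] hexagon_diff[OF 4(4,5)] hexagon_diff[OF 4(6,7)] hexagon_diff[OF 4(8,9)]
    show False
      by (rule no_four_cycle_in_char_three[OF three, of "fst X0" "fst X1" "fst Y0" "fst X2" "fst Y1" "fst X3" "fst Y2" "fst Y3"])
       (unfold q, simp_all,
        (fact hexagon_first_coord(1)[OF 4(2,3,10)] hexagon_first_coord(1)[OF 4(4,5,11)]
          hexagon_first_coord(1)[OF 4(6,7,12)] hexagon_first_coord(1)[OF 4(8,9,13)]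
          hexagon_first_coord(2)[OF 4(3,4,14)] hexagon_first_coord(2)[OF 4(5,6,15)]
          hexagon_first_coord(2)[OF 4(7,8,16)] hexagon_first_coord(2)[OF 4(9,2,17)])+)
  next
    case (5 X0 Y0 X1 Y1 X2 Y2 X3 Y3 X4 Y4)
    note q = hexagon_diff[OF 5(2,3)] hexagon_diff[OF 5(4,5)] hexagon_diff[OF 5(6,7)] hexagon_diff[OF 5(8,9)]
      hexagon_diff[OF 5(10,11)]
    show False
      by (rule no_five_cycle_in_char_three[OF three, of "fst X0" "fst X1" "fst Y0" "fst X2" "fst Y1" "fst X3"
            "fst Y2" "fst X4" "fst Y3" "fst Y4"])
       (unfold q, simp_all,
        (fact hexagon_first_coord(1)[OF 5(2,3,12)] hexagon_first_coord(1)[OF 5(4,5,13)]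
          hexagon_first_coord(1)[OF 5(6,7,14)] hexagon_first_coord(1)[OF 5(8,9,15)]
          hexagon_first_coord(1)[OF 5(10,11,16)]
          hexagon_first_coord(2)[OF 5(3,4,17)] hexagon_first_coord(2)[OF 5(5,6,18)]
          hexagon_first_coord(2)[OF 5(7,8,19)] hexagon_first_coord(2)[OF 5(9,10,20)]
          hexagon_first_coord(2)[OF 5(11,2,21)])+)
  qed
qed

section \<open>Blowing up a bipartite graph of large girth\<close>

lemma mod_add_left_cancel_nat: "(a + i) mod l = (a + j) mod l \<longleftrightarrow> i mod l = j mod (l :: nat)"
proof (cases "i \<le> j")
  case True
  then show ?thesis using mod_eq_dvd_iff_nat[of "a + i" "a + j" l] mod_eq_dvd_iff_nat[of i j l] by (auto simp: eq_commute)
next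
  case False
  then show ?thesis using mod_eq_dvd_iff_nat[of "a + j" "a + i" l] mod_eq_dvd_iff_nat[of j i l] by simp
qed

lemma closed_walk_iff_nth:
  "closed_walk R ps \<longleftrightarrow> (\<forall>i<length ps. R (fst (ps ! i)) (snd (ps ! i)) \<and>
      R (fst (ps ! (Suc i mod length ps))) (snd (ps ! i)))"
  unfolding closed_walk_def list_all2_conv_all_nth
  by (auto simp: nth_rotate1 case_prod_beta)

lemma closed_walk_rotate1:
  assumes "closed_walk R ps"
  shows "closed_walk R (rotate1 ps)"
  unfolding closed_walk_iff_nth
proof (intro allI impI)
  fix i assume i: "i < length (rotate1 ps)"
  let ?j = "Suc i mod length ps"
  have j: "?j < length ps" using i by (intro mod_less_divisor) auto
  then show "R (fst (rotate1 ps ! i)) (snd (rotate1 ps ! i)) \<and>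
      R (fst (rotate1 ps ! (Suc i mod length (rotate1 ps)))) (snd (rotate1 ps ! i))"
    using assms i unfolding closed_walk_iff_nth by (simp add: nth_rotate1)
qed

lemma closed_walk_rotate: "closed_walk R ps \<Longrightarrow> closed_walk R (rotate m ps)"
  by (induction m) (simp_all add: closed_walk_rotate1)

lemma nonbacktracking_iff_nth:
  "nonbacktracking ps \<longleftrightarrow> (\<forall>i<length ps. fst (ps ! i) \<noteq> fst (ps ! (Suc i mod length ps)) \<and>
      snd (ps ! i) \<noteq> snd (ps ! (Suc i mod length ps)))"
  unfolding nonbacktracking_def list_all2_conv_all_nth
  by (auto simp: nth_rotate1 case_prod_beta)

text \<open>If a short closed walk never repeats a vertex on the right, it must turn around at some vertex on
  the left; cutting out such turns one after the other, nothing remains, so it stays at a single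
  vertex on the left.\<close>

lemma closed_walk_constant:
  assumes "girth_exceeds k R" "closed_walk R ps" "distinct (map snd ps)" "length ps \<le> k"
  shows "\<exists>x. \<forall>p\<in>set ps. fst p = x"
  using assms(2-4)
proof (induction "length ps" arbitrary: ps rule: less_induct)
  case less
  consider "length ps \<le> 1" | "2 \<le> length ps" by linarith
  then show ?case
  proof cases
    case 1
    then show ?thesis by (cases ps) auto
  next
    case 2
    let ?n = "length ps"
    have "\<not> nonbacktracking ps"
    proof -
      have "ps \<noteq> []" using 2 by auto
      then show ?thesis using assms(1) less.prems(1,3) unfolding girth_exceeds_def by blast
    qed
    then obtain i where i: "i < ?n" and
      "fst (ps ! i) = fst (ps ! (Suc i mod ?n)) \<or> snd (ps ! i) = snd (ps ! (Suc i mod ?n))"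
      unfolding nonbacktracking_iff_nth by blast
    moreover have "snd (ps ! i) \<noteq> snd (ps ! (Suc i mod ?n))"
    proof
      assume "snd (ps ! i) = snd (ps ! (Suc i mod ?n))"
      moreover have j: "Suc i mod ?n < ?n" using i by (intro mod_less_divisor) auto
      ultimately have "map snd ps ! i = map snd ps ! (Suc i mod ?n)" using i by simp
      then have "i = Suc i mod ?n"
        using less.prems(2) i j by (subst (asm) nth_eq_iff_index_eq) auto
      then show False using i 2 by (auto simp: mod_Suc split: if_splits)
    qed
    ultimately have turn: "fst (ps ! i) = fst (ps ! (Suc i mod ?n))" by blast
    define qs where "qs = rotate i ps"
    have lq: "length qs = ?n" by (simp add: qs_def)
    then obtain p0 p1 rest where qs: "qs = p0 # p1 # rest"
      using 2 by (cases qs; cases "tl qs") auto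
    have "qs ! 0 = ps ! i" "qs ! 1 = ps ! (Suc i mod ?n)"
      using i 2 nth_rotate[of 0 ps i] nth_rotate[of 1 ps i] unfolding qs_def by (cases "ps = []"; simp)+
    then have eq: "fst p0 = fst p1" using turn qs by simp
    have "closed_walk R qs" unfolding qs_def using less.prems(1) by (rule closed_walk_rotate)
    then have "closed_walk R (p1 # rest)"
      unfolding qs closed_walk_def using eq by (auto simp: list_all2_append2 list_all2_Cons2 case_prod_beta)
    moreover have "distinct (map snd qs)" unfolding qs_def using less.prems(2) by (simp flip: rotate_map)
    then have "distinct (map snd (p1 # rest))" unfolding qs by simp
    moreover have "length (p1 # rest) < ?n" using lq qs by simp
    ultimately obtain x where x: "\<forall>p\<in>set (p1 # rest). fst p = x"
      using less.hyps[of "p1 # rest"] less.prems(3) by auto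
    have "set ps = set qs" by (simp add: qs_def)
    then have "\<forall>p\<in>set ps. fst p = x" using x eq unfolding qs by auto
    then show ?thesis by blast
  qed
qed

text \<open>A walk from \<open>x\<close> to \<open>x'\<close>, where every pair is a vertex on the left with the vertex on the right
  that follows it.\<close>

fun open_walk :: "('x \<Rightarrow> 'y \<Rightarrow> bool) \<Rightarrow> 'x \<Rightarrow> ('x \<times> 'y) list \<Rightarrow> 'x \<Rightarrow> bool" where
  "open_walk R x [] x' \<longleftrightarrow> x = x'"
| "open_walk R x (p # ps) x' \<longleftrightarrow> fst p = x \<and> R x (snd p) \<and> (\<exists>x1. R x1 (snd p) \<and> open_walk R x1 ps x')"

lemma open_walk_hd: "open_walk R x ps x' \<Longrightarrow> ps \<noteq> [] \<Longrightarrow> fst (hd ps) = x"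
  by (cases ps) auto

lemma open_walk_list_all2:
  assumes "open_walk R x ps x'" "fst p' = x'" "ps \<noteq> []"
  shows "list_all2 (\<lambda>(x, y) (x', y'). R x y \<and> R x' y) ps (tl ps @ [p'])"
  using assms
proof (induction ps arbitrary: x)
  case (Cons p ps)
  then obtain x1 where x1: "fst p = x" "R x (snd p)" "R x1 (snd p)" "open_walk R x1 ps x'" by auto
  show ?case
  proof (cases "ps = []")
    case True
    then show ?thesis using x1 Cons.prems(2) by (auto simp: case_prod_beta)
  next
    case False
    then show ?thesis
      using Cons.IH[OF x1(4) Cons.prems(2) False] x1 open_walk_hd[OF x1(4) False]
      by (cases ps) (auto simp: case_prod_beta)
  qed
qed simp

lemma open_walk_closed: "open_walk R x ps x \<Longrightarrow> closed_walk R ps"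
  using open_walk_list_all2[of R x ps x "hd ps"] open_walk_hd[of R x ps x]
  by (cases ps) (auto simp: closed_walk_def)

lemma has_cycleE:
  assumes "has_cycle l E" "0 < l"
  obtains u where "\<And>i. {u i, u (Suc i)} \<in> E" "\<And>i j. u i = u j \<longleftrightarrow> i mod l = j mod l"
proof -
  obtain v where v: "inj_on v {..<l}" "\<And>i. i < l \<Longrightarrow> {v i, v (Suc i mod l)} \<in> E"
    using assms(1) unfolding has_cycle_def by blast
  show thesis
  proof (rule that[of "\<lambda>i. v (i mod l)"])
    show "{v (i mod l), v (Suc i mod l)} \<in> E" for i
      using v(2)[of "i mod l"] assms(2) by (simp add: mod_Suc_eq)
    show "v (i mod l) = v (j mod l) \<longleftrightarrow> i mod l = j mod l" for i j
      using v(1) assms(2) by (simp add: inj_on_eq_iff)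
  qed
qed

text \<open>Every vertex on the left of a bipartite graph \<open>R\<close> is replaced by a blob, a star whose centre lies in
  \<open>Z\<close>; the vertices of all blobs form \<open>K\<close>. A vertex outside \<open>K\<close> may be joined to the centre of an adjacent
  blob and to one further vertex of it.\<close>

locale blow_up =
  fixes E :: "'v set set" and K Z :: "'v set" and blob :: "'v \<Rightarrow> 'x" and R :: "'x \<Rightarrow> 'v \<Rightarrow> bool"
  assumes inside: "{u, v} \<in> E \<Longrightarrow> u \<in> K \<Longrightarrow> v \<in> K \<Longrightarrow> blob u = blob v \<and> (u \<in> Z \<or> v \<in> Z)"
    and outside: "{u, v} \<in> E \<Longrightarrow> u \<in> K \<or> v \<in> K"
    and across: "{y, v} \<in> E \<Longrightarrow> y \<notin> K \<Longrightarrow> v \<in> K \<Longrightarrow> R (blob v) y"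
    and center: "u \<in> K \<inter> Z \<Longrightarrow> v \<in> K \<inter> Z \<Longrightarrow> blob u = blob v \<Longrightarrow> u = v"
    and leaf: "{y, u} \<in> E \<Longrightarrow> {y, v} \<in> E \<Longrightarrow> y \<notin> K \<Longrightarrow> u \<in> K - Z \<Longrightarrow> v \<in> K - Z \<Longrightarrow> blob u = blob v \<Longrightarrow> u = v"
begin

text \<open>Contracting each blob to a point turns a path that begins and ends in blobs into a walk in \<open>R\<close>.\<close>

lemma project_path:
  assumes "successively (\<lambda>u v. {u, v} \<in> E) vs" "vs \<noteq> []" "hd vs \<in> K" "last vs \<in> K"
  shows "\<exists>ps. open_walk R (blob (hd vs)) ps (blob (last vs)) \<and> map snd ps = filter (\<lambda>v. v \<notin> K) vs \<and>
    (\<forall>v\<in>set vs \<inter> K. blob v \<in> insert (blob (last vs)) (fst ` set ps))"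
  using assms
proof (induction vs rule: induct_list012)
  case (2 u)
  then show ?case by (intro exI[of _ "[]"]) auto
next
  case (3 u v vs)
  then have uv: "{u, v} \<in> E" "u \<in> K" by auto
  show ?case
  proof (cases "v \<in> K")
    case True
    then obtain ps where ps: "open_walk R (blob v) ps (blob (last (v # vs)))"
      "map snd ps = filter (\<lambda>v. v \<notin> K) (v # vs)"
      "\<forall>w\<in>set (v # vs) \<inter> K. blob w \<in> insert (blob (last (v # vs))) (fst ` set ps)"
      using 3 by auto
    have "blob u = blob v" using inside[OF uv True] by simp
    then show ?thesis using ps uv(2) True by (intro exI[of _ ps]) auto
  next
    case False
    then have ne: "vs \<noteq> []" using 3(6) by auto
    define w where "w = hd vs"
    have "{v, w} \<in> E" using 3(3) ne by (cases vs) (auto simp: w_def)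
    then have w: "w \<in> K" "R (blob w) v" using outside[of v w] across[of v w] False by auto
    have "R (blob u) v" using across[of v u] uv False by (simp add: insert_commute)
    have "successively (\<lambda>u v. {u, v} \<in> E) vs" using 3(3) ne by (cases vs) auto
    then obtain ps where ps: "open_walk R (blob w) ps (blob (last vs))"
      "map snd ps = filter (\<lambda>v. v \<notin> K) vs"
      "\<forall>w\<in>set vs \<inter> K. blob w \<in> insert (blob (last vs)) (fst ` set ps)"
      using 3(1) ne w(1) 3(6) by (auto simp: w_def)
    show ?thesis
      using ps \<open>R (blob u) v\<close> w False uv(2) ne
      by (intro exI[of _ "(blob u, v) # ps"]) auto
  qed
qed simp

text \<open>A cycle of length \<open>2 * k\<close> has at most \<open>k\<close> vertices outside \<open>K\<close>, so its projection is too
  short to leave a single blob. But there, once the centre is removed, only stars remain around the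
  leaves of the blob, and these contain no path with five vertices.\<close>

lemma no_long_even_cycle:
  assumes girth: "girth_exceeds k R" and k: "3 \<le> k"
  shows "\<not> has_cycle (2 * k) E"
proof
  assume "has_cycle (2 * k) E"
  then obtain u0 where u0: "\<And>i. {u0 i, u0 (Suc i)} \<in> E"
    "\<And>i j. u0 i = u0 j \<longleftrightarrow> i mod (2 * k) = j mod (2 * k)"
    using k by (elim has_cycleE) auto
  obtain i0 where i0: "u0 i0 \<in> K" using outside[OF u0(1)[of 0]] by blast
  define u where "u i = u0 (i0 + i)" for i
  define l where "l = 2 * k"
  have adj: "{u i, u (Suc i)} \<in> E" for i using u0(1)[of "i0 + i"] by (simp add: u_def)
  have u_eq: "u i = u j \<longleftrightarrow> i mod l = j mod l" for i j
    unfolding u_def u0(2) l_def[symmetric]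
    by (rule mod_add_left_cancel_nat)
  have uK: "u 0 \<in> K" using i0 by (simp add: u_def)
  have ul: "u l = u 0" by (simp add: u_eq)
  define vs where "vs = map u [0..<Suc l]"
  define out where "out = {i. i < l \<and> u i \<notin> K}"
  have vs: "successively (\<lambda>u v. {u, v} \<in> E) vs" "vs \<noteq> []" "hd vs = u 0" "last vs = u 0"
    using adj ul by (auto simp: vs_def successively_conv_nth hd_map last_map simp del: upt_Suc)
  then obtain ps where ps: "open_walk R (blob (u 0)) ps (blob (u 0))"
    "map snd ps = filter (\<lambda>v. v \<notin> K) vs"
    "\<forall>v\<in>set vs \<inter> K. blob v \<in> insert (blob (u 0)) (fst ` set ps)"
    using project_path[OF vs(1,2)] uK by auto
  have flt: "filter (\<lambda>v. v \<notin> K) vs = filter (\<lambda>v. v \<notin> K) (map u [0..<l])"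
    using uK ul by (simp add: vs_def)
  have inj: "inj_on u {..<l}" by (intro inj_onI) (simp add: u_eq)
  have dist: "distinct (map snd ps)"
    unfolding ps(2) flt using inj
    by (intro distinct_filter) (auto simp: distinct_map atLeast0LessThan)
  have "length ps = card (set (map snd ps))" using dist by (metis distinct_card length_map)
  also have "set (map snd ps) = u ` out"
    unfolding ps(2) flt by (auto simp: out_def)
  also have "card \<dots> \<le> card out" by (intro card_image_le) (simp add: out_def)
  finally have "length ps \<le> card out" .
  moreover have "card out \<le> card ({..<l} - out)"
  proof (rule card_inj_on_le[of "\<lambda>i. Suc i mod l"])
    show "inj_on (\<lambda>i. Suc i mod l) out"
      by (intro inj_onI) (auto simp: out_def mod_Suc split: if_splits)
    show "(\<lambda>i. Suc i mod l) ` out \<subseteq> {..<l} - out"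
    proof
      fix j assume "j \<in> (\<lambda>i. Suc i mod l) ` out"
      then obtain i where i: "j = Suc i mod l" "u i \<notin> K" by (auto simp: out_def)
      have "u j = u (Suc i)" by (simp add: u_eq i(1))
      then have "u j \<in> K" using outside[OF adj[of i]] i(2) by simp
      moreover have "j < l" using k by (simp add: i(1) l_def)
      ultimately show "j \<in> {..<l} - out" by (simp add: out_def)
    qed
  qed simp
  moreover have "card ({..<l} - out) = l - card out"
    by (subst card_Diff_subset) (auto simp: out_def)
  ultimately have "length ps \<le> k" by (simp add: l_def)
  then obtain x where x: "\<forall>p\<in>set ps. fst p = x"
    using closed_walk_constant[OF girth open_walk_closed[OF ps(1)] dist] by blast
  have blob: "blob (u i) = blob (u 0)" if "u i \<in> K" for i
  proof -
    have "u i = u (i mod l)" by (simp add: u_eq)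
    moreover have "i mod l < Suc l" using k by (simp add: l_def less_Suc_eq)
    ultimately have "u i \<in> set vs" unfolding vs_def by (auto simp del: upt_Suc)
    then have *: "blob (u i) \<in> insert (blob (u 0)) (fst ` set ps)" using ps(3) that by blast
    show ?thesis
    proof (cases "ps = []")
      case False
      then have "x = blob (u 0)" using open_walk_hd[OF ps(1)] x hd_in_set by fastforce
      then show ?thesis using * x by auto
    qed (use * in auto)
  qed
  obtain m where m: "\<And>i. u i \<in> K \<inter> Z \<Longrightarrow> i mod l = m mod l"
  proof (cases "\<exists>m. u m \<in> K \<inter> Z")
    case True
    then obtain m where "u m \<in> K \<inter> Z" by blast
    then show thesis using that[of m] center blob u_eq by (metis IntD1)
  qed (use that in blast)
  have away: "u (m + j) \<notin> K \<inter> Z" if "1 \<le> j" "j \<le> 5" for j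
  proof
    assume "u (m + j) \<in> K \<inter> Z"
    then have "(m + j) mod l = (m + 0) mod l" using m by simp
    then have "j mod l = 0 mod l" by (simp only: mod_add_left_cancel_nat)
    then show False using that k by (simp add: l_def)
  qed
  have "{u (m + 2), u (m + 3)} \<in> E" using adj[of "m + 2"] by (simp add: numeral_eq_Suc)
  then have "u (m + 2) \<notin> K \<or> u (m + 3) \<notin> K"
    using inside[of "u (m + 2)" "u (m + 3)"] away[of 2] away[of 3] by auto
  then obtain j where j: "j \<in> {2, 3}" "u (m + j) \<notin> K" by blast
  have "Suc (m + (j - 1)) = m + j" "Suc (m + j) = m + (j + 1)" using j(1) by auto
  then have nb: "{u (m + j), u (m + (j - 1))} \<in> E" "{u (m + j), u (m + (j + 1))} \<in> E"
    using adj[of "m + (j - 1)"] adj[of "m + j"] by (simp_all add: insert_commute)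
  then have "u (m + (j - 1)) \<in> K" "u (m + (j + 1)) \<in> K" using outside j(2) by blast+
  moreover from this have "u (m + (j - 1)) \<in> K - Z" "u (m + (j + 1)) \<in> K - Z"
    using away[of "j - 1"] away[of "j + 1"] j(1) by auto
  ultimately have "u (m + (j - 1)) = u (m + (j + 1))"
    using leaf[OF nb j(2)] blob by metis
  moreover have "m + (j - 1) = (m + (j - 1)) + 0" "m + (j + 1) = (m + (j - 1)) + 2" using j(1) by auto
  ultimately have "0 mod l = 2 mod l" using u_eq mod_add_left_cancel_nat by metis
  then show False using k by (simp add: l_def)
qed

end

text \<open>An embedding of bipartite graphs maps closed walks to closed walks and creates no turns.\<close>

lemma girth_exceeds_pullback:
  assumes girth: "girth_exceeds k R"
    and R': "\<And>x' y'. R' x' y' \<Longrightarrow> R (f x') (h y')"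
    and f: "\<And>x1 y1 x2 y2. R' x1 y1 \<Longrightarrow> R' x2 y2 \<Longrightarrow> f x1 = f x2 \<Longrightarrow> x1 = x2"
    and h: "\<And>x1 y1 x2 y2. R' x1 y1 \<Longrightarrow> R' x2 y2 \<Longrightarrow> h y1 = h y2 \<Longrightarrow> y1 = y2"
  shows "girth_exceeds k R'"
  unfolding girth_exceeds_def
proof (intro allI impI notI)
  fix ps assume ps: "ps \<noteq> []" "length ps \<le> k" "closed_walk R' ps" "nonbacktracking ps"
  let ?qs = "map (\<lambda>(x, y). (f x, h y)) ps"
  let ?n = "length ps"
  have R'i: "R' (fst (ps ! i)) (snd (ps ! i))" "R' (fst (ps ! (Suc i mod ?n))) (snd (ps ! i))"
    if "i < ?n" for i
    using ps(3) that unfolding closed_walk_iff_nth by auto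
  have lt: "Suc i mod ?n < ?n" if "i < ?n" for i using that by (intro mod_less_divisor) auto
  have "closed_walk R ?qs"
    unfolding closed_walk_iff_nth using R'i R' lt by (auto simp: case_prod_beta)
  moreover have "nonbacktracking ?qs"
    unfolding nonbacktracking_iff_nth
  proof (intro allI impI)
    fix i assume i: "i < length ?qs"
    then have i': "i < ?n" by simp
    have "fst (ps ! i) \<noteq> fst (ps ! (Suc i mod ?n))" "snd (ps ! i) \<noteq> snd (ps ! (Suc i mod ?n))"
      using ps(4) i' unfolding nonbacktracking_iff_nth by auto
    then have "f (fst (ps ! i)) \<noteq> f (fst (ps ! (Suc i mod ?n)))"
      "h (snd (ps ! i)) \<noteq> h (snd (ps ! (Suc i mod ?n)))"
      using f[OF R'i(1)[OF i'] R'i(1)[OF lt[OF i']]] h[OF R'i(1)[OF i'] R'i(1)[OF lt[OF i']]] by blast+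
    then show "fst (?qs ! i) \<noteq> fst (?qs ! (Suc i mod length ?qs)) \<and>
        snd (?qs ! i) \<noteq> snd (?qs ! (Suc i mod length ?qs))"
      using i' lt[OF i'] by (simp add: case_prod_beta)
  qed
  moreover have "?qs \<noteq> []" "length ?qs \<le> k" using ps by auto
  ultimately show False using girth unfolding girth_exceeds_def by blast
qed

text \<open>In the game a blob consists of the four numbers \<open>4 * j, \<dots>, 4 * j + 3\<close>, with centre \<open>4 * j\<close>;
  the remaining vertices are at least \<open>M\<close>.\<close>

lemma blow_up_graph_free:
  fixes R :: "'x \<Rightarrow> 'y \<Rightarrow> bool" and \<sigma> :: "'x \<Rightarrow> nat" and \<eta> :: "'y \<Rightarrow> nat"
  assumes k: "3 \<le> k" and girth: "girth_exceeds k R"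
    and \<sigma>: "inj_on \<sigma> A" and \<eta>: "inj_on \<eta> Bs" "\<And>y. y \<in> Bs \<Longrightarrow> M \<le> \<eta> y"
    and E: "\<And>e. e \<in> E \<Longrightarrow> (\<exists>j r. 0 < r \<and> r < 4 \<and> 4 * j + r < M \<and> e = {4 * j, 4 * j + r}) \<or>
         (\<exists>x\<in>A. \<exists>y\<in>Bs. \<exists>v<M. R x y \<and> e = {\<eta> y, v} \<and> v div 4 = \<sigma> x)"
    and leaf: "\<And>y u v. y \<in> Bs \<Longrightarrow> {\<eta> y, u} \<in> E \<Longrightarrow> {\<eta> y, v} \<in> E \<Longrightarrow> u < M \<Longrightarrow> v < M \<Longrightarrow> \<not> 4 dvd u \<Longrightarrow> \<not> 4 dvd v
         \<Longrightarrow> u div 4 = v div 4 \<Longrightarrow> u = v"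
  shows "\<not> has_cycle (2 * k) E"
proof -
  define R' where "R' j z \<longleftrightarrow> (\<exists>x\<in>A. \<exists>y\<in>Bs. R x y \<and> j = \<sigma> x \<and> z = \<eta> y)" for j z
  have "girth_exceeds k R'"
  proof (rule girth_exceeds_pullback[OF girth, of R' "inv_into A \<sigma>" "inv_into Bs \<eta>"])
    show "R (inv_into A \<sigma> j) (inv_into Bs \<eta> z)" if "R' j z" for j z
      using that \<sigma> \<eta>(1) by (auto simp: R'_def)
    show "j1 = j2" if "R' j1 z1" "R' j2 z2" "inv_into A \<sigma> j1 = inv_into A \<sigma> j2" for j1 z1 j2 z2
      using that \<sigma> by (auto simp: R'_def)
    show "z1 = z2" if "R' j1 z1" "R' j2 z2" "inv_into Bs \<eta> z1 = inv_into Bs \<eta> z2" for j1 z1 j2 z2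
      using that \<eta>(1) by (auto simp: R'_def)
  qed
  have inner: "u div 4 = v div 4 \<and> (4 dvd u \<or> 4 dvd v)" if "{u, v} \<in> E" "u < M" "v < M" for u v
    using E[OF that(1)]
  proof (elim disjE exE conjE bexE)
    fix j r assume "0 < r" "r < (4::nat)" "{u, v} = {4 * j, 4 * j + r}"
    then have "(u = 4 * j \<and> v = 4 * j + r) \<or> (u = 4 * j + r \<and> v = 4 * j)" by (auto simp: doubleton_eq_iff)
    then show ?thesis using \<open>r < 4\<close> by auto
  next
    fix x y w assume "y \<in> Bs" "{u, v} = {\<eta> y, w}"
    then have "u = \<eta> y \<or> v = \<eta> y" by (auto simp: doubleton_eq_iff)
    then show ?thesis using \<eta>(2)[OF \<open>y \<in> Bs\<close>] that by auto
  qed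
  have cross: "R' (v div 4) z \<and> (\<exists>y\<in>Bs. z = \<eta> y)" if "{z, v} \<in> E" "\<not> z < M" "v < M" for z v
    using E[OF that(1)]
  proof (elim disjE exE conjE bexE)
    fix j r assume "0 < r" "4 * j + r < M" "{z, v} = {4 * j, 4 * j + r}"
    then show ?thesis using that(2) by (auto simp: doubleton_eq_iff)
  next
    fix x y w assume *: "x \<in> A" "y \<in> Bs" "w < M" "R x y" "{z, v} = {\<eta> y, w}" "w div 4 = \<sigma> x"
    then have "z = \<eta> y" "v = w" using that by (auto simp: doubleton_eq_iff)
    then show ?thesis using * by (auto simp: R'_def)
  qed
  interpret blow_up E "{..<M}" "{v. 4 dvd v}" "\<lambda>v. v div 4" R'
  proof
    show "u div 4 = v div 4 \<and> (u \<in> {v. 4 dvd v} \<or> v \<in> {v. 4 dvd v})"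
      if "{u, v} \<in> E" "u \<in> {..<M}" "v \<in> {..<M}" for u v
      using inner that by auto
    show "u \<in> {..<M} \<or> v \<in> {..<M}" if "{u, v} \<in> E" for u v
      using E[OF that] by (auto simp: doubleton_eq_iff)
    show "R' (v div 4) y" if "{y, v} \<in> E" "y \<notin> {..<M}" "v \<in> {..<M}" for y v
      using cross[of y v] that by auto
    show "u = v" if "u \<in> {..<M} \<inter> {v. 4 dvd v}" "v \<in> {..<M} \<inter> {v. 4 dvd v}" "u div 4 = v div 4" for u v
      using that by auto
    show "u = v" if yuv: "{y, u} \<in> E" "{y, v} \<in> E" "y \<notin> {..<M}" "u \<in> {..<M} - {v. 4 dvd v}"
      "v \<in> {..<M} - {v. 4 dvd v}" "u div 4 = v div 4" for y u v
    proof -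
      obtain y' where "y' \<in> Bs" "y = \<eta> y'" using cross[of y u] yuv by auto
      then show ?thesis using leaf[of y' u v] yuv by auto
    qed
  qed
  show ?thesis using \<open>girth_exceeds k R'\<close> k by (rule no_long_even_cycle)
qed

text \<open>Constructor first prepares \<open>N\<close> blobs, each a path of three vertices. She tries \<open>3 * N\<close> places with
  four vertices each, as only a third of the items can be completed, and Blocker gets at most \<open>6 * N\<close> edges
  meanwhile. Then each edge of the bipartite graph offers her a triangle: she joins the right vertex to the
  centre of the blob, after which Blocker can cut off only one of its two leaves. Blocker's earlier edges
  spoil at most \<open>6 * N\<close> of the \<open>q * N\<close> items, no more than half of them since \<open>12 \<le> q\<close>, and she
  completes a third of the rest.\<close>

theorem blow_up_strategy:
  fixes R :: "'x \<Rightarrow> 'y \<Rightarrow> bool"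
  assumes k: "3 \<le> k" and girth: "girth_exceeds k R"
    and fin: "finite A" "finite Bs" and card: "card A = N" "card Bs = N"
    and many: "q * N \<le> card {(x, y). x \<in> A \<and> y \<in> Bs \<and> R x y}" and q: "12 \<le> q" and n: "13 * N \<le> n"
  shows "q * N \<le> 6 * g n (complete_graph 3) (cycle_graph (2 * k))"
proof -
  let ?F = "cycle_graph (2 * k)"
  let ?val = "game_value n (complete_graph 3) ?F Constructor"
  define M where "M = 12 * N"
  define R0 where "R0 = {(x, y). x \<in> A \<and> y \<in> Bs \<and> R x y}"
  have finR0: "finite R0"
    by (rule finite_subset[of _ "A \<times> Bs"]) (use fin in \<open>auto simp: R0_def\<close>)
  obtain \<eta> :: "'y \<Rightarrow> nat" where \<eta>: "bij_betw \<eta> Bs {M..<M + N}"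
    using finite_same_card_bij[of Bs "{M..<M + N}"] fin card by auto
  have \<eta>_inj: "inj_on \<eta> Bs" and \<eta>_range: "\<And>y. y \<in> Bs \<Longrightarrow> M \<le> \<eta> y \<and> \<eta> y < n"
  proof -
    show "inj_on \<eta> Bs" using \<eta> by (rule bij_betw_imp_inj_on)
    show "M \<le> \<eta> y \<and> \<eta> y < n" if "y \<in> Bs" for y
      using bij_betwE[OF \<eta>] that n by (auto simp: M_def)
  qed
  have free: "free_of ?F ({..<n}, C)" if "C \<subseteq> edges_of n" "\<not> has_cycle (2 * k) C" for C
    using that k edges_ofD by (subst free_of_cycle_iff) auto
  have edge: "{u, v} \<in> edges_of n" if "u < n" "v < n" "u \<noteq> v" for u v
    using that by (auto simp: complete_graph_def)
  define ce where "ce j r = {4 * j, 4 * j + r}" for j r :: nat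
  have ce_edge: "ce j r \<in> edges_of n" if "j < 3 * N" "r \<in> {1, 2, 3}" for j r
    unfolding ce_def using that n by (intro edge) auto
  have played: "\<exists>j r. j < 3 * N \<and> r \<in> {1, 2, 3} \<and> e = ce j r"
    if S: "S \<subseteq> {..<3 * N}" "\<forall>j\<in>S. w j \<in> {ce j 2, ce j 3}"
      and e: "e \<in> {} \<union> (\<lambda>j. ce j 1) ` S \<union> w ` S" for S w e
  proof -
    from e consider j where "j \<in> S" "e = ce j 1" | j where "j \<in> S" "e = w j" by blast
    then show ?thesis
    proof cases
      case (1 j)
      then show ?thesis using S(1) by (intro exI[of _ j] exI[of _ 1]) auto
    next
      case (2 j)
      then have "j < 3 * N" "e = ce j 2 \<or> e = ce j 3" using S by auto
      then show ?thesis by blast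
    qed
  qed
  \<comment> \<open>One sixth of the edges, rounded up.\<close>
  define m where "m = (q * N + 5) div 6"
  have "m \<le> ?val {} {}"
  proof (rule item_phase[where I = "{..<3 * N}" and x = "\<lambda>j. ce j 1" and y = "\<lambda>j. ce j 2" and z = "\<lambda>j. ce j 3"])
    show "{ce j 1, ce j 2, ce j 3} \<subseteq> edges_of n" if "j \<in> {..<3 * N}" for j
      using ce_edge that by auto
    show "ce j 1 \<noteq> ce j 2 \<and> ce j 1 \<noteq> ce j 3 \<and> ce j 2 \<noteq> ce j 3" for j
      by (auto simp: ce_def doubleton_eq_iff)
    show "{ce i 1, ce i 2, ce i 3} \<inter> {ce j 1, ce j 2, ce j 3} = {}" if "i \<noteq> j" for i j
    proof -
      have "ce i r \<noteq> ce j s" if "r < 4" "s < 4" for r s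
      proof
        assume "ce i r = ce j s"
        then have "4 * i = 4 * j \<or> 4 * i = 4 * j + s \<and> 4 * i + r = 4 * j" by (auto simp: ce_def doubleton_eq_iff)
        then show False using \<open>i \<noteq> j\<close> that by presburger
      qed
      then show ?thesis by auto
    qed
    show "\<forall>S\<subseteq>{..<3 * N}. \<forall>w. (\<forall>j\<in>S. w j \<in> {ce j 2, ce j 3}) \<longrightarrow>
        free_of ?F ({..<n}, {} \<union> (\<lambda>j. ce j 1) ` S \<union> w ` S)"
    proof (intro allI impI)
      fix S w assume S: "S \<subseteq> {..<3 * N}" "\<forall>j\<in>S. w j \<in> {ce j 2, ce j 3}"
      let ?C = "{} \<union> (\<lambda>j. ce j 1) ` S \<union> w ` S"
      have C: "\<exists>j r. j < 3 * N \<and> r \<in> {1, 2, 3} \<and> e = ce j r" if "e \<in> ?C" for e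
        using played[OF S] that by simp
      show "free_of ?F ({..<n}, ?C)"
      proof (rule free)
        show "?C \<subseteq> edges_of n"
        proof
          fix e assume "e \<in> ?C"
          from C[OF this] obtain j r where jr: "j < 3 * N" "r \<in> {1, 2, 3}" "e = ce j r" by blast
          show "e \<in> edges_of n" unfolding jr(3) by (rule ce_edge[OF jr(1,2)])
        qed
        show "\<not> has_cycle (2 * k) ?C"
        proof (rule blow_up_graph_free[OF k girth, where A = "{}" and Bs = "{}" and M = M])
          show "(\<exists>j r. 0 < r \<and> r < 4 \<and> 4 * j + r < M \<and> e = {4 * j, 4 * j + r}) \<or>
             (\<exists>x\<in>{}. \<exists>y\<in>{}. \<exists>v<M. R x y \<and> e = {\<eta> y, v} \<and> v div 4 = \<sigma> x)" if e: "e \<in> ?C" for e \<sigma>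
          proof -
            obtain j r where "j < 3 * N" "r \<in> {1, 2, 3}" "e = ce j r" using C[OF e] by blast
            then show ?thesis
              by (intro disjI1 exI[of _ j] exI[of _ r]) (auto simp: ce_def M_def)
          qed
        qed auto
      qed
    qed
    show "\<forall>S\<subseteq>{..<3 * N}. \<forall>w B'. (\<forall>j\<in>S. w j \<in> {ce j 2, ce j 3}) \<longrightarrow> card {..<3 * N} \<le> 3 * card S
         \<longrightarrow> finite B' \<longrightarrow> card B' \<le> card {} + 2 * card S
         \<longrightarrow> m \<le> ?val ({} \<union> (\<lambda>j. ce j 1) ` S \<union> w ` S) B'"
    proof (intro allI impI)
      fix S w and B' :: "nat set set"
      assume S: "S \<subseteq> {..<3 * N}" "\<forall>j\<in>S. w j \<in> {ce j 2, ce j 3}" "card {..<3 * N} \<le> 3 * card S"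
        and B': "finite B'" "card B' \<le> card {} + 2 * card S"
      let ?C = "{} \<union> (\<lambda>j. ce j 1) ` S \<union> w ` S"
      have C: "\<exists>j r. j < 3 * N \<and> r \<in> {1, 2, 3} \<and> e = ce j r" if "e \<in> ?C" for e
        using played[OF S(1,2)] that by simp
      have finS: "finite S" using S(1) finite_subset by blast
      have "card A \<le> card S" using S(3) card(1) by simp
      then obtain \<sigma> where \<sigma>: "inj_on \<sigma> A" "\<sigma> ` A \<subseteq> S"
        using card_le_inj[OF fin(1) finS] by blast
      have "card S \<le> 3 * N" using card_mono[OF _ S(1)] by simp
      then have cB': "card B' \<le> 6 * N" using B'(2) by simp
      define l1 where "l1 x = 4 * \<sigma> x + 1" for x
      define l2 where "l2 x = (if w (\<sigma> x) = ce (\<sigma> x) 2 then 4 * \<sigma> x + 2 else 4 * \<sigma> x + 3)" for x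
      have blobs: "{4 * \<sigma> x, l1 x} \<in> ?C" "{4 * \<sigma> x, l2 x} \<in> ?C" "\<sigma> x < 3 * N" if "x \<in> A" for x
      proof -
        have s: "\<sigma> x \<in> S" using \<sigma>(2) that by blast
        then show "\<sigma> x < 3 * N" using S(1) by blast
        have "{4 * \<sigma> x, l1 x} = ce (\<sigma> x) 1" by (simp add: ce_def l1_def)
        then show "{4 * \<sigma> x, l1 x} \<in> ?C" using s by blast
        have "w (\<sigma> x) \<in> {ce (\<sigma> x) 2, ce (\<sigma> x) 3}" using S(2) s by blast
        then have "{4 * \<sigma> x, l2 x} = w (\<sigma> x)" by (auto simp: ce_def l2_def)
        then show "{4 * \<sigma> x, l2 x} \<in> ?C" using s by blast
      qed
      have l_div: "4 * \<sigma> x div 4 = \<sigma> x" "l1 x div 4 = \<sigma> x" "l2 x div 4 = \<sigma> x" "\<not> 4 dvd l1 x" "\<not> 4 dvd l2 x" for x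
        by (auto simp: l1_def l2_def) presburger+
      have l_lt: "4 * \<sigma> x < M" "l1 x < M" "l2 x < M" if "x \<in> A" for x
        using blobs(3)[OF that] by (auto simp: M_def l1_def l2_def)
      define T where "T i = {{\<eta> (snd i), 4 * \<sigma> (fst i)}, {\<eta> (snd i), l1 (fst i)}, {\<eta> (snd i), l2 (fst i)}}" for i
      have T_mem: "\<exists>v<M. e = {\<eta> (snd i), v} \<and> v div 4 = \<sigma> (fst i)" if "e \<in> T i" "i \<in> R0" for e i
        using that l_div l_lt unfolding T_def R0_def by (auto; blast)
      have T_disj: "T i \<inter> T i' = {}" if ii: "i \<in> R0" "i' \<in> R0" "i \<noteq> i'" for i i'
      proof (rule ccontr)
        assume "T i \<inter> T i' \<noteq> {}"
        then obtain e where "e \<in> T i" "e \<in> T i'" by blast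
        then obtain v v' where v: "v < M" "v' < M" "{\<eta> (snd i), v} = {\<eta> (snd i'), v'}"
          "v div 4 = \<sigma> (fst i)" "v' div 4 = \<sigma> (fst i')"
          using T_mem[of e i] T_mem[of e i'] ii by auto
        have i: "fst i \<in> A" "snd i \<in> Bs" "fst i' \<in> A" "snd i' \<in> Bs" using that by (auto simp: R0_def)
        then have "\<eta> (snd i) = \<eta> (snd i')" "v = v'"
          using v \<eta>_range[OF i(2)] \<eta>_range[OF i(4)] by (auto simp: doubleton_eq_iff)
        then have "snd i = snd i'" "fst i = fst i'"
          using v(4,5) i \<eta>_inj \<sigma>(1) by (auto dest: inj_onD)
        then show False using that(3) by (simp add: prod_eq_iff)
      qed
      define I2 where "I2 = {i \<in> R0. T i \<inter> B' = {}}"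
      have finI2: "finite I2" using finR0 by (simp add: I2_def)
      have "card {i \<in> R0. T i \<inter> B' \<noteq> {}} \<le> card B'"
        using T_disj by (intro card_hit_le B'(1)) blast
      moreover have "card R0 \<le> card (I2 \<union> {i \<in> R0. T i \<inter> B' \<noteq> {}})"
        using finR0 by (intro card_mono) (auto simp: I2_def)
      moreover have "card (I2 \<union> {i \<in> R0. T i \<inter> B' \<noteq> {}}) \<le> card I2 + card {i \<in> R0. T i \<inter> B' \<noteq> {}}"
        by (rule card_Un_le)
      ultimately have "q * N \<le> card I2 + 6 * N" using many cB' by (simp add: R0_def)
      moreover have "12 * N \<le> q * N" using q by simp
      ultimately have cI2: "q * N \<le> 2 * card I2" by linarith
      have finish: "\<exists>lf. (\<forall>i\<in>S2. lf i \<in> {l1 (fst i), l2 (fst i)}) \<and>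
            w2 ` S2 = (\<lambda>i. {\<eta> (snd i), lf i}) ` S2"
        if "\<forall>i\<in>S2. w2 i \<in> {{\<eta> (snd i), l1 (fst i)}, {\<eta> (snd i), l2 (fst i)}}" for S2 w2
      proof (intro exI conjI ballI)
        let ?lf = "\<lambda>i. if w2 i = {\<eta> (snd i), l1 (fst i)} then l1 (fst i) else l2 (fst i)"
        show "?lf i \<in> {l1 (fst i), l2 (fst i)}" for i by simp
        show "w2 ` S2 = (\<lambda>i. {\<eta> (snd i), ?lf i}) ` S2" using that by (intro image_cong) auto
      qed
      show "m \<le> ?val ?C B'"
      proof (rule item_phase[where I = I2 and x = "\<lambda>i. {\<eta> (snd i), 4 * \<sigma> (fst i)}"
            and y = "\<lambda>i. {\<eta> (snd i), l1 (fst i)}" and z = "\<lambda>i. {\<eta> (snd i), l2 (fst i)}"], unfold T_def[symmetric])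
        have sub: "T i \<subseteq> edges_of n" if "i \<in> R0" for i
        proof
          fix e assume "e \<in> T i"
          then obtain v where v: "v < M" "e = {\<eta> (snd i), v}" using T_mem \<open>i \<in> R0\<close> by blast
          moreover have "M \<le> \<eta> (snd i)" "\<eta> (snd i) < n" using \<eta>_range \<open>i \<in> R0\<close> by (auto simp: R0_def)
          ultimately show "e \<in> edges_of n" by (auto intro: edge)
        qed
        show "T i \<subseteq> edges_of n" if "i \<in> I2" for i using sub that by (simp add: I2_def)
        show "T i \<inter> (?C \<union> B') = {}" if "i \<in> I2" for i
        proof -
          have "T i \<inter> ?C = {}"
          proof (rule ccontr)
            assume "T i \<inter> ?C \<noteq> {}"
            then obtain e where e: "e \<in> T i" "e \<in> ?C" by blast
            then have "\<eta> (snd i) \<in> e" by (auto simp: T_def)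
            moreover obtain j r where "j < 3 * N" "r \<in> {1, 2, 3}" "e = ce j r" using C[OF e(2)] by blast
            ultimately have "\<eta> (snd i) < M" by (auto simp: ce_def M_def)
            then show False using \<eta>_range[of "snd i"] that by (auto simp: I2_def R0_def)
          qed
          then show ?thesis using that by (auto simp: I2_def)
        qed
        show "{\<eta> (snd i), 4 * \<sigma> (fst i)} \<noteq> {\<eta> (snd i), l1 (fst i)} \<and>
            {\<eta> (snd i), 4 * \<sigma> (fst i)} \<noteq> {\<eta> (snd i), l2 (fst i)} \<and>
            {\<eta> (snd i), l1 (fst i)} \<noteq> {\<eta> (snd i), l2 (fst i)}" for i
          by (auto simp: doubleton_eq_iff l1_def l2_def)
        show "T i \<inter> T j = {}" if "i \<in> I2" "j \<in> I2" "i \<noteq> j" for i j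
          using T_disj that by (simp add: I2_def)
        define G where "G S2 lf = ?C \<union> (\<lambda>i. {\<eta> (snd i), 4 * \<sigma> (fst i)}) ` S2 \<union> (\<lambda>i. {\<eta> (snd i), lf i}) ` S2"
          for S2 and lf :: "'x \<times> 'y \<Rightarrow> nat"
        have G_edges: "G S2 lf \<subseteq> edges_of n" if "S2 \<subseteq> I2" "\<forall>i\<in>S2. lf i \<in> {l1 (fst i), l2 (fst i)}" for S2 lf
        proof -
          have "?C \<subseteq> edges_of n"
          proof
            fix e assume "e \<in> ?C"
            from C[OF this] obtain j r where jr: "j < 3 * N" "r \<in> {1, 2, 3}" "e = ce j r" by blast
            show "e \<in> edges_of n" unfolding jr(3) by (rule ce_edge[OF jr(1,2)])
          qed
          moreover have "{{\<eta> (snd i), 4 * \<sigma> (fst i)}, {\<eta> (snd i), lf i}} \<subseteq> edges_of n" if i: "i \<in> S2" for i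
          proof -
            have "i \<in> R0" using i \<open>S2 \<subseteq> I2\<close> by (auto simp: I2_def)
            moreover have "lf i \<in> {l1 (fst i), l2 (fst i)}" using i \<open>\<forall>i\<in>S2. _\<close> by blast
            ultimately show ?thesis using sub[of i] by (auto simp: T_def)
          qed
          ultimately show ?thesis unfolding G_def by blast
        qed
        show "\<forall>S2\<subseteq>I2. \<forall>w2. (\<forall>i\<in>S2. w2 i \<in> {{\<eta> (snd i), l1 (fst i)}, {\<eta> (snd i), l2 (fst i)}}) \<longrightarrow>
            free_of ?F ({..<n}, ?C \<union> (\<lambda>i. {\<eta> (snd i), 4 * \<sigma> (fst i)}) ` S2 \<union> w2 ` S2)"
        proof (intro allI impI)
          fix S2 w2 assume S2: "S2 \<subseteq> I2"
            "\<forall>i\<in>S2. w2 i \<in> {{\<eta> (snd i), l1 (fst i)}, {\<eta> (snd i), l2 (fst i)}}"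
          obtain lf where lf: "\<forall>i\<in>S2. lf i \<in> {l1 (fst i), l2 (fst i)}"
            "w2 ` S2 = (\<lambda>i. {\<eta> (snd i), lf i}) ` S2" using finish[OF S2(2)] by blast
          have S2R: "fst i \<in> A" "snd i \<in> Bs" "R (fst i) (snd i)" if "i \<in> S2" for i
            using that S2(1) by (auto simp: I2_def R0_def)
          have lf': "lf i < M" "lf i div 4 = \<sigma> (fst i)" "\<not> 4 dvd lf i" if "i \<in> S2" for i
            using lf(1) that l_lt[OF S2R(1)[OF that]] l_div[of "fst i"] by auto
          show "free_of ?F ({..<n}, ?C \<union> (\<lambda>i. {\<eta> (snd i), 4 * \<sigma> (fst i)}) ` S2 \<union> w2 ` S2)"
            unfolding lf(2) G_def[symmetric]
          proof (rule free[OF G_edges[OF S2(1) lf(1)]],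
              rule blow_up_graph_free[OF k girth \<sigma>(1) \<eta>_inj, where M = M])
            show "M \<le> \<eta> y" if "y \<in> Bs" for y using \<eta>_range[OF that] by simp
            show "(\<exists>j r. 0 < r \<and> r < 4 \<and> 4 * j + r < M \<and> e = {4 * j, 4 * j + r}) \<or>
                (\<exists>x\<in>A. \<exists>y\<in>Bs. \<exists>v<M. R x y \<and> e = {\<eta> y, v} \<and> v div 4 = \<sigma> x)" if e: "e \<in> G S2 lf" for e
            proof -
              consider "e \<in> ?C" | i v where "i \<in> S2" "v \<in> {4 * \<sigma> (fst i), lf i}" "e = {\<eta> (snd i), v}"
                using e unfolding G_def by blast
              then show ?thesis
              proof cases
                case 1
                from C[OF 1] obtain j r where "j < 3 * N" "r \<in> {1, 2, 3}" "e = ce j r" by blast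
                then show ?thesis
                  by (intro disjI1 exI[of _ j] exI[of _ r]) (auto simp: ce_def M_def)
              next
                case (2 i v)
                then have "v < M" "v div 4 = \<sigma> (fst i)"
                  using lf'[OF 2(1)] l_lt[OF S2R(1)[OF 2(1)]] 2(2) by auto
                then show ?thesis using 2 S2R[OF 2(1)] by blast
              qed
            qed
            have only: "\<exists>i\<in>S2. y = snd i \<and> v = lf i" if yv: "y \<in> Bs" "{\<eta> y, v} \<in> G S2 lf" "v < M" "\<not> 4 dvd v" for y v
            proof -
              have y: "M \<le> \<eta> y" using \<eta>_range[OF yv(1)] by simp
              have "{\<eta> y, v} \<notin> ?C"
              proof
                assume "{\<eta> y, v} \<in> ?C"
                from C[OF this] obtain j r where "j < 3 * N" "r \<in> {1, 2, 3}" "{\<eta> y, v} = ce j r" by blast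
                then have "\<eta> y < M" by (auto simp: ce_def M_def doubleton_eq_iff)
                then show False using y by simp
              qed
              then obtain i u where i: "i \<in> S2" "u \<in> {4 * \<sigma> (fst i), lf i}" "{\<eta> y, v} = {\<eta> (snd i), u}"
                using yv(2) unfolding G_def by blast
              have "u < M" using lf'(1)[OF i(1)] l_lt[OF S2R(1)[OF i(1)]] i(2) by auto
              then have "\<eta> y = \<eta> (snd i)" "v = u"
                using i(3) y by (auto simp: doubleton_eq_iff)
              then have "y = snd i" "v = u" using \<eta>_inj yv(1) S2R(2)[OF i(1)] by (auto dest: inj_onD)
              moreover have "u = lf i" using i(2) yv(4) \<open>v = u\<close> by auto
              ultimately show ?thesis using i(1) by blast
            qed
            show "u = v" if yuv: "y \<in> Bs" "{\<eta> y, u} \<in> G S2 lf" "{\<eta> y, v} \<in> G S2 lf" "u < M" "v < M"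
              "\<not> 4 dvd u" "\<not> 4 dvd v" "u div 4 = v div 4" for y u v
            proof -
              obtain i where i: "i \<in> S2" "y = snd i" "u = lf i" using only[OF yuv(1,2,4,6)] by blast
              obtain j where j: "j \<in> S2" "y = snd j" "v = lf j" using only[OF yuv(1,3,5,7)] by blast
              have "\<sigma> (fst i) = \<sigma> (fst j)" using lf'(2)[OF i(1)] lf'(2)[OF j(1)] i j yuv(8) by simp
              then have "fst i = fst j" using inj_onD[OF \<sigma>(1) _ S2R(1)[OF i(1)] S2R(1)[OF j(1)]] by blast
              then have "i = j" using i(2) j(2) by (simp add: prod_eq_iff)
              then show ?thesis using i j by simp
            qed
          qed
        qed
        show "\<forall>S2\<subseteq>I2. \<forall>w2 B2. (\<forall>i\<in>S2. w2 i \<in> {{\<eta> (snd i), l1 (fst i)}, {\<eta> (snd i), l2 (fst i)}}) \<longrightarrow>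
            card I2 \<le> 3 * card S2 \<longrightarrow> finite B2 \<longrightarrow> card B2 \<le> card B' + 2 * card S2 \<longrightarrow>
            m \<le> ?val
              (?C \<union> (\<lambda>i. {\<eta> (snd i), 4 * \<sigma> (fst i)}) ` S2 \<union> w2 ` S2) B2"
        proof (intro allI impI)
          fix S2 w2 and B2 :: "nat set set"
          assume S2: "S2 \<subseteq> I2" "\<forall>i\<in>S2. w2 i \<in> {{\<eta> (snd i), l1 (fst i)}, {\<eta> (snd i), l2 (fst i)}}"
            "card I2 \<le> 3 * card S2"
          obtain lf where lf: "\<forall>i\<in>S2. lf i \<in> {l1 (fst i), l2 (fst i)}"
            "w2 ` S2 = (\<lambda>i. {\<eta> (snd i), lf i}) ` S2" using finish[OF S2(2)] by blast
          have S2R: "fst i \<in> A" "snd i \<in> Bs" if "i \<in> S2" for i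
            using that S2(1) by (auto simp: I2_def R0_def)
          have lf': "lf i < M" "lf i div 4 = \<sigma> (fst i)" "\<not> 4 dvd lf i" if "i \<in> S2" for i
            using lf(1) that l_lt[OF S2R(1)[OF that]] l_div[of "fst i"] by auto
          define tri where "tri i = {\<eta> (snd i), 4 * \<sigma> (fst i), lf i}" for i
          have "tri i \<in> triangles (G S2 lf)" if "i \<in> S2" for i
          proof -
            have "M \<le> \<eta> (snd i)" using \<eta>_range S2R(2)[OF that] by simp
            moreover have "lf i \<noteq> 4 * \<sigma> (fst i)" using lf'(3)[OF that] by auto
            ultimately have "card (tri i) = 3"
              using lf'(1)[OF that] l_lt(1)[OF S2R(1)[OF that]] by (auto simp: tri_def card_insert_if)
            moreover have "{\<eta> (snd i), 4 * \<sigma> (fst i)} \<in> G S2 lf" "{\<eta> (snd i), lf i} \<in> G S2 lf"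
              using that unfolding G_def by blast+
            moreover have "{4 * \<sigma> (fst i), lf i} \<in> ?C" using blobs(1,2)[OF S2R(1)[OF that]] lf(1) that by auto
            then have "{4 * \<sigma> (fst i), lf i} \<in> G S2 lf" unfolding G_def by blast
            ultimately show ?thesis by (auto simp: triangles_def tri_def insert_commute)
          qed
          then have img: "tri ` S2 \<subseteq> triangles (G S2 lf)" by blast
          have "inj_on tri S2"
          proof (rule inj_onI)
            fix i j assume ij: "i \<in> S2" "j \<in> S2" "tri i = tri j"
            note lt = lf'[OF ij(1)] lf'[OF ij(2)] l_lt(1)[OF S2R(1)[OF ij(1)]] l_lt(1)[OF S2R(1)[OF ij(2)]]
              \<eta>_range[OF S2R(2)[OF ij(1)]] \<eta>_range[OF S2R(2)[OF ij(2)]]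
            have "\<eta> (snd i) \<in> tri j" using ij(3) by (auto simp: tri_def)
            then have "\<eta> (snd i) = \<eta> (snd j)" using lt by (auto simp: tri_def)
            moreover have "4 * \<sigma> (fst i) \<in> tri j" using ij(3) by (auto simp: tri_def)
            then have "\<sigma> (fst i) = \<sigma> (fst j)" using lt by (auto simp: tri_def)
            ultimately have "snd i = snd j" "fst i = fst j"
              using inj_onD[OF \<eta>_inj _ S2R(2)[OF ij(1)] S2R(2)[OF ij(2)]]
                inj_onD[OF \<sigma>(1) _ S2R(1)[OF ij(1)] S2R(1)[OF ij(2)]] by blast+
            then show "i = j" by (simp add: prod_eq_iff)
          qed
          then have "card S2 = card (tri ` S2)" by (simp add: card_image)
          also have "\<dots> \<le> card (triangles (G S2 lf))"
            using G_edges[OF S2(1) lf(1)] edges_ofD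
            by (intro card_mono img finite_triangles[of _ "{..<n}"]) blast+
          finally have "m \<le> card (triangles (G S2 lf))" using S2(3) cI2 by (simp add: m_def)
          also have "\<dots> \<le> ?val (G S2 lf) B2"
            by (rule game_value_ge_current[OF G_edges[OF S2(1) lf(1)]])
          finally show "m \<le> ?val
              (?C \<union> (\<lambda>i. {\<eta> (snd i), 4 * \<sigma> (fst i)}) ` S2 \<union> w2 ` S2) B2"
            by (simp only: lf(2) G_def)
        qed
      qed (use finI2 B'(1) in auto)
    qed
  qed auto
  then show ?thesis unfolding g_def m_def by linarith
qed

section \<open>The game for the four-cycle\<close>

text \<open>Each edge of a graph without four-cycles lies in at most one triangle, so Constructor cannot aim at
  triangles of one graph fixed in advance: Blocker would spoil each of them by claiming one of its edges.
  Instead there is a whole family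
  of graphs, indexed by \<open>t\<close>, which agree in the incidences between lines with slope in \<open>H\<close> and points
  of the affine plane over \<open>K\<close>. In the graph of index \<open>t\<close>, two points whose first coordinates \<open>v\<close> and \<open>w\<close>
  lie one in the coset \<open>\<theta> + H\<close> and one outside are joined if the line through them has slope
  \<open>v - w + t\<close>, which must be in \<open>H\<close>. Any such pair of points on a line with slope in \<open>H\<close> is joined for
  exactly one \<open>t\<close>, so that Constructor can choose \<open>t\<close> after the incidences have been claimed.\<close>

locale plane =
  fixes K H :: "'a :: field set" and \<theta> :: 'a
  assumes fin: "finite K" and HK: "H \<subseteq> K"
    and K_closed: "x \<in> K \<Longrightarrow> y \<in> K \<Longrightarrow> x + y \<in> K" "x \<in> K \<Longrightarrow> y \<in> K \<Longrightarrow> x - y \<in> K"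
      "x \<in> K \<Longrightarrow> y \<in> K \<Longrightarrow> x * y \<in> K"
    and H_diff: "x \<in> H \<Longrightarrow> y \<in> H \<Longrightarrow> x - y \<in> H" and H_0: "0 \<in> H"
    and \<theta>: "\<theta> \<in> K" "\<theta> \<notin> H" "\<theta> + \<theta> \<notin> H"
    and two: "(2 :: 'a) \<noteq> 0"
    and H_large: "card K \<le> 3 * card H"
begin

definition chord :: "'a \<Rightarrow> 'a \<times> 'a \<Rightarrow> 'a \<times> 'a \<Rightarrow> bool" where
  "chord t v w \<longleftrightarrow> fst v - \<theta> \<in> H \<and> fst w - \<theta> \<notin> H \<and> fst v - fst w + t \<in> H \<and>
     snd v - snd w = (fst v - fst w + t) * (fst v - fst w)"

fun adj :: "'a \<Rightarrow> ('a \<times> 'a) + ('a \<times> 'a) \<Rightarrow> ('a \<times> 'a) + ('a \<times> 'a) \<Rightarrow> bool" where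
  "adj t (Inl u) (Inl u') \<longleftrightarrow> False"
| "adj t (Inl u) (Inr p) \<longleftrightarrow> fst u \<in> H \<and> snd p = snd u + fst u * fst p"
| "adj t (Inr p) (Inl u) \<longleftrightarrow> fst u \<in> H \<and> snd p = snd u + fst u * fst p"
| "adj t (Inr v) (Inr w) \<longleftrightarrow> chord t v w \<or> chord t w v"

lemma adj_sym: "adj t a b \<Longrightarrow> adj t b a"
  by (cases a; cases b) auto

lemma chord_coset: "chord t v w \<Longrightarrow> fst v - fst w \<notin> H"
  using H_diff[of "fst v - \<theta>" "fst v - fst w"] by (auto simp: chord_def)

lemma two_lines:
  assumes "adj t (Inl u) (Inr p)" "adj t (Inl u') (Inr p)" "adj t (Inl u) (Inr p')" "adj t (Inl u') (Inr p')"
    and "u \<noteq> u'"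
  shows "p = p'"
proof -
  have "(fst u - fst u') * (fst p - fst p') = (snd p - (snd u' + fst u' * fst p)) - (snd p' - (snd u' + fst u' * fst p'))"
    using assms(1,3) by (simp add: algebra_simps)
  also have "\<dots> = 0" using assms(2,4) by simp
  finally consider "fst u = fst u'" | "fst p = fst p'" by auto
  then show ?thesis
  proof cases
    case 1
    then have "snd u = snd u'" using assms(1,2) by auto
    then show ?thesis using 1 assms(5) by (simp add: prod_eq_iff)
  next
    case 2
    then show ?thesis using assms(1,3) by (simp add: prod_eq_iff)
  qed
qed

text \<open>A point \<open>z\<close> has at most one chord to the points of a line. For two of them, subtracting their equations
  and dividing by the difference of the first coordinates of \<open>p\<close> and \<open>p'\<close> leaves a linear equation: it
  expresses the difference of the first coordinates of \<open>p'\<close> and \<open>z\<close> through the slopes of the line and of the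
  first chord, hence as an element of \<open>H\<close>.
  But the ends of a chord lie in different cosets.\<close>

lemma line_and_two_chords:
  assumes l: "adj t (Inl u) (Inr p)" "adj t (Inl u) (Inr p')"
    and c: "adj t (Inr p) (Inr z)" "adj t (Inr p') (Inr z)"
  shows "p = p'"
proof -
  have s: "fst u \<in> H" "snd p - snd p' = fst u * (fst p - fst p')" using l by (auto simp: algebra_simps)
  have same: "p = p'" if "fst p = fst p'" using that l by (simp add: prod_eq_iff)
  consider "chord t p z" "chord t p' z" | "chord t z p" "chord t z p'"
    using c by (auto simp: chord_def)
  then show ?thesis
  proof cases
    case 1
    have "(fst p - fst p') * ((fst p - fst z + t) + (fst p' - fst z) - fst u)
        = ((fst p - fst z + t) * (fst p - fst z) - (fst p' - fst z + t) * (fst p' - fst z)) - fst u * (fst p - fst p')"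
      by (simp add: algebra_simps)
    also have "\<dots> = 0"
    proof -
      have "(fst p - fst z + t) * (fst p - fst z) = snd p - snd z"
        "(fst p' - fst z + t) * (fst p' - fst z) = snd p' - snd z" using 1 by (auto simp: chord_def)
      then show ?thesis using s(2) by simp
    qed
    finally consider "fst p = fst p'" | "(fst p - fst z + t) + (fst p' - fst z) - fst u = 0"
      unfolding mult_eq_0_iff by auto
    then show ?thesis
    proof cases
      case 2
      have a: "fst p - fst z + t \<in> H" using 1(1) by (simp add: chord_def)
      have eq: "fst p' - fst z = fst u - (fst p - fst z + t)" using 2 by (simp add: algebra_simps)
      have "fst p' - fst z \<in> H" unfolding eq using s(1) a by (rule H_diff)
      then show ?thesis using chord_coset[OF 1(2)] by simp
    qed (rule same)
  next
    case 2
    have "(fst p' - fst p) * ((fst z - fst p + t) + (fst z - fst p') - fst u)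
        = ((fst z - fst p + t) * (fst z - fst p) - (fst z - fst p' + t) * (fst z - fst p')) + fst u * (fst p - fst p')"
      by (simp add: algebra_simps)
    also have "\<dots> = 0"
    proof -
      have "(fst z - fst p + t) * (fst z - fst p) = snd z - snd p"
        "(fst z - fst p' + t) * (fst z - fst p') = snd z - snd p'" using 2 by (auto simp: chord_def)
      then show ?thesis unfolding s(2)[symmetric] by simp
    qed
    finally consider "fst p = fst p'" | "(fst z - fst p + t) + (fst z - fst p') - fst u = 0"
      unfolding mult_eq_0_iff by auto
    then show ?thesis
    proof cases
      case 2
      have a: "fst z - fst p + t \<in> H" using \<open>chord t z p\<close> by (simp add: chord_def)
      have eq: "fst z - fst p' = fst u - (fst z - fst p + t)" using 2 by (simp add: algebra_simps)
      have "fst z - fst p' \<in> H" unfolding eq using s(1) a by (rule H_diff)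
      then show ?thesis using chord_coset[OF \<open>chord t z p'\<close>] by simp
    qed (rule same)
  qed
qed

text \<open>The alternating sum of the chord equations around the cycle is bilinear.\<close>

lemma four_chords:
  assumes "chord t v w" "chord t v w'" "chord t v' w" "chord t v' w'"
  shows "v = v' \<or> w = w'"
proof -
  let ?f = "\<lambda>v w. (fst v - fst w + t) * (fst v - fst w)"
  have f: "?f v w = snd v - snd w" "?f v w' = snd v - snd w'" "?f v' w = snd v' - snd w" "?f v' w' = snd v' - snd w'"
    using assms by (auto simp: chord_def)
  have "2 * ((fst v - fst v') * (fst w' - fst w)) = ?f v w - ?f v w' + ?f v' w' - ?f v' w"
    by (simp add: algebra_simps)
  also have "\<dots> = 0" unfolding f by simp
  finally consider "fst v = fst v'" | "fst w = fst w'" using two by auto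
  then show ?thesis
  proof cases
    case 1
    then have "snd v - snd w = snd v' - snd w" using f(1,3) by simp
    then show ?thesis using 1 by (simp add: prod_eq_iff)
  next
    case 2
    then have "snd v - snd w = snd v - snd w'" using f(1,2) by simp
    then show ?thesis using 2 by (simp add: prod_eq_iff)
  qed
qed

lemma no_quadrilateral:
  assumes "adj t a b" "adj t b c" "adj t c d" "adj t d a"
  shows "a = c \<or> b = d"
proof -
  have base: "b = d"
    if q: "adj t (Inl u) b" "adj t b c" "adj t c d" "adj t d (Inl u)" "c \<noteq> Inl u" for u b c d
  proof -
    obtain p p' where p: "b = Inr p" "d = Inr p'" using q(1,4) by (cases b; cases d) auto
    note q' = q(1,2,3,4)[unfolded p]
    show ?thesis
    proof (cases c)
      case (Inl u')
      have "p = p'"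
        using q'(1) adj_sym[OF q'(2)] adj_sym[OF q'(4)] q'(3) q(5) unfolding Inl
        by (intro two_lines[of t u p u' p']) auto
      then show ?thesis using p by simp
    next
      case (Inr z)
      have "p = p'"
        using q'(1) adj_sym[OF q'(4)] q'(2) adj_sym[OF q'(3)] unfolding Inr
        by (rule line_and_two_chords)
      then show ?thesis using p by simp
    qed
  qed
  show ?thesis
  proof (cases "\<exists>u. Inl u \<in> {a, b, c, d}")
    case True
    then obtain u where "Inl u = a \<or> Inl u = b \<or> Inl u = c \<or> Inl u = d" by blast
    then show ?thesis
    proof (elim disjE)
      assume "Inl u = a" then show ?thesis using base[of u b c d] assms by blast
    next
      assume "Inl u = b" then show ?thesis using base[of u c d a] assms by blast
    next
      assume "Inl u = c" then show ?thesis using base[of u d a b] assms by blast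
    next
      assume "Inl u = d" then show ?thesis using base[of u a b c] assms by blast
    qed
  next
    case False
    then obtain p1 p2 p3 p4 where p: "a = Inr p1" "b = Inr p2" "c = Inr p3" "d = Inr p4"
      by (metis insert_iff sum.exhaust)
    have orient: "(fst x - \<theta> \<in> H \<longleftrightarrow> fst y - \<theta> \<notin> H) \<and> (fst x - \<theta> \<in> H \<longrightarrow> chord t x y) \<and>
        (fst x - \<theta> \<notin> H \<longrightarrow> chord t y x)" if "adj t (Inr x) (Inr y)" for x y
      using that by (auto simp: chord_def)
    consider "chord t p1 p2" "chord t p3 p2" "chord t p3 p4" "chord t p1 p4"
      | "chord t p2 p1" "chord t p2 p3" "chord t p4 p3" "chord t p4 p1"
      using assms(1)[unfolded p, THEN orient] assms(2)[unfolded p, THEN orient]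
        assms(3)[unfolded p, THEN orient] assms(4)[unfolded p, THEN orient] by blast
    then show ?thesis
    proof cases
      case 1
      then show ?thesis using four_chords[of t p1 p2 p4 p3] p by auto
    next
      case 2
      then show ?thesis using four_chords[of t p2 p1 p3 p4] p by auto
    qed
  qed
qed

lemma no_four_cycle:
  assumes E: "\<And>e. e \<in> E \<Longrightarrow> \<exists>a\<in>D. \<exists>b\<in>D. adj t a b \<and> e = {f a, f b}" and inj: "inj_on f D"
  shows "\<not> has_cycle 4 E"
proof
  assume "has_cycle 4 E"
  then obtain v where v: "inj_on v {..<4::nat}" and e: "\<And>i. i < 4 \<Longrightarrow> {v i, v (Suc i mod 4)} \<in> E"
    unfolding has_cycle_def by blast
  define \<delta> where "\<delta> i = inv_into D f (v i)" for i
  have adj: "adj t (\<delta> i) (\<delta> (Suc i mod 4)) \<and> f (\<delta> i) = v i" if i: "i < 4" for i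
  proof -
    obtain a b where ab: "a \<in> D" "b \<in> D" "adj t a b" "{v i, v (Suc i mod 4)} = {f a, f b}"
      using E[OF e[OF i]] by blast
    have inv: "inv_into D f (f a) = a" "inv_into D f (f b) = b" using ab inj by auto
    consider "v i = f a" "v (Suc i mod 4) = f b" | "v i = f b" "v (Suc i mod 4) = f a"
      using ab(4) by (auto simp: doubleton_eq_iff)
    then show ?thesis using ab(3) adj_sym inv by cases (auto simp: \<delta>_def)
  qed
  have "adj t (\<delta> 0) (\<delta> 1)" "adj t (\<delta> 1) (\<delta> 2)" "adj t (\<delta> 2) (\<delta> 3)" "adj t (\<delta> 3) (\<delta> 0)"
  proof -
    have m: "Suc 0 mod 4 = 1" "Suc 1 mod 4 = 2" "Suc 2 mod 4 = 3" "Suc 3 mod 4 = (0 :: nat)" by simp_all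
    show "adj t (\<delta> 0) (\<delta> 1)" using adj[of 0, unfolded m] by simp
    show "adj t (\<delta> 1) (\<delta> 2)" using adj[of 1, unfolded m] by simp
    show "adj t (\<delta> 2) (\<delta> 3)" using adj[of 2, unfolded m] by simp
    show "adj t (\<delta> 3) (\<delta> 0)" using adj[of 3, unfolded m] by simp
  qed
  then have "\<delta> 0 = \<delta> 2 \<or> \<delta> 1 = \<delta> 3" by (rule no_quadrilateral)
  moreover have "f (\<delta> 0) = v 0" "f (\<delta> 1) = v 1" "f (\<delta> 2) = v 2" "f (\<delta> 3) = v 3"
    using adj by simp_all
  ultimately have "v 0 = v 2 \<or> v 1 = v 3" by metis
  then show False using inj_onD[OF v, of 0 2] inj_onD[OF v, of 1 3] by auto
qed

text \<open>Cauchy--Schwarz, as the sum of the squares of \<open>s u\<close> minus their mean is nonnegative.\<close>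

lemma square_of_sum_le:
  fixes s :: "'i \<Rightarrow> nat"
  shows "(\<Sum>u\<in>U. s u) ^ 2 \<le> card U * (\<Sum>u\<in>U. s u ^ 2)"
proof (cases "card U = 0")
  case True
  then show ?thesis by (cases "finite U") auto
next
  case False
  define n T Q where "n = int (card U)" and "T = (\<Sum>u\<in>U. int (s u))" and "Q = (\<Sum>u\<in>U. int (s u) ^ 2)"
  have "0 \<le> (\<Sum>u\<in>U. (n * int (s u) - T) ^ 2)" by (intro sum_nonneg) simp
  also have "\<dots> = (\<Sum>u\<in>U. n ^ 2 * int (s u) ^ 2 - 2 * n * T * int (s u) + T ^ 2)"
    by (intro sum.cong refl) (simp add: power2_eq_square algebra_simps)
  also have "\<dots> = n ^ 2 * Q - 2 * n * T * T + n * T ^ 2"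
    by (simp add: sum.distrib sum_subtractf sum_distrib_left n_def Q_def T_def)
  also have "\<dots> = n * (n * Q - T ^ 2)" by (simp add: power2_eq_square algebra_simps)
  finally have "T ^ 2 \<le> n * Q" using False by (simp add: n_def zero_le_mult_iff)
  then have "int ((\<Sum>u\<in>U. s u) ^ 2) \<le> int (card U * (\<Sum>u\<in>U. s u ^ 2))"
    by (simp add: n_def T_def Q_def)
  then show ?thesis by (simp only: of_nat_le_iff)
qed

text \<open>In the first phase the items belong to pairs of a line and an element \<open>h\<close> of \<open>H\<close>: the line is joined to
  its point with first coordinate \<open>\<theta> + h\<close>, and then to the one with first coordinate \<open>h\<close> or \<open>h - \<theta>\<close>. Let \<open>S\<close> be the set
  of completed items, at least a third of all. By Cauchy--Schwarz the lines carry at least \<open>|S| * q / 9\<close>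
  pairs of claimed points, one in \<open>\<theta> + H\<close> and one outside. At most \<open>2 * |S|\<close> of these pairs have
  been taken by Blocker, so \<open>|S| * q / 18\<close> remain because \<open>36 \<le> q\<close>, and some \<open>t\<close> accounts for \<open>|S| / 18\<close>
  of them. In the second phase Constructor claims half of these chords, each of which closes a triangle.
  As \<open>|S|\<close> is at least \<open>q ^ 3 / 27\<close>, this gives the factor \<open>972 = 27 * 18 * 2\<close>.\<close>

theorem four_cycle_strategy:
  assumes q: "36 \<le> card K" and n: "2 * card K ^ 2 \<le> n"
  shows "card K ^ 3 \<le> 972 * g n (complete_graph 3) (cycle_graph 4)"
proof -
  let ?F = "cycle_graph 4"
  let ?val = "game_value n (complete_graph 3) ?F Constructor"
  define q where "q = card K"
  define h where "h = card H"
  have finH: "finite H" using fin HK finite_subset by blast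
  have hq: "h \<le> q" unfolding h_def q_def using fin HK by (rule card_mono)
  define D where "D = Inl ` (H \<times> K) \<union> Inr ` (K \<times> K)"
  have finD: "finite D" using fin finH by (simp add: D_def)
  have "card D \<le> card (Inl ` (H \<times> K) :: (('a \<times> 'a) + ('a \<times> 'a)) set) + card (Inr ` (K \<times> K) :: (('a \<times> 'a) + ('a \<times> 'a)) set)"
    unfolding D_def by (rule card_Un_le)
  also have "\<dots> = h * q + q * q"
    by (simp add: card_image card_cartesian_product h_def q_def)
  also have "\<dots> \<le> n"
  proof -
    have "2 * (q * q) \<le> n" using n by (simp add: q_def power2_eq_square)
    moreover have "h * q \<le> q * q" using hq by (rule mult_le_mono1)
    ultimately show ?thesis by linarith
  qed
  finally have "card D \<le> card {..<n}" by simp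
  then obtain f where f: "f ` D \<subseteq> {..<n}" "inj_on f D"
    using card_le_inj[OF finD, of "{..<n}"] by auto
  have free: "free_of ?F ({..<n}, C)"
    if C: "\<And>e. e \<in> C \<Longrightarrow> \<exists>a\<in>D. \<exists>b\<in>D. adj t a b \<and> e = {f a, f b}" for C t
  proof -
    have "e \<subseteq> {..<n}" if "e \<in> C" for e using C[OF that] f(1) by auto
    then show ?thesis using no_four_cycle[OF C f(2)] by (subst free_of_cycle_iff) auto
  qed
  have edge: "{f a, f b} \<in> edges_of n" if "a \<in> D" "b \<in> D" "a \<noteq> b" for a b
  proof -
    have "f a \<noteq> f b" using inj_onD[OF f(2)] that by blast
    then show ?thesis using f(1) that by (auto simp: complete_graph_def)
  qed
  \<comment> \<open>The point with first coordinate \<open>a\<close> on the line \<open>u\<close>.\<close>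
  define P where "P u a = (Inr (a, snd u + fst u * a) :: ('a \<times> 'a) + ('a \<times> 'a))" for u a
  define ed where "ed u a = {f (Inl u), f (P u a)}" for u a
  have PD: "Inl u \<in> D" "P u a \<in> D" if "u \<in> H \<times> K" "a \<in> K" for u a
    using that HK K_closed by (auto simp: D_def P_def)
  have ed_adj: "\<exists>x\<in>D. \<exists>y\<in>D. adj t x y \<and> ed u a = {f x, f y}" if "u \<in> H \<times> K" "a \<in> K" for u a t
    using PD[OF that] that by (intro bexI[of _ "Inl u"] bexI[of _ "P u a"]) (auto simp: ed_def P_def)
  have ed_edge: "ed u a \<in> edges_of n" if "u \<in> H \<times> K" "a \<in> K" for u a
    unfolding ed_def using PD[OF that] by (intro edge) (auto simp: P_def)
  have ed_eq: "u = u' \<and> a = a'" if "ed u a = ed u' a'" "u \<in> H \<times> K" "a \<in> K" "u' \<in> H \<times> K" "a' \<in> K" for u a u' a'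
  proof -
    note D = PD[OF that(2,3)] PD[OF that(4,5)]
    have "f (Inl u) = f (Inl u') \<and> f (P u a) = f (P u' a') \<or> f (Inl u) = f (P u' a') \<and> f (P u a) = f (Inl u')"
      using that(1) by (simp add: ed_def doubleton_eq_iff)
    then have "(Inl u :: ('a \<times> 'a) + ('a \<times> 'a)) = Inl u' \<and> P u a = P u' a' \<or> Inl u = P u' a' \<and> P u a = Inl u'"
      by (simp only: inj_on_eq_iff[OF f(2)] D)
    then show ?thesis by (auto simp: P_def)
  qed
  define I where "I = (H \<times> K) \<times> H"
  have Imem: "fst i \<in> H \<times> K" "snd i \<in> H" "snd i \<in> K" "\<theta> + snd i \<in> K" "snd i - \<theta> \<in> K" if "i \<in> I" for i
    using that HK K_closed \<theta>(1) by (auto simp: I_def)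
  define xe where "xe i = ed (fst i) (\<theta> + snd i)" for i
  define ye where "ye i = ed (fst i) (snd i)" for i
  define ze where "ze i = ed (fst i) (snd i - \<theta>)" for i
  have cosets: "\<theta> + a \<noteq> b" "\<theta> + a \<noteq> b - \<theta>" "a \<noteq> b - \<theta>" if "a \<in> H" "b \<in> H" for a b
  proof -
    have "b - a \<in> H" using that by (intro H_diff)
    then have "b - a \<noteq> \<theta>" "b - a \<noteq> \<theta> + \<theta>" using \<theta> by auto
    then show "\<theta> + a \<noteq> b" "\<theta> + a \<noteq> b - \<theta>" "a \<noteq> b - \<theta>" by (auto simp: algebra_simps)
  qed
  have coords: "\<exists>a\<in>{\<theta> + snd i, snd i, snd i - \<theta>}. e = ed (fst i) a" if "e \<in> {xe i, ye i, ze i}" for e i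
    using that by (auto simp: xe_def ye_def ze_def)
  have coord_eq: "i = j \<and> a = b" if "i \<in> I" "j \<in> I" "a \<in> {\<theta> + snd i, snd i, snd i - \<theta>}"
    "b \<in> {\<theta> + snd j, snd j, snd j - \<theta>}" "ed (fst i) a = ed (fst j) b" for i j a b
  proof -
    have "a \<in> K" "b \<in> K" using that(3,4) Imem[OF that(1)] Imem[OF that(2)] by auto
    then have eq: "fst i = fst j" "a = b" using ed_eq[OF that(5)] Imem that(1,2) by auto
    have "snd i = snd j"
      using that(3,4) eq(2) cosets[OF Imem(2)[OF that(1)] Imem(2)[OF that(2)]]
        cosets[OF Imem(2)[OF that(2)] Imem(2)[OF that(1)]] by auto
    then show ?thesis using eq by (simp add: prod_eq_iff)
  qed
  have cardI: "card I = h * q * h" by (simp add: I_def card_cartesian_product h_def q_def)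
  \<comment> \<open>The quotient rounded up.\<close>
  define m where "m = (q ^ 3 + 971) div 972"
  have "m \<le> ?val {} {}"
  proof (rule item_phase[where I = I and x = xe and y = ye and z = ze])
    show "finite I" using fin finH by (simp add: I_def)
    show "{xe i, ye i, ze i} \<subseteq> edges_of n" if "i \<in> I" for i
      using Imem[OF that] ed_edge by (simp add: xe_def ye_def ze_def)
    show "{xe i, ye i, ze i} \<inter> ({} \<union> {}) = {}" for i by simp
    show "xe i \<noteq> ye i \<and> xe i \<noteq> ze i \<and> ye i \<noteq> ze i" if "i \<in> I" for i
      using coord_eq[OF that that] cosets[OF Imem(2)[OF that] Imem(2)[OF that]]
      unfolding xe_def ye_def ze_def by blast
    show "{xe i, ye i, ze i} \<inter> {xe j, ye j, ze j} = {}" if ij: "i \<in> I" "j \<in> I" "i \<noteq> j" for i j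
    proof (rule ccontr)
      assume "{xe i, ye i, ze i} \<inter> {xe j, ye j, ze j} \<noteq> {}"
      then obtain e where e: "e \<in> {xe i, ye i, ze i}" "e \<in> {xe j, ye j, ze j}" by blast
      obtain a where a: "a \<in> {\<theta> + snd i, snd i, snd i - \<theta>}" "e = ed (fst i) a" using coords[OF e(1)] by blast
      obtain b where b: "b \<in> {\<theta> + snd j, snd j, snd j - \<theta>}" "e = ed (fst j) b" using coords[OF e(2)] by blast
      show False using coord_eq[OF ij(1,2) a(1) b(1)] a(2) b(2) ij(3) by simp
    qed
    have played: "\<exists>u a. u \<in> H \<times> K \<and> a \<in> K \<and> e = ed u a"
      if S: "S \<subseteq> I" "\<forall>i\<in>S. w i \<in> {ye i, ze i}" and e: "e \<in> {} \<union> xe ` S \<union> w ` S" for S w e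
    proof -
      from e consider i where "i \<in> S" "e = xe i" | i where "i \<in> S" "e = w i" by blast
      then obtain i where i: "i \<in> I" "e \<in> {xe i, ye i, ze i}" using S by cases blast+
      then obtain a where "a \<in> {\<theta> + snd i, snd i, snd i - \<theta>}" "e = ed (fst i) a" using coords by blast
      then show ?thesis using Imem[OF i(1)] by (intro exI[of _ "fst i"] exI[of _ a]) auto
    qed
    show "\<forall>S\<subseteq>I. \<forall>w. (\<forall>i\<in>S. w i \<in> {ye i, ze i}) \<longrightarrow> free_of ?F ({..<n}, {} \<union> xe ` S \<union> w ` S)"
    proof (intro allI impI free[where t = 0])
      fix S w e assume "S \<subseteq> I" "\<forall>i\<in>S. w i \<in> {ye i, ze i}" "e \<in> {} \<union> xe ` S \<union> w ` S"
      from played[OF this] obtain u a where "u \<in> H \<times> K" "a \<in> K" "e = ed u a" by blast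
      then show "\<exists>a\<in>D. \<exists>b\<in>D. adj 0 a b \<and> e = {f a, f b}" using ed_adj by blast
    qed
    show "\<forall>S\<subseteq>I. \<forall>w B'. (\<forall>i\<in>S. w i \<in> {ye i, ze i}) \<longrightarrow> card I \<le> 3 * card S \<longrightarrow> finite B'
      \<longrightarrow> card B' \<le> card {} + 2 * card S
      \<longrightarrow> m \<le> ?val ({} \<union> xe ` S \<union> w ` S) B'"
    proof (intro allI impI)
      fix S w and B' :: "nat set set"
      assume S: "S \<subseteq> I" "\<forall>i\<in>S. w i \<in> {ye i, ze i}" "card I \<le> 3 * card S"
        and B': "finite B'" "card B' \<le> card {} + 2 * card S"
      let ?C = "{} \<union> xe ` S \<union> w ` S"
      have finS: "finite S" by (rule finite_subset[OF S(1)]) (use fin finH in \<open>simp add: I_def\<close>)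
      define \<alpha> where "\<alpha> i = (if w i = ye i then snd i else snd i - \<theta>)" for i
      have \<alpha>: "w i = ed (fst i) (\<alpha> i)" "\<alpha> i \<in> {snd i, snd i - \<theta>}" if "i \<in> S" for i
        using S(2) that by (auto simp: \<alpha>_def ye_def ze_def)
      \<comment> \<open>Two completed items on the same line: the point of the first in \<open>\<theta> + H\<close> and the point of the
        second outside form a pair.\<close>
      define Ch where "Ch = (SIGMA i:S. {j \<in> S. fst j = fst i})"
      have finCh: "finite Ch" using finS by (simp add: Ch_def)
      have Ch: "fst c \<in> S" "snd c \<in> S" "fst (snd c) = fst (fst c)" if "c \<in> Ch" for c
        using that by (auto simp: Ch_def)
      define V where "V c = P (fst (fst c)) (\<theta> + snd (fst c))" for c :: "(('a \<times> 'a) \<times> 'a) \<times> (('a \<times> 'a) \<times> 'a)"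
      define W where "W c = P (fst (fst c)) (\<alpha> (snd c))" for c :: "(('a \<times> 'a) \<times> 'a) \<times> (('a \<times> 'a) \<times> 'a)"
      define e where "e c = {f (V c), f (W c)}" for c
      define \<tau> where "\<tau> c = fst (fst (fst c)) - (\<theta> + snd (fst c)) + \<alpha> (snd c)"
        for c :: "(('a \<times> 'a) \<times> 'a) \<times> (('a \<times> 'a) \<times> 'a)"
      have inK: "fst (fst c) \<in> H \<times> K" "fst (fst (fst c)) \<in> H" "snd (fst c) \<in> H" "\<theta> + snd (fst c) \<in> K"
        "snd (snd c) \<in> H" "\<alpha> (snd c) \<in> K" "\<tau> c \<in> K" "\<alpha> (snd c) - \<theta> \<notin> H" if c: "c \<in> Ch" for c
      proof -
        have I: "fst c \<in> I" "snd c \<in> I" using Ch[OF c] S(1) by auto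
        show 1: "fst (fst c) \<in> H \<times> K" "snd (fst c) \<in> H" "\<theta> + snd (fst c) \<in> K" using Imem[OF I(1)] by auto
        then show 2: "fst (fst (fst c)) \<in> H" by auto
        show s: "snd (snd c) \<in> H" using Imem[OF I(2)] by auto
        show 3: "\<alpha> (snd c) \<in> K" using \<alpha>(2)[OF Ch(2)[OF c]] Imem[OF I(2)] by auto
        show "\<tau> c \<in> K" unfolding \<tau>_def using 1(3) 2 3 HK K_closed by blast
        show "\<alpha> (snd c) - \<theta> \<notin> H"
        proof
          assume a: "\<alpha> (snd c) - \<theta> \<in> H"
          have "snd (snd c) - (\<alpha> (snd c) - \<theta>) \<in> H" by (rule H_diff[OF s a])
          moreover have "snd (snd c) - (\<alpha> (snd c) - \<theta>) \<in> {\<theta>, \<theta> + \<theta>}"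
            using \<alpha>(2)[OF Ch(2)[OF c]] by auto
          ultimately show False using \<theta> by auto
        qed
      qed
      have VW: "V c \<in> D" "W c \<in> D" if "c \<in> Ch" for c
        using inK[OF that] PD(2) by (auto simp: V_def W_def)
      have chord: "chord (\<tau> c) (\<theta> + snd (fst c), snd (fst (fst c)) + fst (fst (fst c)) * (\<theta> + snd (fst c)))
          (\<alpha> (snd c), snd (fst (fst c)) + fst (fst (fst c)) * \<alpha> (snd c))" if "c \<in> Ch" for c
        using inK[OF that] by (simp add: chord_def \<tau>_def algebra_simps)
      have VW_adj: "adj (\<tau> c) (V c) (W c)" if "c \<in> Ch" for c
        using chord[OF that] by (simp add: V_def W_def P_def)
      have Vne: "V c \<noteq> W c'" if "c \<in> Ch" "c' \<in> Ch" for c c'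
      proof
        assume "V c = W c'"
        then have "\<alpha> (snd c') - \<theta> = snd (fst c)" by (auto simp: V_def W_def P_def algebra_simps)
        then show False using inK(3)[OF that(1)] inK(8)[OF that(2)] by simp
      qed
      have e_inj: "inj_on e Ch"
      proof (rule inj_onI)
        fix c c' assume c: "c \<in> Ch" "c' \<in> Ch" "e c = e c'"
        have "f (V c) = f (V c') \<and> f (W c) = f (W c') \<or> f (V c) = f (W c') \<and> f (W c) = f (V c')"
          using c(3) by (simp add: e_def doubleton_eq_iff)
        then have "V c = V c' \<and> W c = W c' \<or> V c = W c' \<and> W c = V c'"
          by (simp only: inj_on_eq_iff[OF f(2)] VW[OF c(1)] VW[OF c(2)])
        then have eq: "V c = V c'" "W c = W c'" using Vne c(1,2) by auto
        have h: "snd (fst c) = snd (fst c')" and \<alpha>eq: "\<alpha> (snd c) = \<alpha> (snd c')"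
          using eq by (auto simp: V_def W_def P_def)
        have ne: "V c \<noteq> W c" using Vne c(1) by blast
        have "fst (fst c) = fst (fst c')"
        proof (rule ccontr)
          assume "fst (fst c) \<noteq> fst (fst c')"
          moreover have "adj 0 (Inl (fst (fst c))) (V c)" "adj 0 (Inl (fst (fst c))) (W c)"
            "adj 0 (Inl (fst (fst c'))) (V c)" "adj 0 (Inl (fst (fst c'))) (W c)"
            using inK(2)[OF c(1)] inK(2)[OF c(2)] unfolding eq(1) eq(2)
            by (simp_all add: V_def W_def P_def flip: eq) (use eq in \<open>auto simp: V_def W_def P_def\<close>)
          moreover obtain p p' where "V c = Inr p" "W c = Inr p'" by (simp add: V_def W_def P_def)
          ultimately show False using two_lines[of 0 "fst (fst c)" p "fst (fst c')" p'] ne by auto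
        qed
        then have "fst c = fst c'" using h by (simp add: prod_eq_iff)
        moreover have "snd (snd c) = snd (snd c')"
          using \<alpha>(2)[OF Ch(2)[OF c(1)]] \<alpha>(2)[OF Ch(2)[OF c(2)]] \<alpha>eq
            cosets(3)[OF inK(5)[OF c(1)] inK(5)[OF c(2)]] cosets(3)[OF inK(5)[OF c(2)] inK(5)[OF c(1)]] by auto
        ultimately show "c = c'" using Ch(3)[OF c(1)] Ch(3)[OF c(2)] by (auto simp: prod_eq_iff)
      qed
      define U where "U = H \<times> K"
      have finU: "finite U" using fin finH by (simp add: U_def)
      have SU: "fst ` S \<subseteq> U" using S(1) Imem(1) by (auto simp: U_def)
      define s where "s u = card {j \<in> S. fst j = u}" for u
      have sumS: "(\<Sum>u\<in>U. s u) = card S"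
        using sum.group[OF finS finU SU, of "\<lambda>_. 1 :: nat"] by (simp add: s_def)
      have "card Ch = (\<Sum>i\<in>S. s (fst i))"
        unfolding Ch_def s_def using finS by (simp add: card_SigmaI)
      also have "\<dots> = (\<Sum>u\<in>U. \<Sum>i\<in>{j \<in> S. fst j = u}. s (fst i))"
        by (rule sum.group[OF finS finU SU, symmetric])
      also have "\<dots> = (\<Sum>u\<in>U. s u ^ 2)"
        by (intro sum.cong refl) (simp add: s_def power2_eq_square)
      finally have sumCh: "(\<Sum>u\<in>U. s u ^ 2) = card Ch" by simp
      have cardU: "card U = h * q" by (simp add: U_def card_cartesian_product h_def q_def)
      have q36: "36 \<le> q" using assms(1) by (simp add: q_def)
      have q3h: "q \<le> 3 * h" using H_large by (simp add: q_def h_def)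
      have "card S * (h * q * h) \<le> card S * (3 * card S)"
        using S(3) unfolding cardI by (rule mult_le_mono2)
      also have "\<dots> = 3 * card S ^ 2" by (simp add: power2_eq_square)
      also have "\<dots> \<le> 3 * (h * q * card Ch)"
        using square_of_sum_le[of s U] unfolding sumS sumCh cardU by simp
      finally have "(h * q) * (card S * h) \<le> (h * q) * (3 * card Ch)" by (simp add: mult_ac)
      moreover have "0 < h * q" using q36 q3h by simp
      ultimately have ChS: "card S * h \<le> 3 * card Ch" by simp
      define Ch' where "Ch' = {c \<in> Ch. e c \<notin> B'}"
      have finCh': "finite Ch'" using finCh by (simp add: Ch'_def)
      have "card {c \<in> Ch. {e c} \<inter> B' \<noteq> {}} \<le> card B'"
        using inj_onD[OF e_inj] by (intro card_hit_le B'(1)) blast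
      moreover have "card Ch \<le> card (Ch' \<union> {c \<in> Ch. {e c} \<inter> B' \<noteq> {}})"
        using finCh by (intro card_mono) (auto simp: Ch'_def)
      moreover have "card (Ch' \<union> {c \<in> Ch. {e c} \<inter> B' \<noteq> {}}) \<le> card Ch' + card {c \<in> Ch. {e c} \<inter> B' \<noteq> {}}"
        by (rule card_Un_le)
      ultimately have "card Ch \<le> card Ch' + 2 * card S" using B'(2) by simp
      moreover have "card S * q \<le> 3 * (card S * h)" using mult_le_mono2[OF q3h, of "card S"] by simp
      moreover have "card S * 36 \<le> card S * q" using q36 by simp
      ultimately have Ch'S: "card S * q \<le> 18 * card Ch'" using ChS by linarith
      obtain t where t: "card Ch' \<le> q * card {c \<in> Ch'. \<tau> c = t}"
      proof (rule ccontr)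
        assume "\<not> thesis"
        then have "q * card {c \<in> Ch'. \<tau> c = t} < card Ch'" for t using that[of t] by (meson not_le)
        then have "(\<Sum>t\<in>K. q * card {c \<in> Ch'. \<tau> c = t}) < (\<Sum>t\<in>K. card Ch')"
          using fin \<theta>(1) by (intro sum_strict_mono) auto
        moreover have "\<tau> ` Ch' \<subseteq> K" using inK(7) unfolding Ch'_def by blast
        then have "(\<Sum>t\<in>K. card {c \<in> Ch'. \<tau> c = t}) = card Ch'"
          using sum.group[OF finCh' fin, of \<tau> "\<lambda>_. 1 :: nat"] by simp
        ultimately show False by (simp add: q_def flip: sum_distrib_left)
      qed
      define N where "N = {c \<in> Ch'. \<tau> c = t}"
      have N: "c \<in> Ch" "e c \<notin> B'" "\<tau> c = t" if "c \<in> N" for c using that by (auto simp: N_def Ch'_def)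
      have finN: "finite N" using finCh' by (simp add: N_def)
      have "card Ch' \<le> q * card N" using t by (simp add: N_def)
      then have "card S * q \<le> 18 * (q * card N)" using Ch'S by linarith
      then have "q * card S \<le> q * (18 * card N)" by (simp only: mult_ac)
      then have NS: "card S \<le> 18 * card N" using q36 by simp
      have C_edges: "?C \<subseteq> edges_of n"
      proof
        fix d assume "d \<in> ?C"
        from played[OF S(1,2) this] obtain u a where "u \<in> H \<times> K" "a \<in> K" "d = ed u a" by blast
        then show "d \<in> edges_of n" using ed_edge by simp
      qed
      have e_edge: "e c \<in> edges_of n" if "c \<in> Ch" for c
        unfolding e_def using VW[OF that] Vne[OF that that] by (rule edge)
      show "m \<le> ?val ?C B'"
      proof (rule single_edge_phase[where I = N and x = e])
        show "finite N" "finite B'" by fact+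
        show "inj_on e N" using e_inj by (rule inj_on_subset) (use N(1) in blast)
        show "e ` N \<subseteq> edges_of n" using e_edge N(1) by blast
        show "e ` N \<inter> (?C \<union> B') = {}"
        proof -
          have "e c \<notin> ?C" if c: "c \<in> N" for c
          proof
            assume "e c \<in> ?C"
            from played[OF S(1,2) this] obtain u a where ua: "u \<in> H \<times> K" "a \<in> K" "e c = ed u a" by blast
            then have "f (Inl u) = f (V c) \<or> f (Inl u) = f (W c)" by (auto simp: e_def ed_def doubleton_eq_iff)
            then have "Inl u = V c \<or> Inl u = W c"
              by (simp only: inj_on_eq_iff[OF f(2)] VW[OF N(1)[OF c]] PD(1)[OF ua(1,2)])
            then show False by (simp add: V_def W_def P_def)
          qed
          then show ?thesis using N(2) by blast
        qed
        show "\<forall>S2\<subseteq>N. free_of ?F ({..<n}, ?C \<union> e ` S2)"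
        proof (intro allI impI free[where t = t])
          fix S2 d assume S2: "S2 \<subseteq> N" and "d \<in> ?C \<union> e ` S2"
          then consider "d \<in> ?C" | c where "c \<in> N" "d = e c" by blast
          then show "\<exists>a\<in>D. \<exists>b\<in>D. adj t a b \<and> d = {f a, f b}"
          proof cases
            case 1
            from played[OF S(1,2) 1] obtain u a where "u \<in> H \<times> K" "a \<in> K" "d = ed u a" by blast
            then show ?thesis using ed_adj by blast
          next
            case (2 c)
            then show ?thesis using VW[OF N(1)[OF 2(1)]] VW_adj[OF N(1)[OF 2(1)]] N(3)[OF 2(1)]
              by (intro bexI[of _ "V c"] bexI[of _ "W c"]) (auto simp: e_def)
          qed
        qed
        show "\<forall>S2\<subseteq>N. card N \<le> 2 * card S2 \<longrightarrow>
            (\<forall>B''. m \<le> ?val (?C \<union> e ` S2) B'')"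
        proof (intro allI impI)
          fix S2 B'' assume S2: "S2 \<subseteq> N" "card N \<le> 2 * card S2"
          let ?G = "?C \<union> e ` S2"
          have G_edges: "?G \<subseteq> edges_of n" using C_edges e_edge N(1) S2(1) by blast
          define tri where "tri c = insert (f (Inl (fst (fst c)))) (e c)" for c
          have tri_e: "e c = tri c - f ` Inl ` (H \<times> K)" "card (tri c) = 3" if c: "c \<in> Ch" for c
          proof -
            have "f x \<notin> f ` Inl ` (H \<times> K)" if "x = V c \<or> x = W c" for x
            proof
              assume "f x \<in> f ` Inl ` (H \<times> K)"
              then obtain u where u: "u \<in> H \<times> K" "f x = f (Inl u)" by blast
              have "Inl u \<in> D" "x \<in> D" using u(1) VW[OF c] that by (auto simp: D_def)
              then have "x = Inl u" using inj_onD[OF f(2) u(2)] by simp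
              then show False using that by (auto simp: V_def W_def P_def)
            qed
            then have out: "f (V c) \<notin> f ` Inl ` (H \<times> K)" "f (W c) \<notin> f ` Inl ` (H \<times> K)" by blast+
            have l: "f (Inl (fst (fst c))) \<in> f ` Inl ` (H \<times> K)" using inK(1)[OF c] by blast
            show "e c = tri c - f ` Inl ` (H \<times> K)" using out l by (auto simp: tri_def e_def)
            have "card (e c) = 2" using e_edge[OF c] by (simp add: complete_graph_def)
            moreover have "f (Inl (fst (fst c))) \<notin> e c" using out l by (auto simp: e_def)
            moreover have "finite (e c)" by (simp add: e_def)
            ultimately show "card (tri c) = 3" by (simp add: tri_def)
          qed
          have "tri c \<in> triangles ?G" if c: "c \<in> S2" for c
          proof -
            have cCh: "c \<in> Ch" using c S2(1) N(1) by blast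
            have "{f (Inl (fst (fst c))), f (V c)} = xe (fst c)" by (simp add: xe_def ed_def V_def)
            moreover have "{f (Inl (fst (fst c))), f (W c)} = w (snd c)"
              using \<alpha>(1)[OF Ch(2)[OF cCh]] Ch(3)[OF cCh] by (simp add: ed_def W_def)
            ultimately have "{f (Inl (fst (fst c))), f (V c)} \<in> ?G" "{f (Inl (fst (fst c))), f (W c)} \<in> ?G"
              "{f (V c), f (W c)} \<in> ?G"
              using Ch[OF cCh] c by (auto simp: e_def)
            then show ?thesis
              using tri_e(2)[OF cCh] by (simp add: triangles_def tri_def e_def insert_commute)
          qed
          then have img: "tri ` S2 \<subseteq> triangles ?G" by blast
          have "inj_on tri S2"
          proof (rule inj_onI)
            fix c c' assume c: "c \<in> S2" "c' \<in> S2" "tri c = tri c'"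
            then have "c \<in> Ch" "c' \<in> Ch" using S2(1) N(1) by blast+
            then show "c = c'" using tri_e(1) c(3) inj_onD[OF e_inj] by metis
          qed
          then have "card S2 = card (tri ` S2)" by (simp add: card_image)
          also have "\<dots> \<le> card (triangles ?G)"
          proof (intro card_mono img)
            show "finite (triangles ?G)"
              by (rule finite_triangles[of _ "{..<n}"]) (use G_edges edges_ofD in blast)+
          qed
          finally have "card S2 \<le> card (triangles ?G)" .
          moreover have "q ^ 3 \<le> 972 * card S2"
          proof -
            have "q * (q * q) \<le> q * ((3 * h) * (3 * h))" using q3h by (intro mult_le_mono) auto
            also have "\<dots> = 9 * (h * q * h)" by simp
            also have "\<dots> \<le> 9 * (3 * card S)" using S(3) unfolding cardI by (rule mult_le_mono2)
            finally show ?thesis using NS S2(2) by (simp add: power3_eq_cube)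
          qed
          ultimately have "m \<le> card (triangles ?G)" by (simp add: m_def)
          also have "\<dots> \<le> ?val ?G B''"
            by (rule game_value_ge_current[OF G_edges])
          finally show "m \<le> ?val ?G B''" .
        qed
      qed
    qed
  qed auto
  then show ?thesis unfolding g_def m_def q_def by linarith
qed

end

section \<open>The order of magnitude\<close>

text \<open>The additive map \<open>x \<mapsto> x ^ 3 - x\<close> takes each value at most three times, as its kernel has three
  elements, but it is not injective; so its image is a proper subgroup of index at most three.\<close>

lemma plane_exists:
  assumes three: "(3 :: 'a :: alg_closed_field) = 0" and j: "0 < j"
  shows "\<exists>H \<theta>. plane (frob_fixed j :: 'a set) H \<theta>"
proof -
  let ?K = "frob_fixed j :: 'a set"
  define \<phi> where "\<phi> x = x ^ 3 - x" for x :: 'a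
  have fin: "finite ?K" using card_frob_fixed[OF three j] by simp
  have \<phi>_diff: "\<phi> (x - y) = \<phi> x - \<phi> y" for x y
    unfolding \<phi>_def cube_diff[OF three] by simp
  have \<phi>_K: "\<phi> ` ?K \<subseteq> ?K" using frob_fixed_closed[OF three] by (auto simp: \<phi>_def)
  have two_eq: "(2 :: 'a) = - 1"
  proof -
    have "(2 :: 'a) + 1 = 0" using three by simp
    then show ?thesis by (simp only: eq_neg_iff_add_eq_0)
  qed
  have "\<not> inj_on \<phi> ?K"
  proof
    assume "inj_on \<phi> ?K"
    moreover have "\<phi> 0 = \<phi> 1" by (simp add: \<phi>_def)
    ultimately show False using frob_fixed_0_1 inj_onD by fastforce
  qed
  then have "\<phi> ` ?K \<noteq> ?K" using fin finite_surj_inj[of ?K \<phi>] by auto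
  then obtain \<theta> where \<theta>: "\<theta> \<in> ?K" "\<theta> \<notin> \<phi> ` ?K" using \<phi>_K by blast
  have diff: "x - y \<in> \<phi> ` ?K" if xy: "x \<in> \<phi> ` ?K" "y \<in> \<phi> ` ?K" for x y
  proof -
    obtain a b where "a \<in> ?K" "b \<in> ?K" "x = \<phi> a" "y = \<phi> b" using xy by blast
    then show ?thesis using frob_fixed_closed(2)[OF three, of a j b] by (intro image_eqI[of _ _ "a - b"]) (simp_all add: \<phi>_diff)
  qed
  have zero: "0 \<in> \<phi> ` ?K" using frob_fixed_0_1 by (intro image_eqI[of _ _ 0]) (auto simp: \<phi>_def)
  have dbl: "\<theta> + \<theta> = - \<theta>" using two_eq by (metis mult_2 mult_minus1)
  have "\<theta> + \<theta> \<notin> \<phi> ` ?K"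
  proof
    assume "\<theta> + \<theta> \<in> \<phi> ` ?K"
    then have "0 - (\<theta> + \<theta>) \<in> \<phi> ` ?K" using zero by (intro diff)
    then show False using \<theta>(2) unfolding dbl by simp
  qed
  moreover have "card ?K \<le> 3 * card (\<phi> ` ?K)"
  proof -
    have fibre: "card {x \<in> ?K. \<phi> x = y} \<le> 3" for y
    proof (cases "\<exists>x0\<in>?K. \<phi> x0 = y")
      case True
      then obtain x0 where x0: "\<phi> x0 = y" by blast
      have "{x \<in> ?K. \<phi> x = y} \<subseteq> {x0, x0 + 1, x0 - 1}"
      proof
        fix x assume "x \<in> {x \<in> ?K. \<phi> x = y}"
        then have "\<phi> (x - x0) = 0" using x0 by (simp add: \<phi>_diff)
        moreover have "\<phi> z = z * (z - 1) * (z + 1)" for z :: 'a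
          by (simp add: \<phi>_def power3_eq_cube algebra_simps)
        ultimately have "x - x0 = 0 \<or> x - x0 - 1 = 0 \<or> x - x0 + 1 = 0" by simp
        then show "x \<in> {x0, x0 + 1, x0 - 1}" by (auto simp: algebra_simps eq_neg_iff_add_eq_0)
      qed
      then have "card {x \<in> ?K. \<phi> x = y} \<le> card {x0, x0 + 1, x0 - 1}" by (intro card_mono) auto
      also have "\<dots> \<le> 3" by (simp add: card_insert_if)
      finally show ?thesis .
    next
      case False
      then have empty: "{x \<in> ?K. \<phi> x = y} = {}" by blast
      show ?thesis unfolding empty by simp
    qed
    have "card ?K = (\<Sum>y\<in>\<phi> ` ?K. card {x \<in> ?K. \<phi> x = y})"
      using sum.group[of ?K "\<phi> ` ?K" \<phi> "\<lambda>_. 1 :: nat"] fin by simp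
    also have "\<dots> \<le> (\<Sum>y\<in>\<phi> ` ?K. 3)" by (intro sum_mono fibre)
    finally show ?thesis by simp
  qed
  moreover have "(2 :: 'a) \<noteq> 0" unfolding two_eq by simp
  ultimately have "plane ?K (\<phi> ` ?K) \<theta>"
    using fin \<phi>_K \<theta> diff zero frob_fixed_closed[OF three] by unfold_locales auto
  then show ?thesis by blast
qed

lemma lower_bound_4:
  assumes "4 \<le> j" "2 * (3 ^ j) ^ 2 \<le> n"
  shows "(3 ^ j) ^ 3 \<le> 972 * g n (complete_graph 3) (cycle_graph 4)"
proof -
  have j: "0 < j" using assms by simp
  obtain H \<theta> where "plane (frob_fixed j :: ac3 set) H \<theta>"
    using plane_exists[OF three_ac3 j] by blast
  then interpret plane "frob_fixed j :: ac3 set" H \<theta> .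
  have "card (frob_fixed j :: ac3 set) = 3 ^ j" by (rule card_frob_fixed(2)[OF three_ac3 j])
  moreover have "(3 :: nat) ^ 4 \<le> 3 ^ j" using assms(1) by (intro power_increasing) auto
  ultimately show ?thesis using four_cycle_strategy[of n] assms(2) by simp
qed

text \<open>A vertex on the left and the first coordinate of a neighbour determine the neighbour; this gives the
  number of edges here and in the next lemma.\<close>

lemma lower_bound_6:
  assumes "4 \<le> j" "13 * (3 ^ j) ^ 3 \<le> n"
  shows "(3 ^ j) ^ 4 \<le> 6 * g n (complete_graph 3) (cycle_graph 6)"
proof -
  define K where "K = (frob_fixed j :: ac3 set)"
  define q :: nat where "q = 3 ^ j"
  have cardK: "card K = q" "finite K"
    using card_frob_fixed[OF three_ac3, of j] assms(1) by (auto simp: K_def q_def)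
  have closed: "x * y \<in> K" "x - y \<in> K" "x ^ i \<in> K" if "x \<in> K" "y \<in> K" for x y i
    using frob_fixed_closed[OF three_ac3] that unfolding K_def by auto
  let ?A = "K \<times> K \<times> K"
  let ?f = "\<lambda>((a, x2, x3), b). ((a, x2, x3), (b, a * b - x2, a * b ^ 2 - x3))"
  have "q * q ^ 3 = card (?A \<times> K)" using cardK by (simp add: card_cartesian_product power3_eq_cube)
  also have "\<dots> \<le> card {(x, y). x \<in> ?A \<and> y \<in> ?A \<and> quadrangle x y}"
  proof (rule card_inj_on_le[of ?f])
    show "inj_on ?f (?A \<times> K)" by (auto intro!: inj_onI)
    show "?f ` (?A \<times> K) \<subseteq> {(x, y). x \<in> ?A \<and> y \<in> ?A \<and> quadrangle x y}"
      using closed by auto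
    show "finite {(x, y). x \<in> ?A \<and> y \<in> ?A \<and> quadrangle x y}"
      by (rule finite_subset[of _ "?A \<times> ?A"]) (use cardK in auto)
  qed
  finally have many: "q * q ^ 3 \<le> card {(x, y). x \<in> ?A \<and> y \<in> ?A \<and> quadrangle x y}" .
  have "(3 :: nat) ^ 4 \<le> 3 ^ j" using assms(1) by (intro power_increasing) auto
  then have "q * q ^ 3 \<le> 6 * g n (complete_graph 3) (cycle_graph (2 * 3))"
    using assms(2) cardK
    by (intro blow_up_strategy[OF _ girth_quadrangle _ _ _ _ many])
      (auto simp: q_def card_cartesian_product power3_eq_cube)
  then show ?thesis by (simp add: q_def numeral_eq_Suc)
qed

lemma lower_bound_10:
  assumes "4 \<le> j" "13 * (3 ^ j) ^ 5 \<le> n"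
  shows "(3 ^ j) ^ 6 \<le> 6 * g n (complete_graph 3) (cycle_graph 10)"
proof -
  define K where "K = (frob_fixed j :: ac3 set)"
  define q :: nat where "q = 3 ^ j"
  have cardK: "card K = q" "finite K"
    using card_frob_fixed[OF three_ac3, of j] assms(1) by (auto simp: K_def q_def)
  have closed: "x * y \<in> K" "x - y \<in> K" "x ^ i \<in> K" if "x \<in> K" "y \<in> K" for x y i
    using frob_fixed_closed[OF three_ac3] that unfolding K_def by auto
  let ?A = "K \<times> K \<times> K \<times> K \<times> K"
  let ?f = "\<lambda>((a, x2, x3, x4, x5), b). ((a, x2, x3, x4, x5),
    (b, a * b - x2, a * b ^ 2 - x3, a * b ^ 3 - x4, a ^ 2 * b ^ 3 - x5))"
  have q5: "card ?A = q ^ 5" using cardK by (simp add: card_cartesian_product numeral_eq_Suc)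
  have "q * q ^ 5 = card (?A \<times> K)" using cardK q5 by (simp add: card_cartesian_product)
  also have "\<dots> \<le> card {(x, y). x \<in> ?A \<and> y \<in> ?A \<and> hexagon x y}"
  proof (rule card_inj_on_le[of ?f])
    show "inj_on ?f (?A \<times> K)" by (auto intro!: inj_onI)
    show "?f ` (?A \<times> K) \<subseteq> {(x, y). x \<in> ?A \<and> y \<in> ?A \<and> hexagon x y}"
      using closed by auto
    show "finite {(x, y). x \<in> ?A \<and> y \<in> ?A \<and> hexagon x y}"
      by (rule finite_subset[of _ "?A \<times> ?A"]) (use cardK in auto)
  qed
  finally have many: "q * q ^ 5 \<le> card {(x, y). x \<in> ?A \<and> y \<in> ?A \<and> hexagon x y}" .
  have "(3 :: nat) ^ 4 \<le> 3 ^ j" using assms(1) by (intro power_increasing) auto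
  then have "q * q ^ 5 \<le> 6 * g n (complete_graph 3) (cycle_graph (2 * 5))"
    using assms(2) cardK q5
    by (intro blow_up_strategy[OF _ girth_hexagon[OF three_ac3] _ _ _ _ many]) (auto simp: q_def)
  then show ?thesis by (simp add: q_def numeral_eq_Suc)
qed

text \<open>The powers of three are dense enough: below every large \<open>n\<close> there is an admissible \<open>q = 3 ^ j\<close> which
  is best possible up to a factor of three.\<close>

lemma bigtheta_from_powers_of_three:
  fixes G :: "nat \<Rightarrow> nat"
  assumes k: "1 \<le> k" and M: "1 \<le> M"
    and lower: "\<And>j n. 4 \<le> j \<Longrightarrow> M * (3 ^ j) ^ k \<le> n \<Longrightarrow> (3 ^ j) ^ (k + 1) \<le> c * G n"
    and upper: "\<And>n. real (G n) \<le> c' * real n powr (1 + 1 / real k)"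
  shows "(\<lambda>n. real (G n)) \<in> \<Theta>(\<lambda>n. real n powr (1 + 1 / real k))"
proof (rule bigthetaI)
  show "(\<lambda>n. real (G n)) \<in> O(\<lambda>n. real n powr (1 + 1 / real k))"
    using upper by (intro bigoI[of _ c'] always_eventually allI) simp
  define \<beta> where "\<beta> = 1 + 1 / real k"
  define C where "C = (real M * 3 ^ k) powr \<beta> * real c"
  have "(\<lambda>n. real n powr \<beta>) \<in> O(\<lambda>n. real (G n))"
  proof (rule bigoI[of _ C], rule eventually_sequentiallyI[of "M * (3 ^ 4) ^ k"])
    fix n assume n: "M * (3 ^ 4) ^ k \<le> n"
    define J where "J = {j. M * (3 ^ j) ^ k \<le> n}"
    have "j \<le> n" if "j \<in> J" for j
    proof -
      have "j < (3 :: nat) ^ j" by (rule less_exp[THEN order_less_le_trans]) (rule power_mono, auto)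
      also have "\<dots> \<le> (3 ^ j) ^ k" using k by (intro self_le_power) auto
      also have "\<dots> \<le> M * (3 ^ j) ^ k" using M by simp
      also have "\<dots> \<le> n" using that by (simp add: J_def)
      finally show ?thesis by simp
    qed
    then have finJ: "finite J" by (intro finite_subset[of J "{..n}"]) auto
    define j where "j = Max J"
    have "4 \<in> J" using n by (simp add: J_def)
    then have j: "j \<in> J" "4 \<le> j" unfolding j_def using finJ by (auto intro: Max_in)
    have "Suc j \<notin> J" using Max_ge[OF finJ, of "Suc j"] by (auto simp: j_def)
    then have "n \<le> M * (3 ^ Suc j) ^ k" by (simp add: J_def)
    then have "real n \<le> real (M * (3 ^ Suc j) ^ k)" by (simp only: of_nat_le_iff)
    also have "\<dots> = (real M * 3 ^ k) * (3 ^ j) ^ k" by (simp add: power_mult_distrib)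
    finally have "real n powr \<beta> \<le> ((real M * 3 ^ k) * (3 ^ j) ^ k) powr \<beta>"
      by (intro powr_mono2) (auto simp: \<beta>_def)
    also have "\<dots> = (real M * 3 ^ k) powr \<beta> * ((3 ^ j) ^ k) powr \<beta>" by (simp add: powr_mult)
    also have "((3 ^ j) ^ k :: real) powr \<beta> = (3 ^ j) ^ (k + 1)"
    proof -
      have "((3 ^ j) ^ k :: real) powr \<beta> = ((3 ^ j) powr real k) powr \<beta>" by (simp add: powr_realpow)
      also have "\<dots> = (3 ^ j) powr (real (k + 1))"
        using k unfolding powr_powr \<beta>_def by (simp add: field_simps)
      also have "\<dots> = (3 ^ j) ^ (k + 1)" by (rule powr_realpow) simp
      finally show ?thesis .
    qed
    also have "(3 ^ j) ^ (k + 1) \<le> real c * real (G n)"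
    proof -
      have "(3 ^ j) ^ (k + 1) \<le> c * G n" using j by (intro lower) (auto simp: J_def)
      then have "real ((3 ^ j) ^ (k + 1)) \<le> real (c * G n)" by (simp only: of_nat_le_iff)
      then show ?thesis by simp
    qed
    finally show "norm (real n powr \<beta>) \<le> C * norm (real (G n))"
      by (simp add: C_def mult_left_mono mult.assoc)
  qed
  then show "(\<lambda>n. real (G n)) \<in> \<Omega>(\<lambda>n. real n powr (1 + 1 / real k))"
    by (simp add: bigomega_iff_bigo \<beta>_def)
qed

theorem corollary1p4:
  fixes k :: nat
  assumes "k \<in> {2, 3, 5}"
  shows "(\<lambda>n. real (g n (complete_graph 3) (cycle_graph (2 * k))))
           \<in> \<Theta>(\<lambda>n. real n powr (1 + 1 / real k))"
proof -
  have upper: "real (g n (complete_graph 3) (cycle_graph (2 * k)))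
      \<le> (160 * real k ^ 2) * real n powr (1 + 1 / real k)" for n
    using assms by (intro upper_bound) auto
  from assms consider "k = 2" | "k = 3" | "k = 5" by blast
  then show ?thesis
  proof cases
    case 1
    show ?thesis
      by (rule bigtheta_from_powers_of_three[where M = 2 and c = 972, OF _ _ _ upper])
        (use lower_bound_4 in \<open>auto simp: 1\<close>)
  next
    case 2
    show ?thesis
      by (rule bigtheta_from_powers_of_three[where M = 13 and c = 6, OF _ _ _ upper])
        (use lower_bound_6 in \<open>auto simp: 2\<close>)
  next
    case 3
    show ?thesis
      by (rule bigtheta_from_powers_of_three[where M = 13 and c = 6, OF _ _ _ upper])
        (use lower_bound_10 in \<open>auto simp: 3\<close>)
  qed
qed

end
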